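(* In Model II (described in the context), for every fixed number $i\ge 0$ of high-priority customers, let $p_{(i,n)}$ denote $\pi_{2,(0,n)}^{(0)}$ if $i=0$ and $\pi_{1,(i,n)}^{(0)}$ if $i\ge 1$. With $D,\eta_1,\eta_2,b_1,b_2$ and the other quantities as defined in the context, the following holds as $n\to\infty$. 1. (Exact geometric decay) If $D>0$, then $p_{(i,n)}\sim C_{2,l,1}\,[u(\eta_1)]^i\,\eta_1^n$. 2. (Geometric decay with prefactor $n^{-1/2}$) If $D=0$, then $p_{(i,n)}\sim C_{2,l,2}\,(\sqrt{\rho_1})^i\,n^{-1/2}\,b_1^n$. 3. (Geometric decay with prefactor $n^{-3/2}$) If $D<0$, then $p_{(i,n)}\sim C_{2,l,3}\,(1+i\widetilde B)\,(\sqrt{\rho_1})^i\,n^{-3/2}\,b_1^n$. Here $$C_{2,l,1}=2aF(1/\eta_1)\beta(1/\eta_1),\qquad C_{2,l,2}=\frac{a\lambda_2\sqrt{1-b_2/b_1}}{\sqrt{\pi}\,b_1\sqrt{b_1b_2}}\,\beta(1/b_1),\qquad C_{2,l,3}=[a\sigma(\eta_1)+b\sigma(\eta_2)]\,\beta(1/b_1),$$ $$u(\eta)=\frac{1-\mu_2-(\lambda_2/\eta)-\sqrt{\left[1-\mu_2-(\lambda_2/\eta)\right]^2-4\lambda_1\mu_1}}{2\mu_1},\qquad \widetilde B=\frac{\mu_2-\mu_1-\mu_2b_1+\sqrt{\lambda_1\mu_1}}{\sqrt{\lambda_1\mu_1}}.$$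
   Context: Model II is the following preemptive priority queue with $N$-policy vacation ($N\ge1$ an integer). High-priority and low-priority customers arrive according to independent Poisson processes with rates $\lambda_1>0$ and $\lambda_2>0$; service times are exponential with rates $\mu_1>0$ and $\mu_2>0$ respectively, all independent. A single server serves each class FCFS, with high-priority customers having preemptive priority over low-priority ones. The server takes a vacation once the system becomes empty, and goes back to work as soon as either the number of low-priority customers reaches $N$ or a high-priority customer arrives; it then works until the system is empty again. Put $\rho_1=\lambda_1/\mu_1$, $\rho_2=\lambda_2/\mu_2$ and assume $\rho_1+\rho_2<1$. Time is scaled so that $\lambda_1+\lambda_2+\mu_1+\mu_2=1$ (standing assumption). Stationary probabilities: $\pi_{1,(i,n)}^{(0)}$ ($i\ge1,n\ge0$) is the probability that the server is serving a high-priority customer with $i$ high- and $n$ low-priority customers present; $\pi_{2,(0,n)}^{(0)}$ ($n\ge1$) is the probability that the server is serving a low-priority customer with no high- and $n$ low-priority customers present. Notation: $\lambda=\lambda_1+\lambda_2$, $r_2=\lambda_2/\lambda$, $H(y)=\sum_{k=0}^{N-1}(r_2y)^k$, $\beta(y)=H(y)/H(1)$; $$b_1=\frac{\lambda_2}{\lambda_2+(\sqrt{\mu_1}-\sqrt{\lambda_1})^2},\qquad b_2=\frac{\lambda_2}{\lambda_2+(\sqrt{\mu_1}+\sqrt{\lambda_1})^2};$$ $$F(y)=\lambda_2y^2-(1-2\mu_1+\mu_2)y+2\mu_2;$$ $$\eta_{1}=\frac{(1-2\mu_1)+\sqrt{(1-2\mu_1)^2+4(\mu_1-\mu_2)\lambda_2}}{2\mu_2},\qquad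 \eta_{2}=\frac{(1-2\mu_1)-\sqrt{(1-2\mu_1)^2+4(\mu_1-\mu_2)\lambda_2}}{2\mu_2};$$ $$a=\frac{1-\rho_1-\rho_2}{2\mu_2}\,\frac{\eta_1}{\eta_1-\eta_2},\qquad b=\frac{1-\rho_1-\rho_2}{2\mu_2}\,\frac{\eta_2}{\eta_2-\eta_1};$$ $$D=(\lambda+\mu_1-2\sqrt{\lambda_1\mu_1})(\mu_1-\mu_2-\sqrt{\lambda_1\mu_1})+\lambda_2\mu_2;$$ $$\sigma(\eta)=\frac{K(\eta)}{b_1\sqrt{\pi}},\qquad K(\eta)=\frac{\lambda_2b_1\sqrt{1-b_2/b_1}}{2\sqrt{b_1b_2}\,(\eta-b_1)}.$$ The notation $f(n)\sim g(n)$ means $\lim_{n\to\infty}f(n)/g(n)=1$. *)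

theory Defs
  imports "HOL-Analysis.Analysis"
begin

section \<open>Stationary distributions of continuous-time Markov chains\<close>

text \<open>
  \<open>q s t\<close> is the transition rate from \<open>s\<close> to \<open>t\<close> for \<open>s \<noteq> t\<close>; the diagonal of \<open>q\<close> is ignored.
  A stationary distribution is a probability distribution \<open>\<pi>\<close> on the state space \<open>S\<close> with
  \<open>\<pi> Q = 0\<close>; its values outside \<open>S\<close> are unconstrained.  For the non-explosive chain below, with
  bounded rates and irreducible on its state space, such a \<open>\<pi>\<close> is unique.
\<close>

definition generator :: "'s set \<Rightarrow> ('s \<Rightarrow> 's \<Rightarrow> real) \<Rightarrow> 's \<Rightarrow> 's \<Rightarrow> real" where
  "generator S q s t = (if s = t then - (\<Sum>\<^sub>\<infinity>v\<in>S - {s}. q s v) else q s t)"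

definition stationary_distribution :: "'s set \<Rightarrow> ('s \<Rightarrow> 's \<Rightarrow> real) \<Rightarrow> ('s \<Rightarrow> real) \<Rightarrow> bool" where
  "stationary_distribution S q \<pi> \<longleftrightarrow>
     (\<forall>s\<in>S. \<pi> s \<ge> 0) \<and> (\<pi> has_sum 1) S \<and>
     (\<forall>t\<in>S. ((\<lambda>s. \<pi> s * generator S q s t) has_sum 0) S)"


section \<open>The preemptive priority queue with N-policy vacation\<close>

datatype server = Vacation | Serving_High | Serving_Low

text \<open>A state \<open>(m, i, n)\<close>: server status, number of high- and of low-priority customers present.\<close>

type_synonym state = "server \<times> nat \<times> nat"

definition queue_states :: "nat \<Rightarrow> state set" where
  "queue_states N =
     {(Vacation, 0, n) | n. n < N} \<union>
     {(Serving_High, i, n) | i n. i \<ge> 1} \<union>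
     {(Serving_Low, 0, n) | n. n \<ge> 1}"

text \<open>What a non-vacationing server does when \<open>i\<close> high- and \<open>n\<close> low-priority customers are
  present: high priority is preemptive, and a vacation starts as soon as the system is empty.\<close>

definition server_action :: "nat \<Rightarrow> nat \<Rightarrow> server" where
  "server_action i n = (if i > 0 then Serving_High else if n > 0 then Serving_Low else Vacation)"

fun high_arrival :: "state \<Rightarrow> state" where
  "high_arrival (m, i, n) = (server_action (i + 1) n, i + 1, n)"

fun low_arrival :: "nat \<Rightarrow> state \<Rightarrow> state" where
  "low_arrival N (m, i, n) =
     (if m = Vacation \<and> n + 1 < N then Vacation else server_action i (n + 1), i, n + 1)"

fun high_departure :: "state \<Rightarrow> state" where
  "high_departure (m, i, n) = (server_action (i - 1) n, i - 1, n)"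

fun low_departure :: "state \<Rightarrow> state" where
  "low_departure (m, i, n) = (server_action i (n - 1), i, n - 1)"

definition queue_rate ::
  "real \<Rightarrow> real \<Rightarrow> real \<Rightarrow> real \<Rightarrow> nat \<Rightarrow> state \<Rightarrow> state \<Rightarrow> real" where
  "queue_rate l1 l2 m1 m2 N s t =
     (if t = high_arrival s then l1 else 0) +
     (if t = low_arrival N s then l2 else 0) +
     (if fst s = Serving_High \<and> t = high_departure s then m1 else 0) +
     (if fst s = Serving_Low \<and> t = low_departure s then m2 else 0)"

definition queue_stationary ::
  "real \<Rightarrow> real \<Rightarrow> real \<Rightarrow> real \<Rightarrow> nat \<Rightarrow> (state \<Rightarrow> real) \<Rightarrow> bool" where
  "queue_stationary l1 l2 m1 m2 N \<pi> \<longleftrightarrow>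
     stationary_distribution (queue_states N) (queue_rate l1 l2 m1 m2 N) \<pi>"

definition joint_prob :: "(state \<Rightarrow> real) \<Rightarrow> nat \<Rightarrow> nat \<Rightarrow> real" where
  "joint_prob \<pi> i n = (if i = 0 then \<pi> (Serving_Low, 0, n) else \<pi> (Serving_High, i, n))"


section \<open>Constants of the asymptotic expansion\<close>

text \<open>
  \<open>l1, l2\<close> are the arrival rates and \<open>m1, m2\<close> the service rates.  The formulas involving
  \<open>1 - 2 * m1\<close> or \<open>1 - m2\<close> rely on the normalisation \<open>l1 + l2 + m1 + m2 = 1\<close>.
\<close>

context
  fixes l1 l2 m1 m2 :: real and N :: nat
begin

definition rho1 :: real where "rho1 = l1 / m1"

definition rho2 :: real where "rho2 = l2 / m2"

definition r2 :: real where "r2 = l2 / (l1 + l2)"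

definition H_fun :: "real \<Rightarrow> real" where
  "H_fun y = (\<Sum>k = 0..<N. (r2 * y) ^ k)"

definition beta_fun :: "real \<Rightarrow> real" where
  "beta_fun y = H_fun y / H_fun 1"

definition b1 :: real where
  "b1 = l2 / (l2 + (sqrt m1 - sqrt l1)\<^sup>2)"

definition b2 :: real where
  "b2 = l2 / (l2 + (sqrt m1 + sqrt l1)\<^sup>2)"

definition F_fun :: "real \<Rightarrow> real" where
  "F_fun y = l2 * y\<^sup>2 - (1 - 2 * m1 + m2) * y + 2 * m2"

definition eta1 :: real where
  "eta1 = ((1 - 2 * m1) + sqrt ((1 - 2 * m1)\<^sup>2 + 4 * (m1 - m2) * l2)) / (2 * m2)"

definition eta2 :: real where
  "eta2 = ((1 - 2 * m1) - sqrt ((1 - 2 * m1)\<^sup>2 + 4 * (m1 - m2) * l2)) / (2 * m2)"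

definition a_const :: real where
  "a_const = (1 - rho1 - rho2) / (2 * m2) * (eta1 / (eta1 - eta2))"

definition b_const :: real where
  "b_const = (1 - rho1 - rho2) / (2 * m2) * (eta2 / (eta2 - eta1))"

definition D_const :: real where
  "D_const = (l1 + l2 + m1 - 2 * sqrt (l1 * m1)) * (m1 - m2 - sqrt (l1 * m1)) + l2 * m2"

definition K_fun :: "real \<Rightarrow> real" where
  "K_fun \<eta> = l2 * b1 * sqrt (1 - b2 / b1) / (2 * sqrt (b1 * b2) * (\<eta> - b1))"

definition sigma_fun :: "real \<Rightarrow> real" where
  "sigma_fun \<eta> = K_fun \<eta> / (b1 * sqrt pi)"

definition u_fun :: "real \<Rightarrow> real" where
  "u_fun \<eta> = (1 - m2 - l2 / \<eta> - sqrt ((1 - m2 - l2 / \<eta>)\<^sup>2 - 4 * l1 * m1)) / (2 * m1)"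

definition B_tilde :: real where
  "B_tilde = (m2 - m1 - m2 * b1 + sqrt (l1 * m1)) / sqrt (l1 * m1)"

definition C_2l1 :: real where
  "C_2l1 = 2 * a_const * F_fun (1 / eta1) * beta_fun (1 / eta1)"

definition C_2l2 :: real where
  "C_2l2 = a_const * l2 * sqrt (1 - b2 / b1) / (sqrt pi * b1 * sqrt (b1 * b2)) * beta_fun (1 / b1)"

definition C_2l3 :: real where
  "C_2l3 = (a_const * sigma_fun eta1 + b_const * sigma_fun eta2) * beta_fun (1 / b1)"

end

text \<open>\<open>f(n) \<sim> g(n)\<close> in the sense that the quotient tends to \<open>1\<close>.  This deliberately differs from
  the library relation \<open>asymp_equiv\<close>, which also accepts indices at which both sides vanish.\<close>

definition ratio_equiv :: "(nat \<Rightarrow> real) \<Rightarrow> (nat \<Rightarrow> real) \<Rightarrow> bool" where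
  "ratio_equiv f g \<longleftrightarrow> (\<lambda>n. f n / g n) \<longlonglongrightarrow> 1"

end

theory Submission
  imports Defs
begin

text \<open>
  Write \<open>L i (z)\<close> for the generating function, in the number of low-priority customers, of the
  probabilities of having \<open>i\<close> high-priority customers in the system, idle server included.  The
  balance equations at the states with a high-priority customer form a linear recurrence in \<open>i\<close>,
  whose characteristic roots are the two solutions of
  \<open>m1 * u^2 - (1 - m2 - l2 * z) * u + l1 = 0\<close>.  Boundedness of probabilities excludes the larger root,
  so \<open>L i = L 0 * u ^ i\<close> (\<open>L_geometric\<close>).  The remaining balance equations then determine \<open>L 0\<close> up to
  the vacation polynomial \<open>V\<close>, a multiple of \<open>H_fun\<close>:
  \<open>L 0 * (z * S - F) = 2 * m2 * (z - 1) * V\<close>, where \<open>S\<close> is the square root of the discriminant.  Multiplying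
  by the conjugate \<open>z * S + F\<close> rationalises the denominator:
  \<open>(z * S - F) * (z * S + F) = 4 * m2^2 * (z - 1) * (1 - eta1 * z) * (1 - eta2 * z)\<close>.  Hence, by partial
  fractions, \<open>L i\<close> is a combination of \<open>X / (1 - eta1 * z)\<close> and \<open>X / (1 - eta2 * z)\<close> with
  \<open>X = (z * S + F) * V * u ^ i\<close>.  Evaluating at \<open>z = 1\<close> gives the normalisation
  \<open>V (1) = 1 - rho1 - rho2\<close> (\<open>V_1\<close>).

  The numerator \<open>X\<close> is of the form \<open>f + g * sqrt (1 - b1 * z)\<close> with \<open>f\<close> and \<open>g\<close> analytic beyond the branch
  point \<open>1 / b1\<close>, so its coefficients are of order \<open>n^(-3/2) * b1^n\<close>, with a constant read off from
  \<open>g (1 / b1)\<close>.  What the division by \<open>1 - eta * z\<close> does to them depends only on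
  the position of \<open>1 / eta\<close>.  A genuine pole inside the disc \<open>\<bar>z\<bar> < 1 / b1\<close> produces the order \<open>eta^n\<close>.  If \<open>1 / eta\<close> is the branch point itself and \<open>X\<close> vanishes
  there, the coefficients become tail sums, of order \<open>n^(-1/2) * b1^n\<close>.  If \<open>1 / eta\<close> is outside the
  closed disc, or is another point of it at which \<open>X\<close> vanishes, the order \<open>n^(-3/2) * b1^n\<close> survives,
  multiplied by the value of \<open>1 / (1 - eta * z)\<close> at the branch point.

  The sign of \<open>D\<close> selects the case, because \<open>F (1 / b1) = 2 * D / l2\<close> and \<open>S (1 / b1) = 0\<close>.  For
  \<open>D \<noteq> 0\<close> the point \<open>1 / eta1\<close> lies strictly between 1 and \<open>1 / b1\<close>, and \<open>F\<close> has no zero from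
  \<open>1 / eta1\<close> to \<open>1 / b1\<close> (\<open>F_nonzero\<close>); so for \<open>D > 0\<close> it is a zero of \<open>z * S - F\<close>, hence a pole, and
  for \<open>D < 0\<close> a zero of \<open>z * S + F\<close>, hence removable.  For \<open>D = 0\<close> it coincides with the branch point.
  The point \<open>1 / eta2\<close>, if it exists, is never a pole in the closed disc: either it lies outside, or
  it is negative and removable.
\<close>

unbundle no vec_syntax and fps_syntax

section \<open>Values of power series inside and on the circle of convergence\<close>

text \<open>
  Values are needed on the circle of convergence itself, at \<open>- 1 / b\<close> for instance, so evaluation is
  based on absolute summability at one point and not on the radius of convergence.
\<close>

lemma eval_fps_add_abs:
  fixes f g :: "real fps"
  assumes "summable (\<lambda>n. \<bar>f $ n * z ^ n\<bar>)" "summable (\<lambda>n. \<bar>g $ n * z ^ n\<bar>)"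
  shows "summable (\<lambda>n. \<bar>(f + g) $ n * z ^ n\<bar>)" "eval_fps (f + g) z = eval_fps f z + eval_fps g z"
proof -
  have "summable (\<lambda>n. \<bar>f $ n * z ^ n\<bar> + \<bar>g $ n * z ^ n\<bar>)"
    using assms by (rule summable_add)
  then show "summable (\<lambda>n. \<bar>(f + g) $ n * z ^ n\<bar>)"
    by (rule summable_comparison_test[rotated])
      (auto simp: ring_distribs simp del: abs_mult intro!: exI[of _ 0])
  show "eval_fps (f + g) z = eval_fps f z + eval_fps g z"
    unfolding eval_fps_def
    using suminf_add[OF summable_rabs_cancel[OF assms(1)] summable_rabs_cancel[OF assms(2)]]
    by (simp add: ring_distribs)
qed

lemma eval_fps_mult_abs:
  fixes f g :: "real fps"
  assumes "summable (\<lambda>n. \<bar>f $ n * z ^ n\<bar>)" "summable (\<lambda>n. \<bar>g $ n * z ^ n\<bar>)"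
  shows "summable (\<lambda>n. \<bar>(f * g) $ n * z ^ n\<bar>)" "eval_fps (f * g) z = eval_fps f z * eval_fps g z"
proof -
  have eq: "(\<Sum>i\<le>n. (f $ i * z ^ i) * (g $ (n - i) * z ^ (n - i))) = (f * g) $ n * z ^ n" for n
  proof -
    have "(\<Sum>i\<le>n. (f $ i * z ^ i) * (g $ (n - i) * z ^ (n - i))) = (\<Sum>i\<le>n. f $ i * g $ (n - i) * z ^ n)"
      by (intro sum.cong) (auto simp flip: power_add)
    then show ?thesis by (simp add: fps_mult_nth sum_distrib_right atLeast0AtMost)
  qed
  have n: "summable (\<lambda>n. norm (f $ n * z ^ n))" "summable (\<lambda>n. norm (g $ n * z ^ n))"
    using assms by simp_all
  have "summable (\<lambda>n. norm (\<Sum>i\<le>n. (f $ i * z ^ i) * (g $ (n - i) * z ^ (n - i))))"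
  proof (rule summable_comparison_test)
    show "summable (\<lambda>n. \<Sum>i\<le>n. \<bar>f $ i * z ^ i\<bar> * \<bar>g $ (n - i) * z ^ (n - i)\<bar>)"
      by (rule summable_Cauchy_product) (use assms in simp_all)
    show "\<exists>K. \<forall>n\<ge>K. norm (norm (\<Sum>i\<le>n. (f $ i * z ^ i) * (g $ (n - i) * z ^ (n - i))))
       \<le> (\<Sum>i\<le>n. \<bar>f $ i * z ^ i\<bar> * \<bar>g $ (n - i) * z ^ (n - i)\<bar>)"
      by (intro exI[of _ 0] allI impI) (simp, rule order_trans[OF sum_abs], simp add: abs_mult)
  qed
  then show "summable (\<lambda>n. \<bar>(f * g) $ n * z ^ n\<bar>)" unfolding eq by simp
  show "eval_fps (f * g) z = eval_fps f z * eval_fps g z"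
    using Cauchy_product[OF n] by (simp add: eval_fps_def eq)
qed

lemma abs_summable_in_disc:
  fixes f :: "real fps"
  assumes "ereal r < fps_conv_radius f" "\<bar>z\<bar> \<le> r"
  shows "summable (\<lambda>n. \<bar>f $ n * z ^ n\<bar>)"
proof -
  have "ereal (norm z) < fps_conv_radius f"
    using assms by (metis ereal_less_eq(3) le_less_trans real_norm_def)
  then show ?thesis using norm_summable_fps[of z f] by simp
qed

definition has_eval :: "real fps \<Rightarrow> real \<Rightarrow> real \<Rightarrow> bool" where
  "has_eval f z v \<longleftrightarrow> summable (\<lambda>n. \<bar>f $ n * z ^ n\<bar>) \<and> eval_fps f z = v"

lemma has_eval_add: "has_eval f z v \<Longrightarrow> has_eval g z w \<Longrightarrow> has_eval (f + g) z (v + w)"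
  using eval_fps_add_abs unfolding has_eval_def by blast

lemma has_eval_mult: "has_eval f z v \<Longrightarrow> has_eval g z w \<Longrightarrow> has_eval (f * g) z (v * w)"
  using eval_fps_mult_abs unfolding has_eval_def by blast

lemma has_eval_const: "has_eval (fps_const c) z c"
  unfolding has_eval_def using abs_summable_in_disc[of "\<bar>z\<bar>" "fps_const c" z] by simp

lemma has_eval_X: "has_eval fps_X z z"
  unfolding has_eval_def using abs_summable_in_disc[of "\<bar>z\<bar>" fps_X z] by simp

lemma has_eval_diff: "has_eval f z v \<Longrightarrow> has_eval g z w \<Longrightarrow> has_eval (f - g) z (v - w)"
  using has_eval_add[OF _ has_eval_mult[OF has_eval_const[of "- 1" z]], of f v g w]
  by (simp flip: fps_const_neg)

lemma has_eval_power: "has_eval f z v \<Longrightarrow> has_eval (f ^ k) z (v ^ k)"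
  using has_eval_const[of 1 z] by (induction k) (auto intro: has_eval_mult)

lemma has_eval_unique: "has_eval f z v \<Longrightarrow> has_eval f z w \<Longrightarrow> v = w"
  by (simp add: has_eval_def)

lemmas has_eval_intros = has_eval_add has_eval_mult has_eval_const has_eval_X has_eval_diff has_eval_power

section \<open>Binomial series and the asymptotics of their coefficients\<close>

text \<open>
  The expansion of \<open>(1 - b * z) powr c\<close>.
\<close>

definition binom_fps :: "real \<Rightarrow> real \<Rightarrow> real fps" where
  "binom_fps c b = fps_compose (fps_binomial c) (fps_const (- b) * fps_X)"

lemma binom_fps_nth: "binom_fps c b $ n = (- b) ^ n * (c gchoose n)"
  unfolding binom_fps_def by (subst fps_compose_linear) simp

lemma binom_fps_mult: "binom_fps c b * binom_fps d b = binom_fps (c + d) b"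
  unfolding binom_fps_def fps_binomial_add_mult by (subst fps_compose_mult_distrib) simp_all

lemma binom_fps_of_nat: "binom_fps (of_nat k) b = (1 - fps_const b * fps_X) ^ k"
  unfolding binom_fps_def fps_binomial_of_nat
  by (simp add: fps_compose_add_distrib flip: fps_compose_power fps_const_neg)

lemma binom_fps_1: "binom_fps 1 b = 1 - fps_const b * fps_X"
  using binom_fps_of_nat[of 1 b] by simp

lemma binom_fps_sums:
  assumes "\<bar>b * z\<bar> < 1"
  shows "(\<lambda>n. binom_fps c b $ n * z ^ n) sums (1 - b * z) powr c"
proof -
  have "(\<lambda>n. (c gchoose n) * ((- b) * z) ^ n) sums (1 + (- b) * z) powr c"
    using assms by (intro gen_binomial_real) simp
  then show ?thesis
    unfolding power_mult_distrib by (simp add: binom_fps_nth mult_ac)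
qed

lemma fps_conv_radius_binom:
  assumes "\<bar>b\<bar> * r < 1"
  shows "ereal r < fps_conv_radius (binom_fps c b)"
proof -
  \<comment> \<open>The convergence is tested at a point slightly beyond \<open>r\<close>.\<close>
  obtain s where s: "r < s" "\<bar>b\<bar> * s < 1" "s > 0"
  proof (cases "b = 0")
    case True
    then show ?thesis by (intro that[of "\<bar>r\<bar> + 1"]) auto
  next
    case False
    then have "max r 0 < 1 / \<bar>b\<bar>" using assms by (simp add: field_simps)
    then obtain s where "max r 0 < s" "s < 1 / \<bar>b\<bar>" using dense by blast
    then show ?thesis using False by (intro that[of s]) (auto simp: field_simps)
  qed
  have "summable (\<lambda>n. binom_fps c b $ n * s ^ n)"
    using binom_fps_sums[of b s c] s by (intro sums_summable) (auto simp: abs_mult)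
  then have "norm s \<le> fps_conv_radius (binom_fps c b)"
    unfolding fps_conv_radius_def by (intro conv_radius_geI) 
  then show ?thesis using s by (auto intro: less_le_trans[of _ "ereal s"])
qed

lemma eval_binom_fps: "\<bar>b * z\<bar> < 1 \<Longrightarrow> eval_fps (binom_fps c b) z = (1 - b * z) powr c"
  using binom_fps_sums[of b z c] by (simp add: eval_fps_def sums_iff)

lemma binom_fps_asymptotic:
  assumes "b > 0"
  shows "(\<lambda>n. real n powr (c + 1) * (binom_fps c b $ n / b ^ n)) \<longlonglongrightarrow> inverse (Gamma (- c))"
proof -
  have "(\<lambda>n. (c gchoose n) / ((-1)^n / exp ((c+1) * ln (real n)))) \<longlonglongrightarrow> inverse (Gamma (- c))"
    using gbinomial_asymptotic[of c] by simp
  moreover have "\<forall>\<^sub>F n in sequentially. (c gchoose n) / ((-1)^n / exp ((c+1) * ln (real n))) =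
      real n powr (c + 1) * (binom_fps c b $ n / b ^ n)"
    using eventually_gt_at_top[of 0]
  proof eventually_elim
    case (elim n)
    have "(- b) ^ n = (-1) ^ n * b ^ n" by (simp flip: power_mult_distrib)
    then show ?case using elim assms
      by (cases "even n") (auto simp: binom_fps_nth powr_def)
  qed
  ultimately show ?thesis by (rule Lim_transform_eventually)
qed

lemma root_coeff_nonpos:
  assumes "b \<ge> 0"
  shows "binom_fps (1/2) b $ Suc n \<le> 0"
proof (induction n)
  case 0
  then show ?case using assms by (simp add: binom_fps_nth)
next
  case (Suc n)
  have "binom_fps (1/2) b $ Suc (Suc n) = binom_fps (1/2) b $ Suc n * (b * (real n + 1/2) / (real n + 2))"
    by (simp add: binom_fps_nth gbinomial_Suc_rec field_simps)
  then show ?case using Suc assms by (simp only:) (rule mult_nonpos_nonneg, auto)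
qed

lemma inverse_Gamma_minus_half: "inverse (Gamma (- (1/2) :: real)) = - 1 / (2 * sqrt pi)"
proof -
  have "Gamma (- (1/2) + 1 :: real) = - (1/2) * Gamma (- (1/2))"
  proof (rule Gamma_plus1)
    show "- (1/2 :: real) \<notin> \<int>\<^sub>\<le>\<^sub>0"
    proof
      assume "- (1/2 :: real) \<in> \<int>\<^sub>\<le>\<^sub>0"
      then obtain k where "- (1/2 :: real) = of_int k" by (rule nonpos_Ints_cases)
      then have "real_of_int (2 * k) = real_of_int (- 1)" by simp
      then have "2 * k = - 1" by (simp only: of_int_eq_iff)
      then show False by presburger
    qed
  qed
  then have "Gamma (- (1/2) :: real) = - 2 * sqrt pi"
    using Gamma_one_half_real by simp
  then show ?thesis by (simp add: field_simps)
qed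

text \<open>
  Weighting the coefficients by \<open>k + 1\<close> is the operation \<open>(z * f)'\<close>, which keeps the radius of
  convergence.
\<close>

lemma summable_poly_weight:
  fixes f :: "real fps"
  assumes "ereal r < fps_conv_radius f" "r \<ge> 0"
  shows "summable (\<lambda>k. \<bar>f $ k\<bar> * r ^ k * (real k + 1) ^ m)"
  using assms(1)
proof (induction m arbitrary: f)
  case 0
  then show ?case using abs_summable_in_disc[of r f r] assms by (simp add: abs_mult)
next
  case (Suc m)
  have "ereal r < fps_conv_radius (fps_deriv (fps_X * f))"
    using Suc.prems by (intro less_le_trans[OF _ fps_conv_radius_deriv] less_le_trans[OF _ fps_conv_radius_mult]) auto
  note IH = Suc.IH[OF this]
  have coeff: "fps_deriv (fps_X * f) $ k = (real k + 1) * f $ k" for k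
    by (simp only: fps_deriv_nth) (simp add: add_ac)
  have "\<bar>fps_deriv (fps_X * f) $ k\<bar> * r ^ k * (real k + 1) ^ m = \<bar>f $ k\<bar> * r ^ k * (real k + 1) ^ Suc m" for k
    unfolding coeff by (simp add: abs_mult mult_ac)
  with IH show ?case by (simp only:)
qed

lemma shift_ratio_tendsto_1: "(\<lambda>n. real (n + k) / real n) \<longlonglongrightarrow> 1"
proof -
  have "(\<lambda>n. 1 + real k / real n) \<longlonglongrightarrow> 1 + 0"
    by (intro tendsto_add tendsto_const lim_const_over_n)
  moreover have "\<forall>\<^sub>F n in sequentially. 1 + real k / real n = real (n + k) / real n"
    using eventually_gt_at_top[of 0] by eventually_elim (auto simp: field_simps)
  ultimately show ?thesis using Lim_transform_eventually by fastforce
qed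

text \<open>
  A power-law tail survives multiplication by a function analytic beyond \<open>1 / b\<close>: only the
  initial coefficients of \<open>f\<close> matter, and they shift the tail by a bounded amount.  Dominated
  convergence applies because \<open>n \<le> (k + 1) * (n - k)\<close> for \<open>k < n\<close>, so that the weight costs at most
  \<open>(k + 1) powr p\<close>.
\<close>

lemma coeff_mult_analytic:
  fixes f x :: "real fps"
  assumes f: "ereal (1 / b) < fps_conv_radius f" and b: "b > 0" and p: "p \<ge> 0"
    and x: "(\<lambda>n. real n powr p * (x $ n / b ^ n)) \<longlonglongrightarrow> C"
  shows "(\<lambda>n. real n powr p * ((f * x) $ n / b ^ n)) \<longlonglongrightarrow> eval_fps f (1 / b) * C"
proof -
  define r where "r = 1 / b"
  have r: "r > 0" using b by (simp add: r_def)
  define g where "g n = x $ n * r ^ n" for n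
  have g: "(\<lambda>n. real n powr p * g n) \<longlonglongrightarrow> C"
    using x b by (simp add: g_def r_def power_one_over field_simps)
  obtain K where K: "\<And>n. \<bar>real n powr p * g n\<bar> \<le> K"
    using convergent_imp_Bseq[of "\<lambda>n. real n powr p * g n"] g
    by (auto simp: Bseq_def convergent_def)
  define K' where "K' = max K \<bar>g 0\<bar>"
  have K'0: "K' \<ge> 0" by (simp add: K'_def)
  define a where "a k n = (if k \<le> n then f $ k * r ^ k * (real n powr p * g (n - k)) else 0)" for k n
  have lim: "(\<lambda>n. a k n) \<longlonglongrightarrow> f $ k * r ^ k * C" for k
  proof -
    have "(\<lambda>n. real (n + k) powr p / real n powr p) \<longlonglongrightarrow> 1"
    proof -
      have "(\<lambda>n. (real (n + k) / real n) powr p) \<longlonglongrightarrow> 1 powr p"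
        by (intro tendsto_powr shift_ratio_tendsto_1) auto
      then show ?thesis by (simp add: powr_divide)
    qed
    from tendsto_mult[OF this g]
    have "(\<lambda>n. real (n + k) powr p / real n powr p * (real n powr p * g n)) \<longlonglongrightarrow> C" by simp
    moreover have "\<forall>\<^sub>F n in sequentially. real (n + k) powr p / real n powr p * (real n powr p * g n)
        = real (n + k) powr p * g n"
      using eventually_gt_at_top[of 0] by eventually_elim auto
    ultimately have "(\<lambda>n. real (n + k) powr p * g n) \<longlonglongrightarrow> C"
      by (rule Lim_transform_eventually)
    then have "(\<lambda>n. f $ k * r ^ k * (real (n + k) powr p * g n)) \<longlonglongrightarrow> f $ k * r ^ k * C"
      by (intro tendsto_mult) auto
    then have "(\<lambda>n. a k (n + k)) \<longlonglongrightarrow> f $ k * r ^ k * C" by (simp add: a_def)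
    then show ?thesis by (rule LIMSEQ_offset)
  qed
  \<comment> \<open>An integer exponent at least \<open>p\<close>, for \<open>summable_poly_weight\<close>.\<close>
  define m where "m = nat \<lceil>p\<rceil>"
  have m: "(real k + 1) powr p \<le> (real k + 1) ^ m" for k
    by (subst powr_realpow[symmetric]) (auto intro!: powr_mono simp: m_def, linarith)
  have bound: "norm (a k n) \<le> \<bar>f $ k\<bar> * r ^ k * (real k + 1) ^ m * K'" for k n
  proof (cases "k \<le> n")
    case True
    have "\<bar>real n powr p * g (n - k)\<bar> \<le> (real k + 1) powr p * K'"
    proof (cases "k = n")
      case True
      then show ?thesis using p by (auto simp: abs_mult K'_def intro!: mult_mono powr_mono2)
    next
      case False
      then have kn: "k < n" using True by simp
      have "real n \<le> (real k + 1) * real (n - k)"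
      proof -
        obtain d where "n = k + Suc d" using kn less_imp_Suc_add by auto
        then have "n \<le> (k + 1) * (n - k)" by simp
        then show ?thesis by (metis of_nat_le_iff of_nat_mult of_nat_Suc Suc_eq_plus1 add.commute)
      qed
      then have "real n powr p \<le> (real k + 1) powr p * real (n - k) powr p"
        using p by (simp add: powr_mono2 flip: powr_mult)
      then have "real n powr p * \<bar>g (n - k)\<bar> \<le> (real k + 1) powr p * (real (n - k) powr p * \<bar>g (n - k)\<bar>)"
        by (subst mult.assoc[symmetric]) (intro mult_right_mono, auto)
      also have "\<dots> \<le> (real k + 1) powr p * K'"
        using K[of "n - k"] by (intro mult_left_mono) (auto simp: K'_def abs_mult)
      finally show ?thesis by (simp add: abs_mult)
    qed
    also have "\<dots> \<le> (real k + 1) ^ m * K'"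
      using m K'0 by (intro mult_right_mono) auto
    finally have "\<bar>f $ k\<bar> * r ^ k * \<bar>real n powr p * g (n - k)\<bar> \<le> \<bar>f $ k\<bar> * r ^ k * ((real k + 1) ^ m * K')"
      using r by (intro mult_left_mono) auto
    then show ?thesis using True r by (simp add: a_def abs_mult mult_ac)
  next
    case False
    then show ?thesis using r K'0 by (simp add: a_def)
  qed
  have "(\<lambda>n. suminf (\<lambda>k. a k n)) \<longlonglongrightarrow> suminf (\<lambda>k. f $ k * r ^ k * C)"
  proof (rule tannerys_theorem[THEN conjunct2, THEN conjunct2])
    show "summable (\<lambda>k. \<bar>f $ k\<bar> * r ^ k * (real k + 1) ^ m * K')"
      using summable_poly_weight[of r f m] f r by (intro summable_mult2) (auto simp: r_def)
    show "\<forall>\<^sub>F (k, n) in sequentially \<times>\<^sub>F sequentially. norm (a k n) \<le> \<bar>f $ k\<bar> * r ^ k * (real k + 1) ^ m * K'"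
      by (intro always_eventually) (use bound in auto)
  qed (use lim in auto)
  also have "suminf (\<lambda>k. f $ k * r ^ k * C) = eval_fps f r * C"
    unfolding eval_fps_def using f r
    by (subst suminf_mult2) (auto intro!: summable_fps simp: r_def)
  also have "(\<lambda>n. suminf (\<lambda>k. a k n)) = (\<lambda>n. real n powr p * ((f * x) $ n / b ^ n))"
  proof
    fix n
    have "suminf (\<lambda>k. a k n) = (\<Sum>k\<le>n. a k n)"
      by (rule suminf_finite) (auto simp: a_def)
    also have "\<dots> = (\<Sum>k\<le>n. real n powr p * (f $ k * x $ (n - k)) * r ^ n)"
      by (intro sum.cong) (auto simp: a_def g_def mult_ac simp flip: power_add)
    also have "\<dots> = real n powr p * ((f * x) $ n / b ^ n)"
      by (simp add: fps_mult_nth sum_distrib_left sum_distrib_right atLeast0AtMost r_def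
          power_one_over sum_divide_distrib)
    finally show "suminf (\<lambda>k. a k n) = real n powr p * ((f * x) $ n / b ^ n)" .
  qed
  finally show ?thesis by (simp add: r_def)
qed

section \<open>Square-root singularities\<close>

text \<open>
  Behaviour at \<open>1 / b\<close> of a series whose only singularity in the closed disc is a square root
  there: \<open>x = \<alpha> + \<beta> * sqrt (1 - b * z)\<close> to first order.  Since the square of the root vanishes at
  \<open>1 / b\<close>, the pairs \<open>(\<alpha>, \<beta>)\<close> multiply like dual numbers.
\<close>

definition sqrt_germ :: "real \<Rightarrow> real fps \<Rightarrow> real \<Rightarrow> real \<Rightarrow> bool" where
  "sqrt_germ b x \<alpha> \<beta> \<longleftrightarrow> (\<exists>f g. x = f + g * binom_fps (1/2) b \<and>
     ereal (1 / b) < fps_conv_radius f \<and> ereal (1 / b) < fps_conv_radius g \<and>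
     eval_fps f (1 / b) = \<alpha> \<and> eval_fps g (1 / b) = \<beta>)"

lemma sqrt_germ_analytic:
  "ereal (1 / b) < fps_conv_radius f \<Longrightarrow> sqrt_germ b f (eval_fps f (1 / b)) 0"
  unfolding sqrt_germ_def by (rule exI[of _ f], rule exI[of _ 0]) simp

lemma sqrt_germ_root: "sqrt_germ b (binom_fps (1/2) b) 0 1"
  unfolding sqrt_germ_def by (rule exI[of _ 0], rule exI[of _ 1]) simp

lemma sqrt_germ_add:
  assumes "b > 0" "sqrt_germ b x \<alpha> \<beta>" "sqrt_germ b y \<gamma> \<delta>"
  shows "sqrt_germ b (x + y) (\<alpha> + \<gamma>) (\<beta> + \<delta>)"
proof -
  obtain f g where x: "x = f + g * binom_fps (1/2) b" "ereal (1 / b) < fps_conv_radius f"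
     "ereal (1 / b) < fps_conv_radius g" "eval_fps f (1 / b) = \<alpha>" "eval_fps g (1 / b) = \<beta>"
    using assms(2) unfolding sqrt_germ_def by blast
  obtain h k where y: "y = h + k * binom_fps (1/2) b" "ereal (1 / b) < fps_conv_radius h"
     "ereal (1 / b) < fps_conv_radius k" "eval_fps h (1 / b) = \<gamma>" "eval_fps k (1 / b) = \<delta>"
    using assms(3) unfolding sqrt_germ_def by blast
  have "x + y = (f + h) + (g + k) * binom_fps (1/2) b"
    using x y by (simp add: algebra_simps)
  moreover have "ereal (1 / b) < fps_conv_radius (f + h)" "ereal (1 / b) < fps_conv_radius (g + k)"
    using x y by (auto intro!: less_le_trans[OF _ fps_conv_radius_add])
  moreover have "eval_fps (f + h) (1 / b) = \<alpha> + \<gamma>" "eval_fps (g + k) (1 / b) = \<beta> + \<delta>"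
    using x y assms(1) by (auto simp: eval_fps_add)
  ultimately show ?thesis unfolding sqrt_germ_def by blast
qed

lemma sqrt_germ_mult:
  assumes "b > 0" "sqrt_germ b x \<alpha> \<beta>" "sqrt_germ b y \<gamma> \<delta>"
  shows "sqrt_germ b (x * y) (\<alpha> * \<gamma>) (\<alpha> * \<delta> + \<beta> * \<gamma>)"
proof -
  obtain f g where x: "x = f + g * binom_fps (1/2) b" "ereal (1 / b) < fps_conv_radius f"
     "ereal (1 / b) < fps_conv_radius g" "eval_fps f (1 / b) = \<alpha>" "eval_fps g (1 / b) = \<beta>"
    using assms(2) unfolding sqrt_germ_def by blast
  obtain h k where y: "y = h + k * binom_fps (1/2) b" "ereal (1 / b) < fps_conv_radius h"
     "ereal (1 / b) < fps_conv_radius k" "eval_fps h (1 / b) = \<gamma>" "eval_fps k (1 / b) = \<delta>"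
    using assms(3) unfolding sqrt_germ_def by blast
  define l where "l = 1 - fps_const b * (fps_X :: real fps)"
  have sq: "binom_fps (1/2) b * binom_fps (1/2) b = l"
    using binom_fps_mult[of "1/2" b "1/2"] binom_fps_1[of b] by (simp add: l_def)
  have "x * y = (f * h + g * k * (binom_fps (1/2) b * binom_fps (1/2) b)) + (f * k + g * h) * binom_fps (1/2) b"
    using x y by (simp add: algebra_simps)
  then have "x * y = (f * h + g * k * l) + (f * k + g * h) * binom_fps (1/2) b"
    unfolding sq .
  moreover have l: "fps_conv_radius l = \<infinity>" "eval_fps l (1 / b) = 0"
  proof -
    have "fps_conv_radius l \<ge> \<infinity>" unfolding l_def
      by (rule order_trans[OF _ fps_conv_radius_diff], rule min.boundedI)
        (simp, rule order_trans[OF _ fps_conv_radius_mult], simp)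
    then show *: "fps_conv_radius l = \<infinity>" by simp
    have "fps_conv_radius (fps_const b * fps_X :: real fps) = \<infinity>"
      using fps_conv_radius_mult[of "fps_const b" "fps_X :: real fps"] by simp
    then show "eval_fps l (1 / b) = 0" unfolding l_def using assms(1)
      by (simp add: eval_fps_diff eval_fps_mult)
  qed
  moreover have rad: "ereal (1 / b) < fps_conv_radius (f * h)" "ereal (1 / b) < fps_conv_radius (g * k)"
     "ereal (1 / b) < fps_conv_radius (f * k)" "ereal (1 / b) < fps_conv_radius (g * h)"
    using x y by (auto intro!: less_le_trans[OF _ fps_conv_radius_mult])
  moreover have rad': "ereal (1 / b) < fps_conv_radius (g * k * l)"
    using rad l by (auto intro!: less_le_trans[OF _ fps_conv_radius_mult])
  moreover have "ereal (1 / b) < fps_conv_radius (f * h + g * k * l)" "ereal (1 / b) < fps_conv_radius (f * k + g * h)"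
    using rad rad' by (auto intro!: less_le_trans[OF _ fps_conv_radius_add])
  moreover have "eval_fps (f * h + g * k * l) (1 / b) = \<alpha> * \<gamma>"
    "eval_fps (f * k + g * h) (1 / b) = \<alpha> * \<delta> + \<beta> * \<gamma>"
    using x y assms(1) rad rad' l by (auto simp: eval_fps_add eval_fps_mult)
  ultimately show ?thesis unfolding sqrt_germ_def by blast
qed

lemma sqrt_germ_const: "sqrt_germ b (fps_const c) c 0"
  using sqrt_germ_analytic[of b "fps_const c"] by simp

lemma sqrt_germ_X: "sqrt_germ b fps_X (1 / b) 0"
  using sqrt_germ_analytic[of b fps_X] by simp

lemma sqrt_germ_diff:
  assumes "b > 0" "sqrt_germ b x \<alpha> \<beta>" "sqrt_germ b y \<gamma> \<delta>"
  shows "sqrt_germ b (x - y) (\<alpha> - \<gamma>) (\<beta> - \<delta>)"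
  using sqrt_germ_add[OF assms(1,2) sqrt_germ_mult[OF assms(1) sqrt_germ_const[of b "- 1"] assms(3)]]
  by (simp flip: fps_const_neg)

lemma sqrt_germ_power:
  assumes "b > 0" "sqrt_germ b x \<alpha> \<beta>"
  shows "sqrt_germ b (x ^ k) (\<alpha> ^ k) (real k * \<alpha> ^ (k - 1) * \<beta>)"
proof (induction k)
  case 0
  then show ?case using sqrt_germ_const[of b 1] by simp
next
  case (Suc k)
  have "\<alpha> * (real k * \<alpha> ^ (k - 1) * \<beta>) + \<beta> * \<alpha> ^ k = real (Suc k) * \<alpha> ^ (Suc k - 1) * \<beta>"
    by (cases k) (auto simp: algebra_simps)
  with sqrt_germ_mult[OF assms Suc] show ?case by simp
qed

text \<open>
  The analytic part contributes nothing at this scale, and the root contributes its own coefficient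
  asymptotics multiplied by \<open>g (1 / b)\<close>.
\<close>

lemma sqrt_germ_coeff:
  assumes "b > 0" "sqrt_germ b x \<alpha> \<beta>"
  shows "(\<lambda>n. real n powr (3/2) * (x $ n / b ^ n)) \<longlonglongrightarrow> - \<beta> / (2 * sqrt pi)"
proof -
  obtain f g where x: "x = f + g * binom_fps (1/2) b" "ereal (1 / b) < fps_conv_radius f"
     "ereal (1 / b) < fps_conv_radius g" "eval_fps g (1 / b) = \<beta>"
    using assms(2) unfolding sqrt_germ_def by blast
  have "(\<lambda>n. real n powr (3/2) * ((1 :: real fps) $ n / b ^ n)) \<longlonglongrightarrow> 0"
    by (rule tendsto_eventually, rule eventually_mono[OF eventually_gt_at_top[of 0]]) simp
  from coeff_mult_analytic[OF x(2) assms(1) _ this]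
  have f: "(\<lambda>n. real n powr (3/2) * (f $ n / b ^ n)) \<longlonglongrightarrow> 0" by simp
  have "(\<lambda>n. real n powr (3/2) * ((g * binom_fps (1/2) b) $ n / b ^ n)) \<longlonglongrightarrow> \<beta> * inverse (Gamma (- (1/2)))"
    using coeff_mult_analytic[OF x(3) assms(1) _ ] binom_fps_asymptotic[OF assms(1), of "1/2"] x(4)
    by simp
  from tendsto_add[OF f this] show ?thesis
    unfolding inverse_Gamma_minus_half x by (simp add: algebra_simps add_divide_distrib)
qed

text \<open>
  Multiplying by \<open>(1 - b * z)^2\<close> turns the singular factor \<open>(1 - b * z) powr (1/2)\<close> into
  \<open>(1 - b * z) powr (5/2)\<close>, which improves the decay of the coefficients by two powers of \<open>n\<close>.
\<close>

lemma sqrt_germ_coeff_damped: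
  assumes "b > 0" "sqrt_germ b x \<alpha> \<beta>"
  shows "\<exists>C. (\<lambda>n. real n powr (7/2) * (((1 - fps_const b * fps_X)\<^sup>2 * x) $ n / b ^ n)) \<longlonglongrightarrow> C"
proof -
  obtain f g where x: "x = f + g * binom_fps (1/2) b" "ereal (1 / b) < fps_conv_radius f"
     "ereal (1 / b) < fps_conv_radius g"
    using assms(2) unfolding sqrt_germ_def by blast
  define l where "l = (1 - fps_const b * (fps_X :: real fps))\<^sup>2"
  have l2: "l = binom_fps 2 b" using binom_fps_of_nat[of 2 b] by (simp add: l_def)
  have "l * x = f * l + g * binom_fps (5/2) b"
    using binom_fps_mult[of 2 b "1/2"] unfolding x l2 by (simp add: algebra_simps)
  moreover have "(\<lambda>n. real n powr (7/2) * (l $ n / b ^ n)) \<longlonglongrightarrow> 0"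
  proof (rule tendsto_eventually, rule eventually_mono[OF eventually_gt_at_top[of 2]])
    fix n :: nat assume "2 < n"
    then have "(2 :: real) gchoose n = 0" using binomial_gbinomial[of 2 n, where 'a=real] by (simp add: binomial_eq_0)
    then have "l $ n = 0" unfolding l2 binom_fps_nth by simp
    then show "real n powr (7/2) * (l $ n / b ^ n) = 0" by simp
  qed
  from coeff_mult_analytic[OF x(2) assms(1) _ this]
  have "(\<lambda>n. real n powr (7/2) * ((f * l) $ n / b ^ n)) \<longlonglongrightarrow> 0" by simp
  moreover have "(\<lambda>n. real n powr (7/2) * ((g * binom_fps (5/2) b) $ n / b ^ n)) \<longlonglongrightarrow>
      eval_fps g (1 / b) * inverse (Gamma (- (5/2)))"
    using coeff_mult_analytic[OF x(3) assms(1) _ ] binom_fps_asymptotic[OF assms(1), of "5/2"]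
    by simp
  ultimately have "(\<lambda>n. real n powr (7/2) * ((l * x) $ n / b ^ n)) \<longlonglongrightarrow> 0 + eval_fps g (1 / b) * inverse (Gamma (- (5/2)))"
    using tendsto_add by (fastforce simp: ring_distribs add_divide_distrib)
  then show ?thesis unfolding l_def by blast
qed

lemma abs_summable_of_coeff:
  fixes x :: "real fps"
  assumes "b > 0" "(\<lambda>n. real n powr (3/2) * (x $ n / b ^ n)) \<longlonglongrightarrow> C" "\<bar>z\<bar> \<le> 1 / b"
  shows "summable (\<lambda>n. \<bar>x $ n * z ^ n\<bar>)"
proof -
  obtain K where K: "\<And>n. \<bar>real n powr (3/2) * (x $ n / b ^ n)\<bar> \<le> K"
    using convergent_imp_Bseq[of "\<lambda>n. real n powr (3/2) * (x $ n / b ^ n)"] assms(2)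
    by (auto simp: Bseq_def convergent_def)
  have "summable (\<lambda>n. K * real n powr (- (3/2)))"
    by (intro summable_mult) (simp add: summable_real_powr_iff)
  then show ?thesis
  proof (rule summable_comparison_test'[where N = 1])
    fix n :: nat assume n: "1 \<le> n"
    have "\<bar>x $ n * z ^ n\<bar> \<le> \<bar>x $ n\<bar> * (1 / b) ^ n"
      using assms(3) by (simp add: abs_mult power_abs mult_left_mono power_mono)
    also have "\<dots> = \<bar>real n powr (3/2) * (x $ n / b ^ n)\<bar> * real n powr (- (3/2))"
      using n assms(1) by (simp add: abs_mult powr_minus field_simps)
    also have "\<dots> \<le> K * real n powr (- (3/2))"
      using K by (intro mult_right_mono) auto
    finally show "norm \<bar>x $ n * z ^ n\<bar> \<le> K * real n powr (- (3/2))" by simp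
  qed
qed

lemma sqrt_germ_abs_summable:
  assumes "b > 0" "sqrt_germ b x \<alpha> \<beta>" "\<bar>z\<bar> \<le> 1 / b"
  shows "summable (\<lambda>n. \<bar>x $ n * z ^ n\<bar>)"
  using abs_summable_of_coeff[OF assms(1) sqrt_germ_coeff[OF assms(1,2)] assms(3)] .

text \<open>
  The value squares to \<open>1 - b * z\<close>, and only its sign is in question.  All coefficients
  after the first are nonpositive and sum to \<open>- 1\<close> at \<open>z = 1 / b\<close>, so the value is nonnegative on the
  whole disc.
\<close>

lemma eval_root:
  assumes "b > 0" "\<bar>z\<bar> \<le> 1 / b"
  shows "eval_fps (binom_fps (1/2) b) z = sqrt (1 - b * z)"
proof -
  let ?T = "binom_fps (1/2) b"
  have abs: "summable (\<lambda>n. \<bar>?T $ n * z ^ n\<bar>)" if "\<bar>z\<bar> \<le> 1 / b" for z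
    by (rule sqrt_germ_abs_summable[OF assms(1) sqrt_germ_root that])
  have sq: "(eval_fps ?T z)\<^sup>2 = 1 - b * z" if "\<bar>z\<bar> \<le> 1 / b" for z
  proof -
    have "(eval_fps ?T z)\<^sup>2 = eval_fps (?T * ?T) z"
      using eval_fps_mult_abs(2)[OF abs abs] that by (simp add: power2_eq_square)
    also have "?T * ?T = 1 - fps_const b * fps_X"
      using binom_fps_mult[of "1/2" b "1/2"] binom_fps_1[of b] by simp
    also have "eval_fps \<dots> z = 1 - b * z"
    proof -
      have r: "fps_conv_radius (fps_const b * fps_X :: real fps) = \<infinity>"
        using fps_conv_radius_mult[of "fps_const b" "fps_X :: real fps"] by simp
      then show ?thesis by (simp add: eval_fps_diff eval_fps_mult)
    qed
    finally show ?thesis .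
  qed
  have split: "eval_fps ?T z = 1 + (\<Sum>n. ?T $ Suc n * z ^ Suc n)" if "\<bar>z\<bar> \<le> 1 / b" for z
    using suminf_split_head[OF summable_rabs_cancel[OF abs[OF that]]]
    by (simp add: eval_fps_def binom_fps_nth)
  have "eval_fps ?T (1 / b) = 0"
    using sq[of "1 / b"] assms(1) by simp
  then have one: "(\<Sum>n. \<bar>?T $ Suc n * (1 / b) ^ Suc n\<bar>) = 1"
  proof -
    have "(\<lambda>n. \<bar>?T $ Suc n * (1 / b) ^ Suc n\<bar>) = (\<lambda>n. - (?T $ Suc n * (1 / b) ^ Suc n))"
      using root_coeff_nonpos[of b] assms(1) by (auto simp: abs_mult)
    moreover have "summable (\<lambda>n. ?T $ Suc n * (1 / b) ^ Suc n)"
      using summable_rabs_cancel[OF abs, of "1 / b"] assms(1) by (subst summable_Suc_iff) simp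
    ultimately show ?thesis
      using split[of "1 / b"] \<open>eval_fps ?T (1 / b) = 0\<close> assms(1) by (simp add: suminf_minus)
  qed
  have s: "summable (\<lambda>n. \<bar>?T $ Suc n * z ^ Suc n\<bar>)" if "\<bar>z\<bar> \<le> 1 / b" for z
    using abs[OF that] by (subst summable_Suc_iff)
  have "\<bar>\<Sum>n. ?T $ Suc n * z ^ Suc n\<bar> \<le> (\<Sum>n. \<bar>?T $ Suc n * z ^ Suc n\<bar>)"
    by (rule summable_rabs[OF s[OF assms(2)]])
  also have "\<dots> \<le> (\<Sum>n. \<bar>?T $ Suc n * (1 / b) ^ Suc n\<bar>)"
  proof (rule suminf_le[OF _ s[OF assms(2)] s])
    fix n
    have "\<bar>z\<bar> ^ Suc n \<le> (1 / b) ^ Suc n" using assms by (intro power_mono) auto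
    then show "\<bar>?T $ Suc n * z ^ Suc n\<bar> \<le> \<bar>?T $ Suc n * (1 / b) ^ Suc n\<bar>"
      using assms(1) unfolding abs_mult power_abs by (intro mult_left_mono) auto
  qed (use assms in auto)
  finally have "eval_fps ?T z \<ge> 0"
    using one split[OF assms(2)] by linarith
  then show ?thesis using sq[OF assms(2)] real_sqrt_unique by metis
qed

lemma eval_germ:
  assumes "b > 0" "sqrt_germ b x \<alpha> \<beta>"
  shows "eval_fps x (1 / b) = \<alpha>"
proof -
  obtain f g where x: "x = f + g * binom_fps (1/2) b" "ereal (1 / b) < fps_conv_radius f"
     "ereal (1 / b) < fps_conv_radius g" "eval_fps f (1 / b) = \<alpha>"
    using assms(2) unfolding sqrt_germ_def by blast
  have T: "summable (\<lambda>n. \<bar>binom_fps (1/2) b $ n * (1 / b) ^ n\<bar>)"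
    by (rule sqrt_germ_abs_summable[OF assms(1) sqrt_germ_root]) (use assms in auto)
  have f: "summable (\<lambda>n. \<bar>f $ n * (1 / b) ^ n\<bar>)" and g: "summable (\<lambda>n. \<bar>g $ n * (1 / b) ^ n\<bar>)"
    using x assms(1) by (auto intro: abs_summable_in_disc)
  show ?thesis
    unfolding x(1) eval_fps_add_abs(2)[OF f eval_fps_mult_abs(1)[OF g T]] eval_fps_mult_abs(2)[OF g T]
    using x(4) assms(1) by (simp add: eval_root)
qed

section \<open>Dividing out a linear factor\<close>

lemma quotient_coeff_rec:
  fixes x y :: "real fps"
  assumes "y * (1 - fps_const \<eta> * fps_X) = x"
  shows "y $ 0 = x $ 0" "y $ Suc n = \<eta> * y $ n + x $ Suc n"
proof -
  have x: "x = y - fps_const \<eta> * (y * fps_X)" using assms by (simp add: algebra_simps)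
  show "y $ 0 = x $ 0" "y $ Suc n = \<eta> * y $ n + x $ Suc n" unfolding x by simp_all
qed

lemma quotient_coeff:
  fixes x y :: "real fps"
  assumes "y * (1 - fps_const \<eta> * fps_X) = x" "\<eta> \<noteq> 0"
  shows "y $ n / \<eta> ^ n = (\<Sum>k\<le>n. x $ k * (1 / \<eta>) ^ k)"
proof (induction n)
  case 0
  then show ?case using quotient_coeff_rec(1)[OF assms(1)] by simp
next
  case (Suc n)
  have "y $ Suc n / \<eta> ^ Suc n = y $ n / \<eta> ^ n + x $ Suc n * (1 / \<eta>) ^ Suc n"
    using quotient_coeff_rec(2)[OF assms(1), of n] assms(2)
    by (simp add: add_divide_distrib power_one_over)
  then show ?case using Suc by simp
qed

lemma quotient_simple_pole:
  fixes x y :: "real fps"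
  assumes "y * (1 - fps_const \<eta> * fps_X) = x" "\<eta> \<noteq> 0" "summable (\<lambda>n. \<bar>x $ n * (1 / \<eta>) ^ n\<bar>)"
  shows "(\<lambda>n. y $ n / \<eta> ^ n) \<longlonglongrightarrow> eval_fps x (1 / \<eta>)"
  unfolding quotient_coeff[OF assms(1,2)] eval_fps_def
  by (rule summable_LIMSEQ'[OF summable_rabs_cancel[OF assms(3)]])

text \<open>
  At a zero of the numerator the partial sums are minus the tails.
\<close>

lemma quotient_removable:
  fixes x y :: "real fps"
  assumes "y * (1 - fps_const \<eta> * fps_X) = x" "\<eta> \<noteq> 0" "summable (\<lambda>n. \<bar>x $ n * (1 / \<eta>) ^ n\<bar>)"
    and "eval_fps x (1 / \<eta>) = 0"
  shows "y $ n / \<eta> ^ n = - (\<Sum>k. x $ (Suc n + k) * (1 / \<eta>) ^ (Suc n + k))"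
proof -
  have "(\<Sum>k. x $ k * (1 / \<eta>) ^ k) =
      (\<Sum>k. x $ (k + Suc n) * (1 / \<eta>) ^ (k + Suc n)) + (\<Sum>k<Suc n. x $ k * (1 / \<eta>) ^ k)"
    by (rule suminf_split_initial_segment[OF summable_rabs_cancel[OF assms(3)]])
  then show ?thesis
    using assms(4) unfolding quotient_coeff[OF assms(1,2)] eval_fps_def
    by (simp add: lessThan_Suc_atMost add_ac del: power_one_over)
qed

text \<open>
  The telescoping sequence \<open>2 / sqrt m - 2 / sqrt (m + 1)\<close> serves as the comparison sequence for sums of
  terms of order \<open>m^(-3/2)\<close>.
\<close>

lemma inverse_sqrt_difference_asymptotic:
  "(\<lambda>m. real m powr (3/2) * (2 / sqrt (real m) - 2 / sqrt (real (Suc m)))) \<longlonglongrightarrow> 1"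
proof -
  have ratio: "(\<lambda>m. sqrt (real (Suc m) / real m)) \<longlonglongrightarrow> sqrt 1"
    using shift_ratio_tendsto_1[of 1] by (intro tendsto_real_sqrt) simp
  then have "(\<lambda>m. 2 / (sqrt (real (Suc m) / real m) * (1 + sqrt (real (Suc m) / real m)))) \<longlonglongrightarrow> 2 / (sqrt 1 * (1 + sqrt 1))"
    by (intro tendsto_divide tendsto_mult tendsto_add tendsto_const ratio) auto
  moreover have "\<forall>\<^sub>F m in sequentially. 2 / (sqrt (real (Suc m) / real m) * (1 + sqrt (real (Suc m) / real m))) = real m powr (3/2) * (2 / sqrt (real m) - 2 / sqrt (real (Suc m)))"
    using eventually_gt_at_top[of 0]
  proof eventually_elim
    case (elim m)
    define p q where "p = sqrt (real m)" and "q = sqrt (real (Suc m))"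
    have p: "p > 0" "q > 0" "q * q - p * p = 1" "p * p = real m" using elim by (auto simp: p_def q_def)
    have "real m powr (3/2) = real m powr 1 * real m powr (1/2)"
      by (subst powr_add[symmetric]) simp
    then have pw: "real m powr (3/2) = p * p * p"
      using elim p by (simp add: powr_half_sqrt p_def)
    have "(q - p) * (q + p) = 1" using p by (simp add: algebra_simps)
    then have qp: "q - p = 1 / (q + p)" using p by (subst eq_divide_eq) auto
    have "real m powr (3/2) * (2 / sqrt (real m) - 2 / sqrt (real (Suc m))) = p * p * p * (2 / p - 2 / q)"
      by (simp only: pw p_def q_def)
    also have "2 / p - 2 / q = 2 * (q - p) / (p * q)"
      using p by (simp add: diff_frac_eq right_diff_distrib)
    also have "p * p * p * (2 * (q - p) / (p * q)) = 2 * p * p * (1 / (q + p)) / q"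
      unfolding qp using p by simp
    also have "\<dots> = 2 / ((q / p) * (1 + q / p))"
      using p(1,2) by (simp add: field_simps)
    finally show ?case by (simp only: p_def q_def real_sqrt_divide)
  qed
  ultimately have "(\<lambda>m. real m powr (3/2) * (2 / sqrt (real m) - 2 / sqrt (real (Suc m)))) \<longlonglongrightarrow> 2 / (sqrt 1 * (1 + sqrt 1))"
    by (rule Lim_transform_eventually)
  then show ?thesis by simp
qed

lemma tail_sum_asymptotic:
  fixes x :: "nat \<Rightarrow> real"
  assumes "(\<lambda>n. real n powr (3/2) * x n) \<longlonglongrightarrow> C"
  shows "(\<lambda>n. sqrt (real n) * (\<Sum>k. x (Suc n + k))) \<longlonglongrightarrow> 2 * C"
proof -
  define g where "g m = 2 / sqrt (real m) - 2 / sqrt (real (Suc m))" for m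
  have conj: "(\<lambda>m. real m powr (3/2) * g m) \<longlonglongrightarrow> 1"
    unfolding g_def by (rule inverse_sqrt_difference_asymptotic)
  have g_sums: "(\<lambda>k. g (Suc n + k)) sums (2 / sqrt (real (Suc n)))" for n
  proof -
    have "(\<lambda>k. 2 / sqrt (real (Suc n + k))) \<longlonglongrightarrow> 0"
    proof -
      have "(\<lambda>k. 2 * inverse (sqrt (real k))) \<longlonglongrightarrow> 2 * 0"
        by (intro tendsto_mult tendsto_const tendsto_inverse_0_at_top)
          (rule filterlim_compose[OF sqrt_at_top filterlim_real_sequentially])
      from LIMSEQ_ignore_initial_segment[OF this, of "Suc n"] show ?thesis
        by (simp add: divide_inverse add.commute)
    qed
    from telescope_sums'[OF this] show ?thesis by (simp add: g_def)
  qed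
  have lim': "(\<lambda>n. sqrt (real (Suc n)) * (\<Sum>k. x (Suc n + k))) \<longlonglongrightarrow> 2 * C"
  proof (rule tendstoI)
    fix e :: real assume e: "e > 0"
    have "(\<lambda>m. real m powr (3/2) * x m - C * (real m powr (3/2) * g m)) \<longlonglongrightarrow> C - C * 1"
      by (intro tendsto_intros assms conj)
    \<comment> \<open>The comparison terms \<open>m^(3/2) * g m\<close> exceed 1/2 eventually, so an error of \<open>e / 8\<close> is at most
      \<open>e / 4\<close> times such a term.\<close>
    then have small: "\<forall>\<^sub>F m in sequentially. \<bar>real m powr (3/2) * x m - C * (real m powr (3/2) * g m)\<bar> < e / 8"
      using e by (auto dest!: tendstoD[where e = "e / 8"] simp: dist_real_def)
    have "\<forall>\<^sub>F m in sequentially. real m powr (3/2) * g m > 1/2"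
      using order_tendstoD(1)[OF conj, of "1/2"] by simp
    with small have "\<forall>\<^sub>F m in sequentially. \<bar>x m - C * g m\<bar> \<le> e / 4 * g m"
      using eventually_gt_at_top[of 0]
    proof eventually_elim
      case (elim m)
      have w: "real m powr (3/2) > 0" using elim by simp
      have "real m powr (3/2) * \<bar>x m - C * g m\<bar> = \<bar>real m powr (3/2) * x m - C * (real m powr (3/2) * g m)\<bar>"
      proof -
        have "real m powr (3/2) * x m - C * (real m powr (3/2) * g m) = real m powr (3/2) * (x m - C * g m)"
          by (simp add: algebra_simps)
        then show ?thesis by (simp add: abs_mult)
      qed
      also have "\<dots> \<le> e / 8" using elim by simp
      also have "\<dots> \<le> e / 4 * (real m powr (3/2) * g m)"
        using elim e mult_left_mono[of "1/2" "real m powr (3/2) * g m" "e / 4"] by simp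
      also have "\<dots> = real m powr (3/2) * (e / 4 * g m)" by simp
      finally show ?case using w by (simp only: mult_le_cancel_left_pos)
    qed
    then obtain M where M: "\<And>m. m \<ge> M \<Longrightarrow> \<bar>x m - C * g m\<bar> \<le> e / 4 * g m"
      unfolding eventually_sequentially by blast
    show "\<forall>\<^sub>F n in sequentially. dist (sqrt (real (Suc n)) * (\<Sum>k. x (Suc n + k))) (2 * C) < e"
      using eventually_ge_at_top[of M]
    proof eventually_elim
      case (elim n)
      have b: "\<bar>x (Suc n + k) - C * g (Suc n + k)\<bar> \<le> e / 4 * g (Suc n + k)" for k
        using elim by (intro M) auto
      have sg: "(\<lambda>k. e / 4 * g (Suc n + k)) sums (e / 4 * (2 / sqrt (real (Suc n))))"
        "(\<lambda>k. C * g (Suc n + k)) sums (C * (2 / sqrt (real (Suc n))))"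
        by (intro sums_mult g_sums)+
      have sd: "summable (\<lambda>k. \<bar>x (Suc n + k) - C * g (Suc n + k)\<bar>)"
        by (rule summable_comparison_test'[OF sums_summable[OF sg(1)], of 0]) (use b in simp)
      have sx: "summable (\<lambda>k. x (Suc n + k))"
        using summable_add[OF summable_rabs_cancel[OF sd] sums_summable[OF sg(2)]] by simp
      have "\<bar>(\<Sum>k. x (Suc n + k)) - C * (2 / sqrt (real (Suc n)))\<bar> =
          \<bar>\<Sum>k. x (Suc n + k) - C * g (Suc n + k)\<bar>"
        using suminf_diff[OF sx sums_summable[OF sg(2)]] sg(2) by (simp add: sums_iff)
      also have "\<dots> \<le> (\<Sum>k. \<bar>x (Suc n + k) - C * g (Suc n + k)\<bar>)" by (rule summable_rabs[OF sd])
      also have "\<dots> \<le> e / 4 * (2 / sqrt (real (Suc n)))"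
        using suminf_le[OF b sd sums_summable[OF sg(1)]] sg(1) by (simp add: sums_iff)
      finally have "sqrt (real (Suc n)) * \<bar>(\<Sum>k. x (Suc n + k)) - C * (2 / sqrt (real (Suc n)))\<bar>
          \<le> sqrt (real (Suc n)) * (e / 4 * (2 / sqrt (real (Suc n))))"
        by (intro mult_left_mono) auto
      also have "\<dots> = e / 2" by simp
      finally have "sqrt (real (Suc n)) * \<bar>(\<Sum>k. x (Suc n + k)) - C * (2 / sqrt (real (Suc n)))\<bar> \<le> e / 2" .
      moreover have "sqrt (real (Suc n)) * \<bar>(\<Sum>k. x (Suc n + k)) - C * (2 / sqrt (real (Suc n)))\<bar> =
        \<bar>sqrt (real (Suc n)) * (\<Sum>k. x (Suc n + k)) - 2 * C\<bar>"
      proof -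
        have "sqrt (real (Suc n)) * (\<Sum>k. x (Suc n + k)) - 2 * C =
            sqrt (real (Suc n)) * ((\<Sum>k. x (Suc n + k)) - C * (2 / sqrt (real (Suc n))))"
          by (simp add: right_diff_distrib)
        then show ?thesis by (simp only: abs_mult) simp
      qed
      ultimately show ?case using e by (simp add: dist_real_def)
    qed
  qed
  have ratio: "(\<lambda>n. sqrt (real (Suc n) / real n)) \<longlonglongrightarrow> sqrt 1"
    using shift_ratio_tendsto_1[of 1] by (intro tendsto_real_sqrt) simp
  have "(\<lambda>n. inverse (sqrt (real (Suc n) / real n)) * (sqrt (real (Suc n)) * (\<Sum>k. x (Suc n + k)))) \<longlonglongrightarrow> inverse (sqrt 1) * (2 * C)"
    by (intro tendsto_mult tendsto_inverse ratio lim') simp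
  moreover have "\<forall>\<^sub>F n in sequentially. inverse (sqrt (real (Suc n) / real n)) * (sqrt (real (Suc n)) * (\<Sum>k. x (Suc n + k)))
     = sqrt (real n) * (\<Sum>k. x (Suc n + k))"
    using eventually_gt_at_top[of 0] by eventually_elim (simp add: real_sqrt_divide)
  ultimately have "(\<lambda>n. sqrt (real n) * (\<Sum>k. x (Suc n + k))) \<longlonglongrightarrow> inverse (sqrt 1) * (2 * C)"
    by (rule Lim_transform_eventually)
  then show ?thesis by simp
qed

text \<open>
  A pole that meets the branch point cancels half a power: the coefficients become tail sums of
  terms of order \<open>n^(-3/2)\<close>.
\<close>

lemma quotient_critical:
  fixes x y :: "real fps"
  assumes "b > 0" "sqrt_germ b x 0 \<beta>" "y * (1 - fps_const b * fps_X) = x"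
  shows "(\<lambda>n. sqrt (real n) * (y $ n / b ^ n)) \<longlonglongrightarrow> \<beta> / sqrt pi"
proof -
  have s: "summable (\<lambda>n. \<bar>x $ n * (1 / b) ^ n\<bar>)"
    using assms by (intro sqrt_germ_abs_summable[OF assms(1,2)]) auto
  have y: "y $ n / b ^ n = - (\<Sum>k. x $ (Suc n + k) * (1 / b) ^ (Suc n + k))" for n
    using assms by (intro quotient_removable[OF assms(3) _ s] eval_germ[OF assms(1,2)]) auto
  have "(\<lambda>n. real n powr (3/2) * (x $ n * (1 / b) ^ n)) \<longlonglongrightarrow> - \<beta> / (2 * sqrt pi)"
    using sqrt_germ_coeff[OF assms(1,2)] by (simp add: power_one_over)
  from tendsto_minus[OF tail_sum_asymptotic[OF this]] show ?thesis unfolding y by simp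
qed

lemma sum_inverse_cubes_tail:
  assumes "n \<ge> 1"
  shows "summable (\<lambda>k. 1 / real (Suc n + k) ^ 3)" "(\<Sum>k. 1 / real (Suc n + k) ^ 3) \<le> 1 / real n ^ 2"
proof -
  have inv: "(\<lambda>k. 1 / real (n + k)) \<longlonglongrightarrow> 0"
    using lim_const_over_n[of 1] LIMSEQ_ignore_initial_segment[of "\<lambda>k. 1 / real k" 0 n] by (simp add: add.commute)
  have tel: "(\<lambda>k. 1 / real n * (1 / real (n + k) - 1 / real (n + Suc k))) sums (1 / real n * (1 / real (n + 0) - 0))"
    by (intro sums_mult telescope_sums'[OF inv])
  have le: "1 / real (Suc n + k) ^ 3 \<le> 1 / real n * (1 / real (n + k) - 1 / real (n + Suc k))" for k
  proof -
    have "1 / real (n + k) - 1 / real (n + Suc k) = 1 / (real (n + k) * real (Suc n + k))"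
      using assms by (simp add: field_simps)
    moreover have "real n * (real (n + k) * real (Suc n + k)) \<le> real (Suc n + k) ^ 3"
      unfolding power3_eq_cube mult.assoc[symmetric] by (intro mult_mono) auto
    ultimately show ?thesis using assms
      by (simp add: divide_simps)
  qed
  show *: "summable (\<lambda>k. 1 / real (Suc n + k) ^ 3)"
    by (rule summable_comparison_test'[OF sums_summable[OF tel], of 0]) (use le in simp)
  show "(\<Sum>k. 1 / real (Suc n + k) ^ 3) \<le> 1 / real n ^ 2"
    using suminf_le[OF le * sums_summable[OF tel]] tel by (simp add: sums_iff power2_eq_square)
qed

text \<open>
  Here \<open>1 / (1 - \<eta> * z)\<close> is itself analytic beyond the branch point.
\<close>

lemma quotient_pole_outside:
  fixes x :: "real fps"
  assumes b: "b > 0" and germ: "sqrt_germ b x \<alpha> \<beta>" and y: "y * (1 - fps_const \<eta> * fps_X) = x"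
    and \<eta>: "\<bar>\<eta>\<bar> < b"
  shows "(\<lambda>n. real n powr (3/2) * (y $ n / b ^ n)) \<longlonglongrightarrow> - \<beta> / (2 * sqrt pi) / (1 - \<eta> / b)"
proof -
  have lt: "\<bar>\<eta>\<bar> * (1 / b) < 1" using \<eta> b by simp
  have lt': "\<bar>\<eta> * (1 / b)\<bar> < 1" using lt b by (simp add: abs_mult)
  have "binom_fps (- 1) \<eta> * x = binom_fps (- 1) \<eta> * binom_fps 1 \<eta> * y"
    using y by (simp add: binom_fps_1 mult_ac)
  then have "y = binom_fps (- 1) \<eta> * x"
    using binom_fps_of_nat[of 0] by (simp add: binom_fps_mult)
  moreover have "sqrt_germ b (binom_fps (- 1) \<eta>) (1 / (1 - \<eta> / b)) 0"
    using sqrt_germ_analytic[OF fps_conv_radius_binom[OF lt, of "- 1"]] eval_binom_fps[OF lt', of "- 1"] lt' b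
    by (simp add: powr_minus divide_inverse abs_less_iff)
  ultimately have "sqrt_germ b y (1 / (1 - \<eta> / b) * \<alpha>) (1 / (1 - \<eta> / b) * \<beta> + 0 * \<alpha>)"
    using sqrt_germ_mult[OF b _ germ] by metis
  from sqrt_germ_coeff[OF b this] show ?thesis by (simp add: mult.commute)
qed

text \<open>
  With \<open>k = \<eta> / b\<close> and \<open>l = 1 - b * z\<close> the factor \<open>1 - \<eta> * z\<close> is \<open>(1 - k) + k * l\<close>; this expands the
  quotient in powers of \<open>l\<close> with remainder \<open>l^2 * y\<close>.
\<close>

lemma second_order_expansion:
  fixes x y k l :: "'a :: comm_ring_1"
  assumes "x = y * (1 - k) + k * l * y"
  shows "(1 - k)\<^sup>2 * y = (1 - k) * x - k * (l * x) + k\<^sup>2 * (l\<^sup>2 * y)"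
  unfolding assms by (simp add: algebra_simps power2_eq_square)

text \<open>
  Up to sign, the coefficient of \<open>y\<close> at \<open>n\<close>, divided by \<open>b^n\<close>, is the sum over \<open>j > 0\<close> of
  \<open>x $ (n + j) / b^(n + j) * (b / \<eta>)^j\<close>, which for \<open>\<eta> = - b\<close> alternates without geometric decay.  The
  expansion \<open>second_order_expansion\<close> avoids estimating it directly: in the remainder
  \<open>(1 - b * z)^2 * y\<close> the terms of the tail are so small, of order \<open>n^(-7/2)\<close>, that bounding them by
  absolute values already gives \<open>o(n^(-3/2))\<close>.  Thus one argument covers all \<open>\<eta> \<noteq> b\<close> with
  \<open>\<bar>\<eta>\<bar> \<ge> b\<close>.
\<close>

lemma quotient_removable_germ:
  fixes x y :: "real fps"
  assumes b: "b > 0" and germ: "sqrt_germ b x \<alpha> \<beta>" and y: "y * (1 - fps_const \<eta> * fps_X) = x"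
    and \<eta>: "\<eta> \<noteq> b" "\<bar>\<eta>\<bar> \<ge> b" and zero: "eval_fps x (1 / \<eta>) = 0"
  shows "(\<lambda>n. real n powr (3/2) * (y $ n / b ^ n)) \<longlonglongrightarrow> - \<beta> / (2 * sqrt pi) / (1 - \<eta> / b)"
proof -
  define h where "h = \<eta> / b"
  define l where "l = 1 - fps_const b * (fps_X :: real fps)"
  have h: "h \<noteq> 1" "\<bar>h\<bar> \<ge> 1" "\<eta> = h * b" and \<eta>0: "\<eta> \<noteq> 0" using \<eta> b by (auto simp: h_def)
  have germ_l: "sqrt_germ b l 0 0"
    using sqrt_germ_diff[OF b sqrt_germ_const[of b 1] sqrt_germ_mult[OF b sqrt_germ_const[of b b] sqrt_germ_X]] b
    by (simp add: l_def)
  have \<eta>_abs: "\<bar>1 / \<eta>\<bar> \<le> 1 / b" using \<eta> b \<eta>0 by (simp add: frac_le)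
  note sx = sqrt_germ_abs_summable[OF b germ \<eta>_abs]
  have germ_l2x: "sqrt_germ b (l\<^sup>2 * x) 0 0" and germ_lx: "sqrt_germ b (l * x) 0 0"
    using sqrt_germ_mult[OF b germ_l germ] sqrt_germ_mult[OF b sqrt_germ_power[OF b germ_l, of 2] germ] by simp_all
  have "eval_fps (l\<^sup>2 * x) (1 / \<eta>) = 0"
    using eval_fps_mult_abs(2)[OF sqrt_germ_abs_summable[OF b sqrt_germ_power[OF b germ_l, of 2] \<eta>_abs] sx] zero
    by simp
  have "(l\<^sup>2 * y) * (1 - fps_const \<eta> * fps_X) = l\<^sup>2 * x" using y by (simp add: mult.assoc)
  note tail = quotient_removable[OF this \<eta>0 sqrt_germ_abs_summable[OF b germ_l2x \<eta>_abs] \<open>eval_fps (l\<^sup>2 * x) (1 / \<eta>) = 0\<close>]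
  obtain C where "(\<lambda>n. real n powr (7/2) * ((l\<^sup>2 * x) $ n / b ^ n)) \<longlonglongrightarrow> C"
    using sqrt_germ_coeff_damped[OF b germ] unfolding l_def by blast
  then obtain K where K: "\<And>n. \<bar>real n powr (7/2) * ((l\<^sup>2 * x) $ n / b ^ n)\<bar> \<le> K"
    using convergent_imp_Bseq[of "\<lambda>n. real n powr (7/2) * ((l\<^sup>2 * x) $ n / b ^ n)"]
    by (auto simp: Bseq_def convergent_def)
  have K0: "K \<ge> 0" using K[of 0] by simp
  have cube: "\<bar>(l\<^sup>2 * x) $ m / b ^ m\<bar> \<le> K * (1 / real m ^ 3)" if "m \<ge> 1" for m
  proof -
    have "real m powr 3 \<le> real m powr (7/2)" using that by (intro powr_mono) auto
    then have "real m ^ 3 * \<bar>(l\<^sup>2 * x) $ m / b ^ m\<bar> \<le> real m powr (7/2) * \<bar>(l\<^sup>2 * x) $ m / b ^ m\<bar>"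
      using that by (intro mult_right_mono) (auto simp: powr_numeral)
    also have "\<dots> \<le> K" using K[of m] by (simp add: abs_mult)
    finally show ?thesis using that by (simp add: field_simps)
  qed
  have bound: "\<bar>(l\<^sup>2 * y) $ n / b ^ n\<bar> \<le> K * (1 / real n ^ 2)" if n: "n \<ge> 1" for n
  proof -
    have term_le: "\<bar>h\<bar> ^ n * \<bar>(l\<^sup>2 * x) $ (Suc n + k) * (1 / \<eta>) ^ (Suc n + k)\<bar> \<le> K * (1 / real (Suc n + k) ^ 3)" for k
    proof -
      define m where "m = Suc n + k"
      have "\<bar>h\<bar> ^ n * \<bar>(l\<^sup>2 * x) $ m * (1 / \<eta>) ^ m\<bar> = \<bar>h\<bar> ^ n / \<bar>h\<bar> ^ m * \<bar>(l\<^sup>2 * x) $ m / b ^ m\<bar>"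
        unfolding h(3) by (simp add: abs_mult power_abs power_mult_distrib power_divide)
      also have "\<dots> \<le> 1 * \<bar>(l\<^sup>2 * x) $ m / b ^ m\<bar>"
      proof (rule mult_right_mono)
        have "\<bar>h\<bar> ^ n \<le> \<bar>h\<bar> ^ m" using h(2) by (intro power_increasing) (auto simp: m_def)
        moreover have "\<bar>h\<bar> ^ m > 0" using h(2) by (intro zero_less_power) simp
        ultimately show "\<bar>h\<bar> ^ n / \<bar>h\<bar> ^ m \<le> 1" by simp
      qed simp
      also have "\<dots> \<le> K * (1 / real m ^ 3)" using cube[of m] by (simp add: m_def)
      finally show ?thesis by (simp only: m_def)
    qed
    \<comment> \<open>\<open>t\<close> is the tail; the factor \<open>h ^ n\<close> changes the scale from \<open>\<eta>\<close> to \<open>b\<close>.\<close>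
    define t where "t k = (l\<^sup>2 * x) $ (Suc n + k) * (1 / \<eta>) ^ (Suc n + k)" for k
    have st: "summable (\<lambda>k. \<bar>t k\<bar>)"
      using summable_ignore_initial_segment[OF sqrt_germ_abs_summable[OF b germ_l2x \<eta>_abs], of "Suc n"]
      by (simp add: t_def add.commute)
    have "(l\<^sup>2 * y) $ n / b ^ n = h ^ n * ((l\<^sup>2 * y) $ n / \<eta> ^ n)"
      using b \<eta>0 by (simp add: h_def power_divide)
    also have "\<dots> = - (h ^ n * suminf t)" unfolding tail t_def by simp
    finally have "\<bar>(l\<^sup>2 * y) $ n / b ^ n\<bar> = \<bar>h\<bar> ^ n * \<bar>suminf t\<bar>" by (simp add: abs_mult power_abs)
    also have "\<dots> \<le> \<bar>h\<bar> ^ n * (\<Sum>k. \<bar>t k\<bar>)" by (intro mult_left_mono summable_rabs st) auto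
    also have "\<dots> = (\<Sum>k. \<bar>h\<bar> ^ n * \<bar>t k\<bar>)" by (rule suminf_mult[OF st, symmetric])
    also have "\<dots> \<le> (\<Sum>k. K * (1 / real (Suc n + k) ^ 3))"
      using term_le unfolding t_def[symmetric]
      by (intro suminf_le summable_mult st sum_inverse_cubes_tail n) auto
    also have "\<dots> = K * (\<Sum>k. 1 / real (Suc n + k) ^ 3)"
      by (rule suminf_mult[OF sum_inverse_cubes_tail(1)[OF n]])
    also have "\<dots> \<le> K * (1 / real n ^ 2)"
      by (intro mult_left_mono sum_inverse_cubes_tail n K0)
    finally show ?thesis .
  qed
  have l2y: "(\<lambda>n. real n powr (3/2) * ((l\<^sup>2 * y) $ n / b ^ n)) \<longlonglongrightarrow> 0"
  proof (rule Lim_null_comparison)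
    have "(\<lambda>n. K * real n powr (- (1/2))) \<longlonglongrightarrow> K * 0"
      by (intro tendsto_mult tendsto_const tendsto_neg_powr filterlim_real_sequentially) auto
    then show "(\<lambda>n. K * real n powr (- (1/2))) \<longlonglongrightarrow> 0" by simp
    show "\<forall>\<^sub>F n in sequentially. norm (real n powr (3/2) * ((l\<^sup>2 * y) $ n / b ^ n)) \<le> K * real n powr (- (1/2))"
      using eventually_ge_at_top[of 1]
    proof eventually_elim
      case (elim n)
      have "real n powr (3/2) * (1 / real n ^ 2) = real n powr (3/2) * real n powr (- 2)"
        using elim by (simp add: powr_minus_divide powr_numeral)
      also have "\<dots> = real n powr (- (1/2))" by (subst powr_add[symmetric]) simp
      finally have pw: "real n powr (3/2) * (1 / real n ^ 2) = real n powr (- (1/2))" .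
      have "norm (real n powr (3/2) * ((l\<^sup>2 * y) $ n / b ^ n)) = real n powr (3/2) * \<bar>(l\<^sup>2 * y) $ n / b ^ n\<bar>"
        by (simp add: abs_mult)
      also have "\<dots> \<le> real n powr (3/2) * (K * (1 / real n ^ 2))"
        by (intro mult_left_mono bound elim) auto
      also have "\<dots> = K * real n powr (- (1/2))"
        using pw by (metis mult.left_commute)
      finally show ?case .
    qed
  qed
  have split: "1 - fps_const \<eta> * fps_X = (1 - fps_const h) + fps_const h * l"
    unfolding h(3) l_def by (simp add: algebra_simps flip: fps_const_mult)
  have "x = y * (1 - fps_const h) + fps_const h * l * y"
    unfolding y[symmetric] split by (simp add: algebra_simps)
  then have "(1 - fps_const h)\<^sup>2 * y = (1 - fps_const h) * x - fps_const h * (l * x) + (fps_const h)\<^sup>2 * (l\<^sup>2 * y)"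
    by (rule second_order_expansion)
  moreover have "1 - fps_const h = fps_const (1 - h)" by (simp flip: fps_const_sub)
  ultimately have rel: "fps_const ((1 - h)\<^sup>2) * y = fps_const (1 - h) * x - fps_const h * (l * x) + fps_const (h\<^sup>2) * (l\<^sup>2 * y)"
    by (simp only: fps_const_power)
  have coeff: "(1 - h)\<^sup>2 * y $ n = (1 - h) * x $ n - h * (l * x) $ n + h\<^sup>2 * (l\<^sup>2 * y) $ n" for n
    using arg_cong[OF rel, of "\<lambda>f. f $ n"] by simp
  have "real n powr (3/2) * (y $ n / b ^ n) =
     ((1 - h) * (real n powr (3/2) * (x $ n / b ^ n)) - h * (real n powr (3/2) * ((l * x) $ n / b ^ n))
       + h\<^sup>2 * (real n powr (3/2) * ((l\<^sup>2 * y) $ n / b ^ n))) / (1 - h)\<^sup>2" for n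
  proof -
    have "(1 - h)\<^sup>2 * (real n powr (3/2) * (y $ n / b ^ n)) = real n powr (3/2) * ((1 - h)\<^sup>2 * y $ n) / b ^ n"
      by simp
    also have "\<dots> = (1 - h) * (real n powr (3/2) * (x $ n / b ^ n)) - h * (real n powr (3/2) * ((l * x) $ n / b ^ n))
       + h\<^sup>2 * (real n powr (3/2) * ((l\<^sup>2 * y) $ n / b ^ n))"
      unfolding coeff by (simp add: ring_distribs add_divide_distrib diff_divide_distrib mult_ac)
    finally show ?thesis using h(1) by (simp only: eq_divide_eq) (simp add: mult.commute)
  qed
  moreover have "(\<lambda>n. ((1 - h) * (real n powr (3/2) * (x $ n / b ^ n)) - h * (real n powr (3/2) * ((l * x) $ n / b ^ n))
       + h\<^sup>2 * (real n powr (3/2) * ((l\<^sup>2 * y) $ n / b ^ n))) / (1 - h)\<^sup>2) \<longlonglongrightarrow>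
     ((1 - h) * (- \<beta> / (2 * sqrt pi)) - h * (- 0 / (2 * sqrt pi)) + h\<^sup>2 * 0) / (1 - h)\<^sup>2"
    using h(1) by (intro tendsto_divide tendsto_add tendsto_diff tendsto_mult tendsto_const
       sqrt_germ_coeff[OF b germ] sqrt_germ_coeff[OF b germ_lx] l2y) simp
  moreover have "((1 - h) * (- \<beta> / (2 * sqrt pi)) - h * (- 0 / (2 * sqrt pi)) + h\<^sup>2 * 0) / (1 - h)\<^sup>2
      = - \<beta> / (2 * sqrt pi) / (1 - \<eta> / b)"
    using h(1) by (simp add: power2_eq_square h_def[symmetric])
  ultimately show ?thesis by simp
qed

lemma quotient_coeff_asymptotic:
  fixes x y :: "real fps"
  assumes "b > 0" "sqrt_germ b x \<alpha> \<beta>" "y * (1 - fps_const \<eta> * fps_X) = x" "\<eta> \<noteq> b"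
    and "b \<le> \<bar>\<eta>\<bar> \<Longrightarrow> eval_fps x (1 / \<eta>) = 0"
  shows "(\<lambda>n. real n powr (3/2) * (y $ n / b ^ n)) \<longlonglongrightarrow> - \<beta> / (2 * sqrt pi) / (1 - \<eta> / b)"
proof (cases "b \<le> \<bar>\<eta>\<bar>")
  case True
  then show ?thesis using assms by (intro quotient_removable_germ) auto
next
  case False
  then show ?thesis using assms(1-3) by (intro quotient_pole_outside) auto
qed

section \<open>Balance equations of the queue\<close>

lemma stationary_balance:
  assumes "stationary_distribution S q \<pi>" "t \<in> S" "finite A" "t \<notin> A"
    and q0: "\<And>s. s \<in> S \<Longrightarrow> s \<noteq> t \<Longrightarrow> s \<notin> A \<Longrightarrow> q s t = 0"
  shows "\<pi> t * (\<Sum>\<^sub>\<infinity>v\<in>S - {t}. q t v) = (\<Sum>s\<in>A. (if s \<in> S then \<pi> s else 0) * q s t)"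
proof -
  have "((\<lambda>s. \<pi> s * generator S q s t) has_sum 0) S"
    using assms by (auto simp: stationary_distribution_def)
  moreover have "((\<lambda>s. (if s \<in> S then \<pi> s else 0) * generator S q s t) has_sum 0) (insert t A)
       \<longleftrightarrow> ((\<lambda>s. \<pi> s * generator S q s t) has_sum 0) S"
    by (rule has_sum_cong_neutral) (use q0 in \<open>auto simp: generator_def\<close>)
  moreover have "((\<lambda>s. (if s \<in> S then \<pi> s else 0) * generator S q s t) has_sum
      (\<Sum>s\<in>insert t A. (if s \<in> S then \<pi> s else 0) * generator S q s t)) (insert t A)"
    using assms by (intro has_sum_finite) auto
  ultimately have "(\<Sum>s\<in>insert t A. (if s \<in> S then \<pi> s else 0) * generator S q s t) = 0"
    using has_sum_unique by blast
  moreover have "(\<Sum>s\<in>A. (if s \<in> S then \<pi> s else 0) * generator S q s t) =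
      (\<Sum>s\<in>A. (if s \<in> S then \<pi> s else 0) * q s t)"
    using assms by (intro sum.cong) (auto simp: generator_def)
  ultimately show ?thesis
    using assms by (simp add: generator_def)
qed

lemma has_sum_point: "c \<in> A \<Longrightarrow> ((\<lambda>v. if v = c then (x::real) else 0) has_sum x) A"
proof -
  assume "c \<in> A"
  then have "((\<lambda>v. if v = c then x else 0) has_sum x) A \<longleftrightarrow> ((\<lambda>v. x) has_sum x) {c}"
    by (intro has_sum_cong_neutral) auto
  then show ?thesis by (simp add: has_sum_finiteI)
qed

locale stationary_priority_queue =
  fixes l1 l2 m1 m2 :: real and N :: nat and \<pi> :: "state \<Rightarrow> real"
  assumes N: "N \<ge> 1" and l1: "l1 > 0" and l2: "l2 > 0" and m1: "m1 > 0" and m2: "m2 > 0"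
    and stable: "rho1 l1 m1 + rho2 l2 m2 < 1"
    and normalized: "l1 + l2 + m1 + m2 = 1"
    and stationary: "queue_stationary l1 l2 m1 m2 N \<pi>"
begin

text \<open>
  The values of \<open>\<pi>\<close> outside the state space are arbitrary; with the value 0 there, the balance
  equations need no case distinction at the boundary.
\<close>

definition prob :: "state \<Rightarrow> real" where
  "prob s = (if s \<in> queue_states N then \<pi> s else 0)"

text \<open>
  The probability of \<open>i\<close> high- and \<open>n\<close> low-priority customers.  A high-priority arrival acts
  alike on all server states, so only this sum enters the balance equations for \<open>i > 0\<close>.
\<close>

definition level :: "nat \<Rightarrow> nat \<Rightarrow> real" where
  "level i n = prob (Vacation, i, n) + prob (Serving_High, i, n) + prob (Serving_Low, i, n)"

lemma prob_outside [simp]: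
  "prob (Vacation, Suc i, n) = 0" "prob (Serving_Low, Suc i, n) = 0"
  "prob (Serving_High, 0, n) = 0" "prob (Serving_Low, i, 0) = 0"
  "N \<le> n \<Longrightarrow> prob (Vacation, i, n) = 0"
  by (auto simp: prob_def queue_states_def)

lemma prob_nonneg: "prob s \<ge> 0"
  using stationary by (auto simp: prob_def queue_stationary_def stationary_distribution_def)

lemma exit_rate:
  assumes "s \<in> queue_states N"
  shows "(\<Sum>\<^sub>\<infinity>v\<in>queue_states N - {s}. queue_rate l1 l2 m1 m2 N s v) =
     l1 + l2 + (if fst s = Serving_High then m1 else 0) + (if fst s = Serving_Low then m2 else 0)"
proof -
  obtain m i n where s: "s = (m, i, n)" by (cases s)
  have "high_arrival s \<in> queue_states N - {s}" "low_arrival N s \<in> queue_states N - {s}"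
    using assms N unfolding s by (cases m; simp add: queue_states_def server_action_def)+
  moreover have "high_departure s \<in> queue_states N - {s}" if "fst s = Serving_High"
    using assms N that unfolding s
    by (cases "i = 1") (auto simp add: queue_states_def server_action_def)
  moreover have "low_departure s \<in> queue_states N - {s}" if "fst s = Serving_Low"
    using assms N that unfolding s
    by (cases "n = 1") (auto simp add: queue_states_def server_action_def)
  ultimately have "((\<lambda>v. queue_rate l1 l2 m1 m2 N s v) has_sum
     (l1 + l2 + (if fst s = Serving_High then m1 else 0) + (if fst s = Serving_Low then m2 else 0)))
     (queue_states N - {s})"
    unfolding queue_rate_def
    by (intro has_sum_add)
      (auto intro!: has_sum_point)
  then show ?thesis by (rule infsumI)
qed

lemma balance:
  assumes "t \<in> queue_states N" "finite A" "t \<notin> A"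
    and "\<And>s. s \<in> queue_states N \<Longrightarrow> s \<noteq> t \<Longrightarrow> s \<notin> A \<Longrightarrow> queue_rate l1 l2 m1 m2 N s t = 0"
  shows "prob t * (l1 + l2 + (if fst t = Serving_High then m1 else 0) +
      (if fst t = Serving_Low then m2 else 0)) = (\<Sum>s\<in>A. prob s * queue_rate l1 l2 m1 m2 N s t)"
proof -
  have "\<pi> t * (\<Sum>\<^sub>\<infinity>v\<in>queue_states N - {t}. queue_rate l1 l2 m1 m2 N t v) =
      (\<Sum>s\<in>A. (if s \<in> queue_states N then \<pi> s else 0) * queue_rate l1 l2 m1 m2 N s t)"
    using stationary assms by (intro stationary_balance) (auto simp: queue_stationary_def)
  then show ?thesis
    using exit_rate[OF assms(1)] assms(1) by (simp add: prob_def)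
qed

lemma queue_rate_nonzeroE:
  assumes "queue_rate l1 l2 m1 m2 N (m, i, n) t \<noteq> 0"
  obtains "t = high_arrival (m, i, n)" | "t = low_arrival N (m, i, n)"
    | "m = Serving_High" "t = high_departure (m, i, n)"
    | "m = Serving_Low" "t = low_departure (m, i, n)"
  using assms unfolding queue_rate_def by (auto split: if_splits)

lemma balance_high:
  "(l1 + l2 + m1) * level (Suc i) n =
     l1 * level i n + l2 * (if n = 0 then 0 else level (Suc i) (n - 1)) + m1 * level (Suc (Suc i)) n"
proof -
  \<comment> \<open>All states with a transition into this one.  Combinations outside the state space are harmless,
    as \<open>prob\<close> vanishes there.\<close>
  define A where "A = {(Serving_High, i, n), (Serving_Low, i, n), (Vacation, i, n),
      (Serving_High, Suc (Suc i), n)} \<union> (if n = 0 then {} else {(Serving_High, Suc i, n - 1)})"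
  have "prob (Serving_High, Suc i, n) * (l1 + l2 + m1) =
     (\<Sum>s\<in>A. prob s * queue_rate l1 l2 m1 m2 N s (Serving_High, Suc i, n))"
  proof (subst balance[of "(Serving_High, Suc i, n)" A, simplified, symmetric])
    fix s :: state
    obtain m j k where s: "s = (m, j, k)" by (cases s)
    assume "s \<in> queue_states N" "s \<notin> A"
    moreover have "s \<in> A" if "s \<in> queue_states N" "queue_rate l1 l2 m1 m2 N s (Serving_High, Suc i, n) \<noteq> 0"
      using that(2) unfolding s
    proof (cases rule: queue_rate_nonzeroE)
      case 1
      then show "(m, j, k) \<in> A" by (cases m) (simp_all add: A_def)
    next
      case 2
      then show "(m, j, k) \<in> A"
        using that(1) s by (cases m) (auto simp: A_def queue_states_def server_action_def split: if_splits)
    next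
      case 3
      then show "(m, j, k) \<in> A"
        by (auto simp: A_def server_action_def split: if_splits)
    next
      case 4
      then show "(m, j, k) \<in> A"
        using that(1) s by (auto simp: A_def queue_states_def server_action_def split: if_splits)
    qed
    ultimately show "queue_rate l1 l2 m1 m2 N s (Serving_High, Suc i, n) = 0" by blast
  qed (auto simp: A_def queue_states_def)
  then show ?thesis
    by (cases n; cases i)
      (simp_all add: A_def level_def queue_rate_def server_action_def algebra_simps)
qed

lemma balance_low:
  "(l1 + l2 + m2) * prob (Serving_Low, 0, Suc n) =
     l2 * prob (Serving_Low, 0, n) + (if Suc n = N then l2 * prob (Vacation, 0, n) else 0)
      + m1 * level 1 (Suc n) + m2 * prob (Serving_Low, 0, Suc (Suc n))"
proof -
  define A where "A = {(Serving_Low, 0, n), (Vacation, 0, n), (Serving_High, 1, Suc n),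
      (Serving_Low, 0, Suc (Suc n)) :: state}"
  have "prob (Serving_Low, 0, Suc n) * (l1 + l2 + m2) =
     (\<Sum>s\<in>A. prob s * queue_rate l1 l2 m1 m2 N s (Serving_Low, 0, Suc n))"
  proof (subst balance[of "(Serving_Low, 0, Suc n)" A, simplified, symmetric])
    fix s :: state
    obtain m j k where s: "s = (m, j, k)" by (cases s)
    assume "s \<in> queue_states N" "s \<notin> A"
    moreover have "s \<in> A" if "s \<in> queue_states N" "queue_rate l1 l2 m1 m2 N s (Serving_Low, 0, Suc n) \<noteq> 0"
      using that(2) unfolding s
    proof (cases rule: queue_rate_nonzeroE)
      case 2
      then show "(m, j, k) \<in> A"
        using that(1) s by (cases m) (auto simp: A_def queue_states_def)
    next
      case 3
      then show "(m, j, k) \<in> A"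
        using that(1) s by (auto simp: A_def queue_states_def)
    qed (auto simp: A_def)
    ultimately show "queue_rate l1 l2 m1 m2 N s (Serving_Low, 0, Suc n) = 0" by blast
  qed (auto simp: A_def queue_states_def)
  then show ?thesis
    using N by (cases "Suc n < N"; cases "Suc n = N")
      (auto simp: A_def level_def queue_rate_def server_action_def algebra_simps)
qed

lemma balance_vacation_0:
  "(l1 + l2) * prob (Vacation, 0, 0) = m1 * level 1 0 + m2 * prob (Serving_Low, 0, 1)"
proof -
  define A where "A = {(Serving_High, 1, 0), (Serving_Low, 0, 1) :: state}"
  have "prob (Vacation, 0, 0) * (l1 + l2) =
     (\<Sum>s\<in>A. prob s * queue_rate l1 l2 m1 m2 N s (Vacation, 0, 0))"
  proof (subst balance[of "(Vacation, 0, 0)" A, simplified, symmetric])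
    fix s :: state
    obtain m j k where s: "s = (m, j, k)" by (cases s)
    assume "s \<in> queue_states N" "s \<notin> A"
    moreover have "s \<in> A" if "s \<in> queue_states N" "queue_rate l1 l2 m1 m2 N s (Vacation, 0, 0) \<noteq> 0"
      using that(2) unfolding s
    proof (cases rule: queue_rate_nonzeroE)
      case 3
      then show "(m, j, k) \<in> A" using that(1) s by (auto simp: A_def queue_states_def)
    next
      case 4
      then show "(m, j, k) \<in> A" using that(1) s by (auto simp: A_def queue_states_def)
    qed auto
    ultimately show "queue_rate l1 l2 m1 m2 N s (Vacation, 0, 0) = 0" by blast
  qed (use N in \<open>auto simp: A_def queue_states_def\<close>)
  then show ?thesis
    by (simp add: A_def level_def queue_rate_def server_action_def algebra_simps)
qed

lemma balance_vacation_Suc: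
  assumes "Suc n < N"
  shows "(l1 + l2) * prob (Vacation, 0, Suc n) = l2 * prob (Vacation, 0, n)"
proof -
  have "prob (Vacation, 0, Suc n) * (l1 + l2) =
     (\<Sum>s\<in>{(Vacation, 0, n)}. prob s * queue_rate l1 l2 m1 m2 N s (Vacation, 0, Suc n))"
  proof (subst balance[of "(Vacation, 0, Suc n)" "{(Vacation, 0, n)}", symmetric])
    fix s :: state
    obtain m j k where s: "s = (m, j, k)" by (cases s)
    assume "s \<in> queue_states N" "s \<notin> {(Vacation, 0, n)}"
    moreover have "s = (Vacation, 0, n)"
      if "s \<in> queue_states N" "queue_rate l1 l2 m1 m2 N s (Vacation, 0, Suc n) \<noteq> 0"
      using that(2) unfolding s
      by (cases rule: queue_rate_nonzeroE) (auto simp: server_action_def split: if_splits)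
    ultimately show "queue_rate l1 l2 m1 m2 N s (Vacation, 0, Suc n) = 0" by blast
  qed (use assms in \<open>auto simp: queue_states_def\<close>)
  then show ?thesis
    using assms by (simp add: queue_rate_def server_action_def algebra_simps)
qed

lemma level_nonneg: "level i n \<ge> 0"
  using prob_nonneg by (simp add: level_def)

lemma level_has_sum: "((\<lambda>(i, n). level i n) has_sum 1) UNIV"
proof -
  have "(prob has_sum 1) UNIV \<longleftrightarrow> (\<pi> has_sum 1) (queue_states N)"
    by (rule has_sum_cong_neutral) (auto simp: prob_def)
  then have "(prob has_sum 1) UNIV"
    using stationary by (simp add: queue_stationary_def stationary_distribution_def)
  moreover have "((\<lambda>(x, m). prob (m, x)) has_sum 1) (UNIV \<times> UNIV) \<longleftrightarrow> (prob has_sum 1) UNIV"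
    by (rule has_sum_reindex_bij_witness[of _ "\<lambda>(m, x). (x, m)" "\<lambda>(x, m). (m, x)"]) auto
  ultimately have sum: "((\<lambda>(x, m). prob (m, x)) has_sum 1) (UNIV \<times> UNIV)" by simp
  have UN: "(UNIV :: server set) = {Vacation, Serving_High, Serving_Low}"
    using server.exhaust by auto
  have "((\<lambda>x. case x of (i, n) \<Rightarrow> level i n) has_sum 1) UNIV"
  proof (rule has_sum_SigmaD[OF sum])
    fix x :: "nat \<times> nat"
    show "((\<lambda>m. case (x, m) of (x, m) \<Rightarrow> prob (m, x)) has_sum (case x of (i, n) \<Rightarrow> level i n)) UNIV"
      unfolding UN by (rule has_sum_finiteI) (auto simp: level_def split: prod.splits)
  qed
  then show ?thesis .
qed

lemma level_sums: "summable (level i)" "(\<lambda>i. suminf (level i)) sums 1"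
proof -
  have "(\<lambda>(i, n). level i n) summable_on (UNIV \<times> UNIV)"
    using level_has_sum by (auto simp: summable_on_def)
  then have row: "level i summable_on UNIV" for i
    using summable_on_SigmaD1[of "\<lambda>i n. level i n" UNIV "\<lambda>_. UNIV" i] by simp
  then have eq: "(level i has_sum suminf (level i)) UNIV" for i
    using has_sum_imp_sums has_sum_infsum sums_unique by metis
  show "summable (level i)"
    using eq has_sum_imp_sums sums_summable by blast
  have "((\<lambda>i. suminf (level i)) has_sum 1) UNIV"
    by (rule has_sum_SigmaD[where f = "\<lambda>(i, n). level i n" and B = "\<lambda>_. UNIV"])
      (use level_has_sum eq in auto)
  then show "(\<lambda>i. suminf (level i)) sums 1" by (rule has_sum_imp_sums)
qed

lemma level_le_1: "level i n \<le> 1"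
proof -
  have "level i n \<le> suminf (level i)"
    using sum_le_suminf[OF level_sums(1), of "{n}" i] level_nonneg by simp
  also have "\<dots> \<le> (\<Sum>i. suminf (level i))"
    using sum_le_suminf[OF sums_summable[OF level_sums(2)], of "{i}"] level_nonneg
    by (simp add: suminf_nonneg level_sums)
  also have "\<dots> = 1" using level_sums(2) by (simp add: sums_iff)
  finally show ?thesis .
qed

section \<open>Generating functions in the number of low-priority customers\<close>

abbreviation (input) "bb1 \<equiv> b1 l1 l2 m1"
abbreviation (input) "bb2 \<equiv> b2 l1 l2 m1"
abbreviation (input) "\<eta>1 \<equiv> eta1 l2 m1 m2"
abbreviation (input) "\<eta>2 \<equiv> eta2 l2 m1 m2"

text \<open>
  The discriminant of the quadratic equation for \<open>u\<close> is \<open>(L1 - l2 * z) * (L2 - l2 * z)\<close>, with zeros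
  \<open>1 / b1\<close> and \<open>1 / b2\<close>.
\<close>

definition L1 where "L1 = l2 + (sqrt m1 - sqrt l1)\<^sup>2"
definition L2 where "L2 = l2 + (sqrt m1 + sqrt l1)\<^sup>2"

definition disc :: "real \<Rightarrow> real" where "disc z = (1 - m2 - l2 * z)\<^sup>2 - 4 * l1 * m1"

lemma L_pos: "L1 > 0" "L2 > 0" using l2 by (auto simp: L1_def L2_def add_pos_nonneg)

lemma b_L: "bb1 = l2 / L1" "bb2 = l2 / L2" by (simp_all add: b1_def b2_def L1_def L2_def)

lemma b_pos: "bb1 > 0" "bb2 > 0" using L_pos l2 by (simp_all add: b_L)

lemma l1_less_m1: "l1 < m1"
proof -
  have "l2 / m2 > 0" using l2 m2 by simp
  then have "l1 / m1 < 1" using stable unfolding rho1_def rho2_def by linarith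
  then show ?thesis using m1 by simp
qed

lemma b1_less_1: "bb1 < 1"
proof -
  have "sqrt m1 - sqrt l1 > 0" using l1_less_m1 by simp
  then show ?thesis using l2 unfolding b1_def by (simp add: add_pos_pos)
qed

lemma L_eqs: "L1 = 1 - m2 - 2 * sqrt (l1 * m1)" "L2 = 1 - m2 + 2 * sqrt (l1 * m1)"
  using l1 m1 normalized unfolding L1_def L2_def
  by (auto simp: power2_diff power2_sum real_sqrt_mult)

lemma L1_less_L2: "L1 < L2" using l1 m1 by (simp add: L_eqs)

lemma b2_less_b1: "bb2 < bb1"
  unfolding b_L using L1_less_L2 L_pos l2 by (simp add: divide_strict_left_mono)

lemma disc_factor: "disc z = (L1 - l2 * z) * (L2 - l2 * z)"
proof -
  have "sqrt (l1 * m1) * sqrt (l1 * m1) = l1 * m1" using l1 m1 by simp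
  then show ?thesis unfolding disc_def L_eqs by (simp add: power2_eq_square algebra_simps)
qed

definition root_const :: real where "root_const = sqrt (L1 * L2)"

definition S_fps :: "real fps" where
  "S_fps = fps_const root_const * (binom_fps (1/2) bb1 * binom_fps (1/2) bb2)"

definition W_fps :: "real fps" where "W_fps = 1 - fps_const m2 - fps_const l2 * fps_X"

text \<open>
  The two characteristic roots of the recurrence in the number of high-priority customers.
\<close>

definition U_fps :: "real fps" where "U_fps = fps_const (1 / (2 * m1)) * (W_fps - S_fps)"

definition U'_fps :: "real fps" where "U'_fps = fps_const (1 / (2 * m1)) * (W_fps + S_fps)"

lemma fps_const_of: "fps_const (1 - m2) = 1 - fps_const m2" "2 = fps_const (2 :: real)" "4 = fps_const (4 :: real)"
  by (simp_all flip: fps_const_sub add: fps_numeral_fps_const)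

lemma S_square: "S_fps * S_fps = W_fps * W_fps - 4 * fps_const l1 * fps_const m1"
proof -
  have T: "binom_fps (1/2) b * binom_fps (1/2) b = 1 - fps_const b * fps_X" for b
    using binom_fps_mult[of "1/2" b "1/2"] by (simp add: binom_fps_1)
  have "S_fps * S_fps = fps_const root_const * fps_const root_const *
     ((binom_fps (1/2) bb1 * binom_fps (1/2) bb1) * (binom_fps (1/2) bb2 * binom_fps (1/2) bb2))"
    unfolding S_fps_def by (simp only: mult_ac)
  also have "fps_const root_const * fps_const root_const = fps_const L1 * fps_const L2"
    using L_pos by (simp add: root_const_def)
  also have "fps_const L1 * fps_const L2 * ((binom_fps (1/2) bb1 * binom_fps (1/2) bb1) * (binom_fps (1/2) bb2 * binom_fps (1/2) bb2))
     = (fps_const L1 * (1 - fps_const bb1 * fps_X)) * (fps_const L2 * (1 - fps_const bb2 * fps_X))"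
    unfolding T by (simp only: mult_ac)
  also have "fps_const L1 * (1 - fps_const bb1 * fps_X) = W_fps - fps_const (2 * sqrt (l1 * m1))"
  proof -
    have "fps_const L1 * (1 - fps_const bb1 * fps_X) = fps_const L1 - fps_const (L1 * bb1) * fps_X"
      by (simp add: right_diff_distrib mult.assoc[symmetric])
    moreover have "L1 * bb1 = l2" using L_pos by (simp add: b_L)
    moreover have "fps_const L1 = fps_const (1 - m2) - fps_const (2 * sqrt (l1 * m1))"
      unfolding L_eqs by (simp only: fps_const_sub)
    ultimately show ?thesis unfolding W_fps_def fps_const_of(1)[symmetric] by simp
  qed
  also have "fps_const L2 * (1 - fps_const bb2 * fps_X) = W_fps + fps_const (2 * sqrt (l1 * m1))"
  proof -
    have "fps_const L2 * (1 - fps_const bb2 * fps_X) = fps_const L2 - fps_const (L2 * bb2) * fps_X"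
      by (simp add: right_diff_distrib mult.assoc[symmetric])
    moreover have "L2 * bb2 = l2" using L_pos by (simp add: b_L)
    moreover have "fps_const L2 = fps_const (1 - m2) + fps_const (2 * sqrt (l1 * m1))"
      unfolding L_eqs by (simp only: fps_const_add)
    ultimately show ?thesis unfolding W_fps_def fps_const_of(1)[symmetric] by simp
  qed
  also have "(W_fps - fps_const (2 * sqrt (l1 * m1))) * (W_fps + fps_const (2 * sqrt (l1 * m1))) =
      W_fps * W_fps - fps_const (2 * sqrt (l1 * m1)) * fps_const (2 * sqrt (l1 * m1))"
    by (simp only: square_diff_square_factored mult.commute)
  also have "fps_const (2 * sqrt (l1 * m1)) * fps_const (2 * sqrt (l1 * m1)) = 4 * fps_const l1 * fps_const m1"
  proof -
    have "2 * sqrt (l1 * m1) * (2 * sqrt (l1 * m1)) = 4 * l1 * m1"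
      using l1 m1 by simp
    then show ?thesis unfolding fps_const_of(3) by (simp only: fps_const_mult)
  qed
  finally show ?thesis .
qed

lemma U_sum: "fps_const m1 * (U_fps + U'_fps) = W_fps"
proof -
  have "fps_const m1 * (U_fps + U'_fps) = fps_const m1 * (fps_const (1 / (2 * m1)) * (2 * W_fps))"
    unfolding U_fps_def U'_fps_def by (simp add: algebra_simps)
  also have "\<dots> = fps_const (m1 * (1 / (2 * m1)) * 2) * W_fps"
    unfolding fps_const_of(2) by (simp only: fps_const_mult[symmetric] mult.assoc)
  finally show ?thesis using m1 by simp
qed

lemma U_prod: "fps_const m1 * (U_fps * U'_fps) = fps_const l1"
proof -
  have "fps_const m1 * (U_fps * U'_fps) =
     (fps_const m1 * fps_const (1 / (2 * m1)) * fps_const (1 / (2 * m1))) * ((W_fps - S_fps) * (W_fps + S_fps))"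
    unfolding U_fps_def U'_fps_def by (simp only: mult_ac)
  also have "(W_fps - S_fps) * (W_fps + S_fps) = W_fps * W_fps - S_fps * S_fps"
    by (simp add: algebra_simps)
  also have "\<dots> = fps_const (4 * l1 * m1)"
    unfolding S_square fps_const_of(3) by simp
  also have "fps_const m1 * fps_const (1 / (2 * m1)) * fps_const (1 / (2 * m1)) * fps_const (4 * l1 * m1) =
      fps_const (m1 * (1 / (2 * m1)) * (1 / (2 * m1)) * (4 * l1 * m1))"
    by (simp only: fps_const_mult)
  also have "m1 * (1 / (2 * m1)) * (1 / (2 * m1)) * (4 * l1 * m1) = l1" using m1 by simp
  finally show ?thesis .
qed

lemma U_2m1: "2 * (fps_const m1 * U_fps) = W_fps - S_fps"
proof -
  have "2 * (fps_const m1 * U_fps) = fps_const (2 * m1 * (1 / (2 * m1))) * (W_fps - S_fps)"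
    unfolding U_fps_def fps_const_of(2) by (simp only: fps_const_mult[symmetric] mult.assoc)
  then show ?thesis using m1 by simp
qed

lemma U'_0: "U'_fps $ 0 > 1"
proof -
  have w: "W_fps $ 0 = l1 + l2 + m1" using normalized by (simp add: W_fps_def)
  have "root_const > 2 * m1 - (l1 + l2 + m1)"
  proof (rule ccontr)
    assume "\<not> ?thesis"
    then have "root_const\<^sup>2 \<le> (2 * m1 - (l1 + l2 + m1))\<^sup>2"
      using L_pos by (intro power_mono) (auto simp: root_const_def)
    moreover have "root_const\<^sup>2 = (l1 + l2 + m1)\<^sup>2 - 4 * l1 * m1"
    proof -
      have "root_const\<^sup>2 = disc 0" using L_pos by (simp add: root_const_def disc_factor)
      moreover have "1 - m2 = l1 + l2 + m1" using normalized by simp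
      ultimately show ?thesis unfolding disc_def by simp
    qed
    ultimately have "4 * (l2 * m1) \<le> 0" by (simp add: power2_eq_square algebra_simps)
    then show False using l2 m1 by (simp add: mult_le_0_iff)
  qed
  moreover have "S_fps $ 0 = root_const" by (simp add: S_fps_def binom_fps_nth)
  ultimately have "W_fps $ 0 + S_fps $ 0 > 2 * m1" using w by linarith
  then have "(W_fps $ 0 + S_fps $ 0) / (2 * m1) > 1" using m1 by simp
  then show ?thesis by (simp add: U'_fps_def)
qed

definition L_fps :: "nat \<Rightarrow> real fps" where "L_fps i = Abs_fps (level i)"

lemma L_rec: "W_fps * L_fps (Suc i) = fps_const l1 * L_fps i + fps_const m1 * L_fps (Suc (Suc i))"
proof (rule fps_ext)
  fix n
  have c: "1 - m2 = l1 + l2 + m1" using normalized by simp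
  have "W_fps * L_fps (Suc i) = fps_const (l1 + l2 + m1) * L_fps (Suc i) - fps_const l2 * (fps_X * L_fps (Suc i))"
    unfolding W_fps_def fps_const_of(1)[symmetric] c by (simp only: left_diff_distrib mult.assoc)
  then have "(W_fps * L_fps (Suc i)) $ n =
      (l1 + l2 + m1) * level (Suc i) n - l2 * (if n = 0 then 0 else level (Suc i) (n - 1))"
    by (simp only: fps_sub_nth fps_mult_left_const_nth fps_X_mult_nth L_fps_def fps_nth_Abs_fps)
  also have "\<dots> = l1 * level i n + m1 * level (Suc (Suc i)) n"
    unfolding balance_high by simp
  finally show "(W_fps * L_fps (Suc i)) $ n = (fps_const l1 * L_fps i + fps_const m1 * L_fps (Suc (Suc i))) $ n"
    by (simp add: L_fps_def)
qed

text \<open>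
  The recurrence factors as \<open>(E - u) (E - u') = 0\<close> with the shift operator \<open>E\<close>, so applying
  \<open>E - u\<close> leaves a geometric sequence with ratio \<open>u'\<close>.
\<close>

lemma L_step: "L_fps (Suc i) - U_fps * L_fps i = U'_fps ^ i * (L_fps 1 - U_fps * L_fps 0)"
proof (induction i)
  case (Suc i)
  have "fps_const m1 * (L_fps (Suc (Suc i)) - U_fps * L_fps (Suc i)) =
     W_fps * L_fps (Suc i) - fps_const l1 * L_fps i - fps_const m1 * (U_fps * L_fps (Suc i))"
    using L_rec[of i] by (simp add: algebra_simps)
  also have "\<dots> = fps_const m1 * (U'_fps * (L_fps (Suc i) - U_fps * L_fps i))"
    unfolding U_sum[symmetric] U_prod[symmetric] by (simp add: algebra_simps)
  finally have "L_fps (Suc (Suc i)) - U_fps * L_fps (Suc i) = U'_fps * (L_fps (Suc i) - U_fps * L_fps i)"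
    using m1 by simp
  then show ?case using Suc by (simp add: mult.assoc)
qed simp

text \<open>
  If \<open>R = L 1 - u * L 0\<close> were not 0, its first nonvanishing coefficient would appear in
  \<open>u' ^ i * R\<close> multiplied by \<open>u'(0) ^ i\<close>, which grows without bound because \<open>u'(0) > 1\<close>, whereas the
  same coefficient of \<open>L (i + 1) - u * L i\<close> is bounded uniformly in \<open>i\<close>.
\<close>

lemma L_geometric: "L_fps i = L_fps 0 * U_fps ^ i"
proof -
  define R where "R = L_fps 1 - U_fps * L_fps 0"
  have "R = 0"
  proof (rule ccontr)
    assume R: "R \<noteq> 0"
    define d where "d = subdegree R"
    have Rd: "R $ d \<noteq> 0" using R by (simp add: d_def)
    have lead: "(U'_fps ^ i * R) $ d = (U'_fps $ 0) ^ i * R $ d" for i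
    proof -
      have "(U'_fps ^ i * R) $ d = (\<Sum>j=0..d. (U'_fps ^ i) $ j * R $ (d - j))" by (rule fps_mult_nth)
      also have "\<dots> = (\<Sum>j\<in>{0}. (U'_fps ^ i) $ j * R $ (d - j))"
        by (rule sum.mono_neutral_right) (auto simp: d_def intro!: nth_less_subdegree_zero)
      finally show ?thesis by (simp add: fps_power_zeroth)
    qed
    have bounded: "\<bar>(U'_fps ^ i * R) $ d\<bar> \<le> 1 + (\<Sum>j=0..d. \<bar>U_fps $ j\<bar>)" for i
    proof -
      have "(U'_fps ^ i * R) $ d = level (Suc i) d - (\<Sum>j=0..d. U_fps $ j * level i (d - j))"
        using L_step[of i, folded R_def, symmetric] by (simp add: L_fps_def fps_mult_nth del: One_nat_def)
      also have "\<bar>\<dots>\<bar> \<le> \<bar>level (Suc i) d\<bar> + \<bar>\<Sum>j=0..d. U_fps $ j * level i (d - j)\<bar>" by (rule abs_triangle_ineq4)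
      also have "\<dots> \<le> 1 + (\<Sum>j=0..d. \<bar>U_fps $ j * level i (d - j)\<bar>)"
        using level_le_1[of "Suc i" d] level_nonneg[of "Suc i" d] by (intro add_mono sum_abs) auto
      also have "\<dots> \<le> 1 + (\<Sum>j=0..d. \<bar>U_fps $ j\<bar>)"
        using level_le_1 level_nonneg by (intro add_mono sum_mono) (auto simp: abs_mult intro!: mult_left_le)
      finally show ?thesis .
    qed
    obtain i where "(1 + (\<Sum>j=0..d. \<bar>U_fps $ j\<bar>)) / \<bar>R $ d\<bar> < (U'_fps $ 0) ^ i"
      using real_arch_pow[OF U'_0] by blast
    then have "1 + (\<Sum>j=0..d. \<bar>U_fps $ j\<bar>) < \<bar>(U'_fps ^ i * R) $ d\<bar>"
      using Rd U'_0 unfolding lead by (simp add: divide_less_eq abs_mult power_abs)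
    with bounded[of i] show False by simp
  qed
  then have "L_fps (Suc i) = U_fps * L_fps i" for i
    using L_step[of i] by (simp add: R_def)
  then show ?thesis by (induction i) (simp_all add: mult_ac)
qed

lemma vacation_geometric: "n < N \<Longrightarrow> prob (Vacation, 0, n) = prob (Vacation, 0, 0) * r2 l1 l2 ^ n"
proof (induction n)
  case (Suc n)
  have "prob (Vacation, 0, Suc n) = l2 / (l1 + l2) * prob (Vacation, 0, n)"
    using balance_vacation_Suc[OF Suc.prems] l1 l2 by (simp add: field_simps)
  then show ?case using Suc by (simp add: r2_def)
qed simp

lemma balance_vacation:
  "(l1 + l2) * prob (Vacation, 0, Suc n) + (if Suc n = N then l2 * prob (Vacation, 0, n) else 0)
     = l2 * prob (Vacation, 0, n)"
  using balance_vacation_Suc[of n] by (cases "Suc n < N"; cases "Suc n = N") auto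

definition V_fps :: "real fps" where "V_fps = Abs_fps (\<lambda>n. prob (Vacation, 0, n))"

text \<open>
  The balance equations at the low-priority states and at the vacation states combined.  The
  sum eliminates the term for the end of a vacation by reaching \<open>N\<close> low-priority customers.
\<close>

lemma boundary_equation:
  "fps_X * ((fps_const l1 + fps_const l2 + fps_const m2 - fps_const l2 * fps_X) * (L_fps 0 - V_fps)
     + (fps_const l1 + fps_const l2 - fps_const l2 * fps_X) * V_fps - fps_const m1 * L_fps 1)
   = fps_const m2 * (L_fps 0 - V_fps)"
proof (rule fps_ext)
  fix n
  define P where "P = Abs_fps (\<lambda>n. prob (Serving_Low, 0, n))"
  have P: "L_fps 0 - V_fps = P"
    by (rule fps_ext) (simp add: L_fps_def V_fps_def P_def level_def)
  have "fps_X * ((fps_const l1 + fps_const l2 + fps_const m2 - fps_const l2 * fps_X) * P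
     + (fps_const l1 + fps_const l2 - fps_const l2 * fps_X) * V_fps - fps_const m1 * L_fps 1) =
    fps_X * (fps_const (l1 + l2 + m2) * P - fps_const l2 * (fps_X * P) + fps_const (l1 + l2) * V_fps
      - fps_const l2 * (fps_X * V_fps) - fps_const m1 * L_fps 1)"
    by (simp only: fps_const_add left_diff_distrib mult.assoc add_diff_eq)
  also have "\<dots> $ n = m2 * P $ n"
  proof (cases n)
    case 0
    then show ?thesis by (simp add: P_def)
  next
    case (Suc k)
    have "(fps_const (l1 + l2 + m2) * P - fps_const l2 * (fps_X * P) + fps_const (l1 + l2) * V_fps
      - fps_const l2 * (fps_X * V_fps) - fps_const m1 * L_fps 1) $ k =
      (l1 + l2 + m2) * P $ k - l2 * (if k = 0 then 0 else P $ (k - 1)) + (l1 + l2) * V_fps $ k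
       - l2 * (if k = 0 then 0 else V_fps $ (k - 1)) - m1 * level 1 k"
      by (simp only: fps_sub_nth fps_add_nth fps_mult_left_const_nth fps_X_mult_nth L_fps_def fps_nth_Abs_fps)
    also have "\<dots> = m2 * P $ Suc k"
    proof (cases k)
      case 0
      then show ?thesis using balance_vacation_0 by (simp add: P_def V_fps_def)
    next
      case (Suc j)
      then show ?thesis using balance_low[of j] balance_vacation[of j] by (simp add: P_def V_fps_def)
    qed
    finally show ?thesis using Suc by (simp only: fps_X_mult_nth) simp
  qed
  finally show "(fps_X * ((fps_const l1 + fps_const l2 + fps_const m2 - fps_const l2 * fps_X) * (L_fps 0 - V_fps)
     + (fps_const l1 + fps_const l2 - fps_const l2 * fps_X) * V_fps - fps_const m1 * L_fps 1)) $ n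
   = (fps_const m2 * (L_fps 0 - V_fps)) $ n" unfolding P by simp
qed

end

section \<open>The kernel and its conjugate\<close>

text \<open>
  At \<open>x = 1\<close> both \<open>(x * s)^2\<close> and \<open>f^2\<close> equal \<open>(m1 - l1)^2\<close>, hence the factor \<open>x - 1\<close>; the terms of
  degree 4 cancel, which leaves a quadratic factor with reciprocal roots \<open>e1\<close> and \<open>e2\<close>.
\<close>

lemma kernel_factorization:
  fixes l1 l2 m1 m2 e1 e2 x s :: "'a :: comm_ring_1"
  assumes l1: "l1 = 1 - l2 - m1 - m2" and s: "s * s = (1 - m2 - l2 * x) * (1 - m2 - l2 * x) - 4 * l1 * m1"
    and e: "m2 * (e1 + e2) = 1 - 2 * m1" "m2 * m2 * (e1 * e2) = - ((m1 - m2) * l2)"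
    and f: "f = l2 * x\<^sup>2 - (1 - 2 * m1 + m2) * x + 2 * m2"
  shows "(x * s - f) * (x * s + f) = 4 * (m2 * m2) * (x - 1) * ((1 - e1 * x) * (1 - e2 * x))"
proof -
  have "(x * s - f) * (x * s + f) = x * x * (s * s) - f * f" by (simp add: algebra_simps)
  also have "\<dots> = (x - 1) * (4 * (m2 * m2) - 4 * m2 * (1 - 2 * m1) * x + 4 * (- ((m1 - m2) * l2)) * x * x)"
    unfolding s f l1 by (simp add: algebra_simps power2_eq_square)
  also have "\<dots> = 4 * (m2 * m2) * (x - 1) * ((1 - e1 * x) * (1 - e2 * x))"
    unfolding e[symmetric] by (simp add: algebra_simps)
  finally show ?thesis .
qed

lemma kernel_equation:
  fixes l1 l2 m1 m2 x s u Q V :: "'a :: comm_ring_1"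
  assumes l1: "l1 = 1 - l2 - m1 - m2" and u: "2 * (m1 * u) = (1 - m2 - l2 * x) - s"
    and bal: "x * ((l1 + l2 + m2 - l2 * x) * (Q - V) + (l1 + l2 - l2 * x) * V - m1 * (Q * u)) = m2 * (Q - V)"
  shows "Q * (x * s - (l2 * x\<^sup>2 - (1 - 2 * m1 + m2) * x + 2 * m2)) = 2 * m2 * (x - 1) * V"
proof -
  have "2 * (m2 * (Q - V)) =
      x * (2 * ((l1 + l2 + m2 - l2 * x) * (Q - V)) + 2 * ((l1 + l2 - l2 * x) * V) - Q * (2 * (m1 * u)))"
    unfolding bal[symmetric] by (simp add: algebra_simps)
  then have "2 * (m2 * (Q - V)) = x * (2 * ((l1 + l2 + m2 - l2 * x) * (Q - V)) + 2 * ((l1 + l2 - l2 * x) * V)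
      - Q * ((1 - m2 - l2 * x) - s))"
    unfolding u .
  then show ?thesis unfolding l1 by (simp add: algebra_simps power2_eq_square)
qed

context stationary_priority_queue
begin

definition F_fps :: "real fps" where
  "F_fps = fps_const l2 * fps_X\<^sup>2 - (1 - 2 * fps_const m1 + fps_const m2) * fps_X + 2 * fps_const m2"

lemma fps_const_l1: "fps_const l1 = 1 - fps_const l2 - fps_const m1 - fps_const m2"
proof -
  have "l1 = 1 - l2 - m1 - m2" using normalized by simp
  then have "fps_const l1 = fps_const (1 - l2 - m1 - m2)" by simp
  then show ?thesis by (simp only: fps_const_sub[symmetric] fps_const_1_eq_1)
qed

lemma L0_kernel: "L_fps 0 * (fps_X * S_fps - F_fps) = 2 * fps_const m2 * (fps_X - 1) * V_fps"
  unfolding F_fps_def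
proof (rule kernel_equation[OF fps_const_l1])
  show "2 * (fps_const m1 * U_fps) = 1 - fps_const m2 - fps_const l2 * fps_X - S_fps"
    using U_2m1 by (simp add: W_fps_def)
  show "fps_X * ((fps_const l1 + fps_const l2 + fps_const m2 - fps_const l2 * fps_X) * (L_fps 0 - V_fps)
     + (fps_const l1 + fps_const l2 - fps_const l2 * fps_X) * V_fps - fps_const m1 * (L_fps 0 * U_fps))
   = fps_const m2 * (L_fps 0 - V_fps)"
    using boundary_equation L_geometric[of 1] by simp
qed

definition eta_disc :: real where "eta_disc = (1 - 2 * m1)\<^sup>2 + 4 * (m1 - m2) * l2"

lemma eta_disc_pos: "eta_disc > 0"
proof -
  have m: "1 - 2 * m1 = l1 + l2 + m2 - m1" using normalized by simp
  have eq: "eta_disc = (l1 + l2 - (m2 - m1))\<^sup>2 + 4 * (m2 - m1) * l1"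
    unfolding eta_disc_def m by (simp add: power2_eq_square algebra_simps)
  consider "m2 > m1" | "m2 = m1" | "m2 < m1" by linarith
  then show ?thesis
  proof cases
    case 1
    then show ?thesis unfolding eq using l1 by (intro add_nonneg_pos) auto
  next
    case 2
    then show ?thesis unfolding eq using l1 l2 by simp
  next
    case 3
    then show ?thesis unfolding eta_disc_def using l2 by (intro add_nonneg_pos) auto
  qed
qed

lemma eta_eqs: "\<eta>1 = ((1 - 2 * m1) + sqrt eta_disc) / (2 * m2)" "\<eta>2 = ((1 - 2 * m1) - sqrt eta_disc) / (2 * m2)"
  by (simp_all add: eta1_def eta2_def eta_disc_def)

lemma eta_sum: "m2 * (\<eta>1 + \<eta>2) = 1 - 2 * m1"
  unfolding eta_eqs using m2 by (simp add: field_simps)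

lemma eta_prod: "m2 * m2 * (\<eta>1 * \<eta>2) = - ((m1 - m2) * l2)"
proof -
  have "m2 * m2 * (\<eta>1 * \<eta>2) = ((1 - 2 * m1) + sqrt eta_disc) * ((1 - 2 * m1) - sqrt eta_disc) / 4"
    unfolding eta_eqs using m2 by simp
  also have "\<dots> = ((1 - 2 * m1)\<^sup>2 - sqrt eta_disc * sqrt eta_disc) / 4"
    by (simp add: power2_eq_square algebra_simps)
  also have "sqrt eta_disc * sqrt eta_disc = eta_disc" using eta_disc_pos by simp
  finally show ?thesis unfolding eta_disc_def by (simp add: field_simps)
qed

lemma eta2_less_eta1: "\<eta>2 < \<eta>1"
  unfolding eta_eqs using m2 eta_disc_pos by (simp add: divide_strict_right_mono)

lemma kernel_conjugate:
  "(fps_X * S_fps - F_fps) * (fps_X * S_fps + F_fps) = 4 * (fps_const m2 * fps_const m2) * (fps_X - 1) *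
     ((1 - fps_const \<eta>1 * fps_X) * (1 - fps_const \<eta>2 * fps_X))"
proof (rule kernel_factorization[OF fps_const_l1])
  show "S_fps * S_fps = (1 - fps_const m2 - fps_const l2 * fps_X) * (1 - fps_const m2 - fps_const l2 * fps_X)
      - 4 * fps_const l1 * fps_const m1"
    using S_square by (simp add: W_fps_def)
  have "fps_const (m2 * (\<eta>1 + \<eta>2)) = fps_const (1 - 2 * m1)" unfolding eta_sum ..
  then show "fps_const m2 * (fps_const \<eta>1 + fps_const \<eta>2) = 1 - 2 * fps_const m1"
    by (simp only: fps_const_of(2) fps_const_1_eq_1[symmetric] fps_const_add fps_const_mult fps_const_sub)
  have "fps_const (m2 * m2 * (\<eta>1 * \<eta>2)) = fps_const (- ((m1 - m2) * l2))" unfolding eta_prod ..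
  then show "fps_const m2 * fps_const m2 * (fps_const \<eta>1 * fps_const \<eta>2) = - ((fps_const m1 - fps_const m2) * fps_const l2)"
    by (simp only: fps_const_mult fps_const_sub fps_const_neg)
qed (simp only: F_fps_def)

lemma L0_formula:
  "fps_const (2 * m2) * L_fps 0 * ((1 - fps_const \<eta>1 * fps_X) * (1 - fps_const \<eta>2 * fps_X)) = (fps_X * S_fps + F_fps) * V_fps"
proof -
  let ?q = "(1 - fps_const \<eta>1 * fps_X) * (1 - fps_const \<eta>2 * fps_X)"
  let ?c = "fps_const (2 * m2) * (fps_X - 1)"
  have two: "2 * fps_const m2 = fps_const (2 * m2)" unfolding fps_const_of(2) by (simp only: fps_const_mult)
  have four: "4 * (fps_const m2 * fps_const m2) = fps_const (2 * m2) * fps_const (2 * m2)"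
    unfolding two[symmetric] by (simp add: algebra_simps)
  have "?c * (fps_const (2 * m2) * L_fps 0 * ?q) = L_fps 0 * (fps_const (2 * m2) * fps_const (2 * m2) * (fps_X - 1) * ?q)"
    by (simp only: mult_ac)
  also have "\<dots> = L_fps 0 * (fps_X * S_fps - F_fps) * (fps_X * S_fps + F_fps)"
    unfolding four[symmetric] kernel_conjugate[symmetric] by (simp only: mult.assoc)
  also have "\<dots> = ?c * ((fps_X * S_fps + F_fps) * V_fps)"
    unfolding L0_kernel two by (simp only: mult_ac)
  finally have "?c * (fps_const (2 * m2) * L_fps 0 * ?q) = ?c * ((fps_X * S_fps + F_fps) * V_fps)" .
  moreover have "?c \<noteq> 0"
  proof
    assume "?c = 0"
    then have "?c $ 0 = 0" by simp
    then show False using m2 by simp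
  qed
  ultimately show ?thesis by simp
qed

text \<open>
  The numerator of \<open>L i\<close> once its denominator has been rationalised.
\<close>

definition numerator :: "nat \<Rightarrow> real fps" where
  "numerator i = (fps_X * S_fps + F_fps) * V_fps * U_fps ^ i"

text \<open>
  \<open>Y1\<close> and \<open>Y2\<close> are \<open>numerator / (1 - \<eta>1 * z)\<close> and \<open>numerator / (1 - \<eta>2 * z)\<close>, written
  without division.
\<close>

definition Y1_fps where "Y1_fps i = fps_const (2 * m2) * L_fps i * (1 - fps_const \<eta>2 * fps_X)"

definition Y2_fps where "Y2_fps i = fps_const (2 * m2) * L_fps i * (1 - fps_const \<eta>1 * fps_X)"

lemma L_formula:
  "fps_const (2 * m2) * L_fps i * ((1 - fps_const \<eta>1 * fps_X) * (1 - fps_const \<eta>2 * fps_X)) = numerator i"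
  unfolding numerator_def L0_formula[symmetric] L_geometric[of i] by (simp only: mult_ac)

lemma Y_eqs: "Y1_fps i * (1 - fps_const \<eta>1 * fps_X) = numerator i" "Y2_fps i * (1 - fps_const \<eta>2 * fps_X) = numerator i"
  unfolding L_formula[symmetric] Y1_fps_def Y2_fps_def by (simp_all only: mult_ac)

lemma level_partial_fractions:
  "level i n = (\<eta>1 * Y1_fps i $ n - \<eta>2 * Y2_fps i $ n) / (2 * m2 * (\<eta>1 - \<eta>2))"
proof -
  have "fps_const \<eta>1 * Y1_fps i - fps_const \<eta>2 * Y2_fps i = fps_const (2 * m2) * L_fps i * (fps_const \<eta>1 - fps_const \<eta>2)"
    unfolding Y1_fps_def Y2_fps_def by (simp only: right_diff_distrib left_diff_distrib mult_ac mult_1_right) simp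
  also have "\<dots> = fps_const (2 * m2 * (\<eta>1 - \<eta>2)) * L_fps i"
    by (simp only: mult_ac fps_const_sub fps_const_mult[symmetric])
  finally have "(fps_const \<eta>1 * Y1_fps i - fps_const \<eta>2 * Y2_fps i) $ n = 2 * m2 * (\<eta>1 - \<eta>2) * level i n"
    by (simp only: fps_mult_left_const_nth L_fps_def fps_nth_Abs_fps)
  then show ?thesis using m2 eta2_less_eta1 by (simp add: divide_simps mult.commute)
qed

section \<open>Evaluation and normalisation\<close>

lemma branch_factors_nonneg: "\<bar>z\<bar> \<le> 1 / bb1 \<Longrightarrow> 1 - bb1 * z \<ge> 0 \<and> 1 - bb2 * z > 0 \<and> \<bar>bb2 * z\<bar> < 1"
proof -
  assume z: "\<bar>z\<bar> \<le> 1 / bb1"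
  have "\<bar>bb1 * z\<bar> \<le> 1" using z b_pos by (simp add: abs_mult field_simps)
  moreover have "\<bar>bb2 * z\<bar> < 1"
  proof (cases "z = 0")
    case False
    then have "\<bar>bb2 * z\<bar> < \<bar>bb1 * z\<bar>" using b_pos b2_less_b1 by (simp add: abs_mult)
    then show ?thesis using \<open>\<bar>bb1 * z\<bar> \<le> 1\<close> by linarith
  qed simp
  ultimately show ?thesis by (simp add: abs_le_iff abs_less_iff)
qed

lemma disc_branch_factors: "disc z = root_const\<^sup>2 * ((1 - bb1 * z) * (1 - bb2 * z))"
proof -
  have "L1 - l2 * z = L1 * (1 - bb1 * z)" "L2 - l2 * z = L2 * (1 - bb2 * z)"
    using L_pos by (simp_all add: right_diff_distrib b_L)
  moreover have "root_const\<^sup>2 = L1 * L2" using L_pos by (simp add: root_const_def)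
  ultimately show ?thesis unfolding disc_factor by (simp only: mult_ac)
qed

lemma eval_S: "\<bar>z\<bar> \<le> 1 / bb1 \<Longrightarrow> has_eval S_fps z (sqrt (disc z))"
proof -
  assume z: "\<bar>z\<bar> \<le> 1 / bb1"
  have 1: "has_eval (binom_fps (1/2) bb1) z (sqrt (1 - bb1 * z))"
    unfolding has_eval_def using eval_root[OF b_pos(1) z] sqrt_germ_abs_summable[OF b_pos(1) sqrt_germ_root z] by simp
  have "\<bar>z\<bar> \<le> 1 / bb2" using z b_pos b2_less_b1 by (meson frac_le less_imp_le order_trans zero_le_one order_refl)
  then have 2: "has_eval (binom_fps (1/2) bb2) z (sqrt (1 - bb2 * z))"
    unfolding has_eval_def using eval_root[OF b_pos(2)] sqrt_germ_abs_summable[OF b_pos(2) sqrt_germ_root] by simp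
  have "sqrt (disc z) = root_const * (sqrt (1 - bb1 * z) * sqrt (1 - bb2 * z))"
    unfolding disc_branch_factors using L_pos by (simp add: real_sqrt_mult root_const_def)
  then show ?thesis unfolding S_fps_def using has_eval_mult[OF has_eval_const has_eval_mult[OF 1 2]] by simp
qed

lemma eval_W: "has_eval W_fps z (1 - m2 - l2 * z)"
  unfolding W_fps_def fps_const_of(1)[symmetric] by (intro has_eval_intros)

definition u_of :: "real \<Rightarrow> real" where "u_of z = (1 - m2 - l2 * z - sqrt (disc z)) / (2 * m1)"

lemma eval_U: "\<bar>z\<bar> \<le> 1 / bb1 \<Longrightarrow> has_eval U_fps z (u_of z)"
  using has_eval_mult[OF has_eval_const has_eval_diff[OF eval_W eval_S], of z "1 / (2 * m1)"]
  unfolding U_fps_def u_of_def by simp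

lemma F_fps_alt: "F_fps = fps_const l2 * fps_X\<^sup>2 - fps_const (1 - 2 * m1 + m2) * fps_X + fps_const (2 * m2)"
  unfolding F_fps_def
  by (simp only: fps_const_of(2) fps_const_1_eq_1[symmetric] fps_const_add fps_const_mult fps_const_sub)

lemma eval_F: "has_eval F_fps z (F_fun l2 m1 m2 z)"
  unfolding F_fps_alt F_fun_def by (intro has_eval_intros)

definition V_of :: "real \<Rightarrow> real" where "V_of z = prob (Vacation, 0, 0) * H_fun l1 l2 N z"

lemma V_finite: "N \<le> n \<Longrightarrow> V_fps $ n = 0" by (simp add: V_fps_def)

lemma eval_V: "has_eval V_fps z (V_of z)"
proof -
  have "summable (\<lambda>n. \<bar>V_fps $ n * z ^ n\<bar>)"
    by (rule summable_finite[of "{..<N}"]) (auto simp: V_finite not_less)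
  moreover have "eval_fps V_fps z = (\<Sum>n<N. V_fps $ n * z ^ n)"
    unfolding eval_fps_def by (rule suminf_finite) (auto simp: V_finite not_less)
  moreover have "(\<Sum>n<N. V_fps $ n * z ^ n) = V_of z"
    unfolding V_of_def H_fun_def sum_distrib_left atLeast0LessThan
  proof (intro sum.cong refl)
    fix k assume "k \<in> {..<N}"
    then have "V_fps $ k = prob (Vacation, 0, 0) * r2 l1 l2 ^ k"
      using vacation_geometric[of k] by (simp only: V_fps_def fps_nth_Abs_fps lessThan_iff)
    then show "V_fps $ k * z ^ k = prob (Vacation, 0, 0) * (r2 l1 l2 * z) ^ k"
      by (simp only: power_mult_distrib mult.assoc)
  qed
  ultimately show ?thesis by (simp add: has_eval_def)
qed

lemma eval_numerator:
  "\<bar>z\<bar> \<le> 1 / bb1 \<Longrightarrow> has_eval (numerator i) z ((z * sqrt (disc z) + F_fun l2 m1 m2 z) * V_of z * u_of z ^ i)"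
  unfolding numerator_def by (intro has_eval_intros eval_S eval_F eval_V eval_U)

lemma eval_L: "has_eval (L_fps i) 1 (suminf (level i))"
  using level_sums(1)[of i] level_nonneg by (simp add: has_eval_def L_fps_def eval_fps_def)

lemma one_le_z1: "\<bar>1\<bar> \<le> 1 / bb1" using b1_less_1 b_pos by simp

lemma disc_1: "sqrt (disc 1) = m1 - l1"
proof -
  have "1 - m2 - l2 = l1 + m1" using normalized by simp
  then have "disc 1 = (l1 + m1)\<^sup>2 - 4 * l1 * m1" by (simp add: disc_def)
  then have "disc 1 = (m1 - l1)\<^sup>2" by (simp add: power2_eq_square algebra_simps)
  then show ?thesis using l1_less_m1 by simp
qed

lemma F_1: "F_fun l2 m1 m2 1 = m1 - l1"
  using normalized by (simp add: F_fun_def)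

lemma eta_at_1: "m2 * ((1 - \<eta>1) * (1 - \<eta>2)) = m1 * (1 - rho1 l1 m1 - rho2 l2 m2)"
proof -
  have "m2 * (m2 * ((1 - \<eta>1) * (1 - \<eta>2))) = m2 * m2 - m2 * (m2 * (\<eta>1 + \<eta>2)) + m2 * m2 * (\<eta>1 * \<eta>2)"
    by (simp add: algebra_simps)
  also have "\<dots> = m2 * (m1 - l1) - m1 * l2"
  proof -
    have m: "1 - 2 * m1 = l1 + l2 + m2 - m1" using normalized by simp
    show ?thesis unfolding eta_sum eta_prod m by (simp add: algebra_simps)
  qed
  also have "\<dots> = m2 * (m1 * (1 - rho1 l1 m1 - rho2 l2 m2))"
    using m1 m2 by (simp add: rho1_def rho2_def right_diff_distrib)
  finally show ?thesis using m2 by (simp only: mult_cancel_left) simp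
qed

text \<open>
  At \<open>z = 1\<close> the root \<open>u\<close> is \<open>rho1\<close>, so the total mass is the geometric series
  \<open>L 0 (1) / (1 - rho1) = 1\<close>; the formula for \<open>L 0\<close> at \<open>z = 1\<close> then determines \<open>V (1)\<close>.
\<close>

lemma V_1: "V_of 1 = 1 - rho1 l1 m1 - rho2 l2 m2"
proof -
  define r where "r = l1 / m1"
  have r: "r < 1" "r \<ge> 0" using l1_less_m1 l1 m1 by (simp_all add: r_def)
  have u: "u_of 1 = r"
  proof -
    have "1 - m2 - l2 = l1 + m1" using normalized by simp
    then show ?thesis unfolding u_of_def disc_1 using m1 by (simp add: r_def)
  qed
  define A where "A = suminf (level 0)"
  have "suminf (level i) = A * r ^ i" for i
    using has_eval_unique[OF eval_L[of i]] has_eval_mult[OF eval_L[of 0] has_eval_power[OF eval_U[OF one_le_z1], of i]]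
    by (simp add: L_geometric[of i, symmetric] A_def u)
  then have "(\<lambda>i. A * r ^ i) sums 1" using level_sums(2) by simp
  moreover have "(\<lambda>i. A * r ^ i) sums (A * (1 / (1 - r)))"
    using r by (intro sums_mult geometric_sums) auto
  ultimately have "A * (1 / (1 - r)) = 1" by (rule sums_unique2[symmetric])
  then have A: "A = 1 - r" using r by (simp add: field_simps)
  have "has_eval (fps_const (2 * m2) * L_fps 0 * ((fps_const 1 - fps_const \<eta>1 * fps_X) * (fps_const 1 - fps_const \<eta>2 * fps_X)))
     1 (2 * m2 * A * ((1 - \<eta>1 * 1) * (1 - \<eta>2 * 1)))"
    unfolding A_def by (intro has_eval_intros eval_L)
  moreover have "has_eval ((fps_X * S_fps + F_fps) * V_fps) 1 ((1 * sqrt (disc 1) + F_fun l2 m1 m2 1) * V_of 1)"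
    by (intro has_eval_intros eval_S eval_F eval_V one_le_z1)
  ultimately have "2 * m2 * A * ((1 - \<eta>1 * 1) * (1 - \<eta>2 * 1)) = (1 * sqrt (disc 1) + F_fun l2 m1 m2 1) * V_of 1"
    unfolding fps_const_1_eq_1 L0_formula by (rule has_eval_unique)
  moreover have "2 * A * (m2 * ((1 - \<eta>1) * (1 - \<eta>2))) = 2 * m2 * A * ((1 - \<eta>1 * 1) * (1 - \<eta>2 * 1))"
    by simp
  moreover have "(1 * sqrt (disc 1) + F_fun l2 m1 m2 1) * V_of 1 = 2 * (m1 - l1) * V_of 1"
    unfolding disc_1 F_1 by simp
  ultimately have "2 * A * (m2 * ((1 - \<eta>1) * (1 - \<eta>2))) = 2 * (m1 - l1) * V_of 1" by (simp only:)
  then have "2 * A * (m1 * (1 - rho1 l1 m1 - rho2 l2 m2)) = 2 * (m1 - l1) * V_of 1" unfolding eta_at_1 .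
  moreover have "A * m1 = m1 - l1" using A m1 by (simp add: r_def left_diff_distrib)
  then have "2 * A * (m1 * (1 - rho1 l1 m1 - rho2 l2 m2)) = 2 * (m1 - l1) * (1 - rho1 l1 m1 - rho2 l2 m2)"
    by (simp add: mult.assoc[symmetric])
  ultimately have "2 * (m1 - l1) * (1 - rho1 l1 m1 - rho2 l2 m2) = 2 * (m1 - l1) * V_of 1" by simp
  then show ?thesis using l1_less_m1 by simp
qed

lemma H_pos: "z > 0 \<Longrightarrow> H_fun l1 l2 N z > 0"
  unfolding H_fun_def using N l1 l2 by (intro sum_pos) (auto simp: r2_def)

lemma V_beta: "V_of z = (1 - rho1 l1 m1 - rho2 l2 m2) * beta_fun l1 l2 N z"
proof -
  have "prob (Vacation, 0, 0) = (1 - rho1 l1 m1 - rho2 l2 m2) / H_fun l1 l2 N 1"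
    using V_1 H_pos[of 1] by (simp add: V_of_def eq_divide_eq)
  then show ?thesis by (simp add: V_of_def beta_fun_def)
qed

section \<open>The singularity at the branch point\<close>

lemma germ_S: "sqrt_germ bb1 S_fps 0 (root_const * sqrt (1 - bb2 / bb1))"
proof -
  have 1: "\<bar>bb2\<bar> * (1 / bb1) < 1" and 2: "\<bar>bb2 * (1 / bb1)\<bar> < 1"
    using b_pos b2_less_b1 by (simp_all add: abs_mult)
  have 3: "1 - bb2 / bb1 \<ge> 0" using b_pos b2_less_b1 by simp
  have "sqrt_germ bb1 (binom_fps (1/2) bb2) (sqrt (1 - bb2 / bb1)) 0"
    using sqrt_germ_analytic[OF fps_conv_radius_binom[OF 1, of "1/2"]] eval_binom_fps[OF 2, of "1/2"] powr_half_sqrt[OF 3]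
    by simp
  from sqrt_germ_mult[OF b_pos(1) sqrt_germ_const sqrt_germ_mult[OF b_pos(1) sqrt_germ_root this], of root_const]
  show ?thesis by (simp add: S_fps_def)
qed

lemma L1_z1: "l2 / bb1 = L1" using l2 L_pos by (simp add: b_L)

lemma germ_U: "sqrt_germ bb1 U_fps (sqrt (rho1 l1 m1)) (- (root_const * sqrt (1 - bb2 / bb1)) / (2 * m1))"
proof -
  have "sqrt_germ bb1 W_fps (1 - m2 - l2 * (1 / bb1)) (0 - (l2 * 0 + 0 * (1 / bb1)))"
    unfolding W_fps_def fps_const_of(1)[symmetric]
    by (intro sqrt_germ_diff sqrt_germ_mult sqrt_germ_const sqrt_germ_X b_pos)
  then have W: "sqrt_germ bb1 W_fps (2 * sqrt (l1 * m1)) 0" using L1_z1 by (simp add: L_eqs)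
  have "sqrt (rho1 l1 m1) = 1 / (2 * m1) * (2 * sqrt (l1 * m1))"
  proof -
    have "rho1 l1 m1 = l1 * m1 / (m1 * m1)" using m1 by (simp add: rho1_def)
    then have "sqrt (rho1 l1 m1) = sqrt (l1 * m1) / sqrt (m1 * m1)" by (simp only: real_sqrt_divide)
    then show ?thesis using m1 by simp
  qed
  then show ?thesis
    using sqrt_germ_mult[OF b_pos(1) sqrt_germ_const[of _ "1 / (2 * m1)"] sqrt_germ_diff[OF b_pos(1) W germ_S]]
    unfolding U_fps_def by simp
qed

lemma germ_V: "sqrt_germ bb1 V_fps (V_of (1 / bb1)) 0"
proof -
  have "fps_conv_radius V_fps = \<infinity>"
    unfolding fps_conv_radius_def
    using eval_V by (intro conv_radius_inftyI'') (auto simp: has_eval_def intro: summable_rabs_cancel)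
  moreover have "eval_fps V_fps (1 / bb1) = V_of (1 / bb1)" using eval_V by (simp add: has_eval_def)
  ultimately show ?thesis using sqrt_germ_analytic[of bb1 V_fps] by simp
qed

lemma germ_F: "sqrt_germ bb1 F_fps (F_fun l2 m1 m2 (1 / bb1)) 0"
proof -
  have "sqrt_germ bb1 F_fps (l2 * (1 / bb1)\<^sup>2 - (1 - 2 * m1 + m2) * (1 / bb1) + 2 * m2)
      (l2 * (real 2 * (1 / bb1) ^ (2 - 1) * 0) + 0 * (1 / bb1)\<^sup>2 - ((1 - 2 * m1 + m2) * 0 + 0 * (1 / bb1)) + 0)"
    unfolding F_fps_alt
    by (intro sqrt_germ_diff sqrt_germ_add sqrt_germ_mult sqrt_germ_power sqrt_germ_const sqrt_germ_X b_pos)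
  then show ?thesis by (simp add: F_fun_def)
qed

text \<open>
  The singular part comes from \<open>z * S\<close> and, by the product rule, from \<open>u ^ i\<close>, where it carries the
  factor \<open>F (1 / b1)\<close>; the latter is the origin of the correction \<open>1 + i * B\<close>.
\<close>

lemma germ_numerator:
  defines "c \<equiv> root_const * sqrt (1 - bb2 / bb1)" and "u0 \<equiv> sqrt (rho1 l1 m1)"
    and "f \<equiv> F_fun l2 m1 m2 (1 / bb1)" and "v \<equiv> V_of (1 / bb1)"
  shows "sqrt_germ bb1 (numerator i) (f * v * u0 ^ i)
     (f * v * (real i * u0 ^ (i - 1) * (- c / (2 * m1))) + c / bb1 * v * u0 ^ i)"
  using sqrt_germ_mult[OF b_pos(1) sqrt_germ_mult[OF b_pos(1) sqrt_germ_add[OF b_pos(1)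
      sqrt_germ_mult[OF b_pos(1) sqrt_germ_X germ_S] germ_F] germ_V] sqrt_germ_power[OF b_pos(1) germ_U, of i]]
  unfolding numerator_def assms by simp

section \<open>Location of the poles\<close>

lemma z1_gt_1: "1 / bb1 > 1" using b1_less_1 b_pos by simp

lemma disc_pos: "\<bar>z\<bar> \<le> 1 / bb1 \<Longrightarrow> disc z \<ge> 0" "\<bar>z\<bar> < 1 / bb1 \<Longrightarrow> disc z > 0"
proof -
  have r: "root_const\<^sup>2 > 0" using L_pos by (simp add: root_const_def)
  show "disc z \<ge> 0" if "\<bar>z\<bar> \<le> 1 / bb1"
    using branch_factors_nonneg[OF that] r unfolding disc_branch_factors by simp
  show "disc z > 0" if z: "\<bar>z\<bar> < 1 / bb1"
  proof -
    have "bb1 * z \<le> bb1 * \<bar>z\<bar>" using b_pos by (intro mult_left_mono) auto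
    also have "\<dots> < 1" using z b_pos by (simp add: field_simps)
    finally show ?thesis using branch_factors_nonneg[of z] z r unfolding disc_branch_factors by simp
  qed
qed

lemma kernel_at:
  assumes "\<bar>z\<bar> \<le> 1 / bb1"
  shows "(z * sqrt (disc z) - F_fun l2 m1 m2 z) * (z * sqrt (disc z) + F_fun l2 m1 m2 z) =
     4 * (m2 * m2) * (z - 1) * ((1 - \<eta>1 * z) * (1 - \<eta>2 * z))"
proof (rule kernel_factorization[OF _ _ eta_sum eta_prod F_fun_def])
  show "l1 = 1 - l2 - m1 - m2" using normalized by simp
  show "sqrt (disc z) * sqrt (disc z) = (1 - m2 - l2 * z) * (1 - m2 - l2 * z) - 4 * l1 * m1"
    using disc_pos(1)[OF assms] by (simp add: disc_def power2_eq_square)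
qed

lemma F_z1: "l2 * F_fun l2 m1 m2 (1 / bb1) = 2 * D_const l1 l2 m1 m2"
proof -
  have b: "1 / bb1 = L1 / l2" by (simp add: b_L)
  have L: "L1 = l1 + l2 + m1 - 2 * sqrt (l1 * m1)" using normalized by (simp add: L_eqs)
  have m: "1 - 2 * m1 + m2 = l1 + l2 + 2 * m2 - m1" using normalized by simp
  have "l2 * F_fun l2 m1 m2 (L1 / l2) = L1 * L1 - (1 - 2 * m1 + m2) * L1 + 2 * m2 * l2"
  proof -
    define M where "M = 1 - 2 * m1 + m2"
    show ?thesis using l2 unfolding F_fun_def M_def[symmetric]
      by (simp add: power2_eq_square right_diff_distrib distrib_left)
  qed
  also have "\<dots> = L1 * (L1 - (l1 + l2 + 2 * m2 - m1)) + 2 * m2 * l2"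
    unfolding m by (simp add: algebra_simps)
  also have "L1 - (l1 + l2 + 2 * m2 - m1) = 2 * (m1 - m2 - sqrt (l1 * m1))"
    unfolding L by simp
  finally show ?thesis unfolding b D_const_def L[symmetric] by simp
qed

lemma F_z1_sign: "F_fun l2 m1 m2 (1 / bb1) > 0 \<longleftrightarrow> D_const l1 l2 m1 m2 > 0"
  "F_fun l2 m1 m2 (1 / bb1) < 0 \<longleftrightarrow> D_const l1 l2 m1 m2 < 0"
  "F_fun l2 m1 m2 (1 / bb1) = 0 \<longleftrightarrow> D_const l1 l2 m1 m2 = 0"
proof -
  have F: "F_fun l2 m1 m2 (1 / bb1) = 2 * D_const l1 l2 m1 m2 / l2"
    using F_z1 l2 by (simp add: eq_divide_eq mult.commute)
  show "F_fun l2 m1 m2 (1 / bb1) > 0 \<longleftrightarrow> D_const l1 l2 m1 m2 > 0"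
    "F_fun l2 m1 m2 (1 / bb1) < 0 \<longleftrightarrow> D_const l1 l2 m1 m2 < 0"
    "F_fun l2 m1 m2 (1 / bb1) = 0 \<longleftrightarrow> D_const l1 l2 m1 m2 = 0"
    unfolding F using l2 by (auto simp: zero_less_divide_iff divide_less_0_iff)
qed

lemma disc_z1: "disc (1 / bb1) = 0" using b_pos by (simp add: disc_branch_factors)

lemma eta_at_z1: "4 * (m2 * m2) * (1 / bb1 - 1) * ((1 - \<eta>1 / bb1) * (1 - \<eta>2 / bb1)) = - (F_fun l2 m1 m2 (1 / bb1))\<^sup>2"
  using kernel_at[of "1 / bb1"] b_pos by (simp add: disc_z1 power2_eq_square)

lemma coeff_z1_pos: "4 * (m2 * m2) * (1 / bb1 - 1) > 0" using m2 z1_gt_1 by simp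

lemma eta1_pos: "\<eta>1 > 0"
proof (cases "m1 > m2")
  case True
  have "m2 * m2 * (\<eta>1 * \<eta>2) < 0" unfolding eta_prod using True l2 by simp
  then have "\<eta>1 * \<eta>2 < 0" using m2 by (simp add: mult_less_0_iff zero_less_mult_iff)
  then show ?thesis using eta2_less_eta1 by (auto simp: mult_less_0_iff)
next
  case False
  then have "m2 * (\<eta>1 + \<eta>2) > 0" unfolding eta_sum using normalized l1 l2 by linarith
  then have "\<eta>1 + \<eta>2 > 0" using m2 by (simp add: zero_less_mult_iff)
  then show ?thesis using eta2_less_eta1 by linarith
qed

text \<open>
  By stability the quadratic \<open>(1 - \<eta>1 * z) * (1 - \<eta>2 * z)\<close> is positive at 1, so \<open>\<eta>1\<close> and \<open>\<eta>2\<close> lie on the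
  same side of 1; it is not positive at \<open>1 / b1 > 1\<close>, so they are not both larger.
\<close>

lemma eta1_less_1: "\<eta>1 < 1"
proof (rule ccontr)
  assume "\<not> ?thesis"
  moreover have "m1 * (1 - rho1 l1 m1 - rho2 l2 m2) > 0" using m1 stable by simp
  then have "m2 * ((1 - \<eta>1) * (1 - \<eta>2)) > 0" unfolding eta_at_1 .
  then have "(1 - \<eta>1) * (1 - \<eta>2) > 0" using m2 by (simp add: zero_less_mult_iff)
  ultimately have "\<eta>1 > 1" "\<eta>2 > 1" by (auto simp: zero_less_mult_iff)
  then have "1 < \<eta>1 / bb1" "1 < \<eta>2 / bb1" using b_pos b1_less_1 by (simp_all add: less_divide_eq)
  then have "(1 - \<eta>1 / bb1) * (1 - \<eta>2 / bb1) > 0" by (intro mult_neg_neg) auto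
  from mult_pos_pos[OF coeff_z1_pos this] show False unfolding eta_at_z1
    by (simp add: not_less[symmetric])
qed

lemma eta_order:
  assumes "D_const l1 l2 m1 m2 \<noteq> 0"
  shows "\<eta>2 < bb1" "bb1 < \<eta>1"
proof -
  have "(F_fun l2 m1 m2 (1 / bb1))\<^sup>2 > 0" using assms F_z1_sign(3) by simp
  then have "4 * (m2 * m2) * (1 / bb1 - 1) * ((1 - \<eta>1 / bb1) * (1 - \<eta>2 / bb1)) < 0"
    unfolding eta_at_z1 by simp
  then have "(1 - \<eta>1 / bb1) * (1 - \<eta>2 / bb1) < 0"
    using coeff_z1_pos by (meson mult_less_0_iff not_less_iff_gr_or_eq)
  moreover have "\<eta>2 / bb1 < \<eta>1 / bb1" using eta2_less_eta1 b_pos by (simp add: divide_strict_right_mono)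
  ultimately have "\<eta>2 / bb1 < 1" "1 < \<eta>1 / bb1" by (auto simp: mult_less_0_iff)
  then show "\<eta>2 < bb1" "bb1 < \<eta>1" using b_pos by (simp_all add: divide_less_eq less_divide_eq)
qed

text \<open>
  One of \<open>\<eta>1\<close>, \<open>\<eta>2\<close> equals \<open>b1\<close>.  If it were the smaller one, then \<open>b1\<close> would be less than the mean of
  the two, which means \<open>m2 < L1\<close>; but \<open>D = 0\<close> says
  \<open>L1 * sqrt m1 = m2 * (sqrt m1 - sqrt l1)\<close>, whence \<open>L1 < m2\<close>.
\<close>

lemma eta_critical:
  assumes D: "D_const l1 l2 m1 m2 = 0"
  shows "\<eta>1 = bb1"
proof (rule ccontr)
  assume ne: "\<eta>1 \<noteq> bb1"
  have "F_fun l2 m1 m2 (1 / bb1) = 0" using D F_z1_sign(3) by simp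
  then have "4 * (m2 * m2) * (1 / bb1 - 1) * ((1 - \<eta>1 / bb1) * (1 - \<eta>2 / bb1)) = 0"
    unfolding eta_at_z1 by simp
  then have "(1 - \<eta>1 / bb1) * (1 - \<eta>2 / bb1) = 0" using coeff_z1_pos by (metis mult_eq_0_iff less_irrefl)
  then have e2: "\<eta>2 = bb1" using ne b_pos by auto
  define a c where "a = sqrt m1" and "c = sqrt l1"
  have ac: "a > c" "c > 0" "a * a = m1" "c * c = l1" "sqrt (l1 * m1) = a * c"
    using l1_less_m1 l1 m1 by (simp_all add: a_def c_def real_sqrt_mult)
  have L: "L1 = l2 + (a - c) * (a - c)" by (simp add: L1_def a_def c_def power2_eq_square)
  have L': "L1 = l1 + l2 + m1 - 2 * sqrt (l1 * m1)" using normalized by (simp add: L_eqs)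
  have D0: "L1 * (m1 - m2 - sqrt (l1 * m1)) + l2 * m2 = 0" using D unfolding D_const_def L' .
  have "m1 - m2 - sqrt (l1 * m1) = a * (a - c) - m2"
    unfolding ac(5) by (simp add: right_diff_distrib ac(3))
  then have "(a - c) * (L1 * a - m2 * (a - c)) = L1 * (m1 - m2 - sqrt (l1 * m1)) + (L1 - (a - c) * (a - c)) * m2"
    by (simp only:) (simp add: algebra_simps)
  also have "\<dots> = 0" using D0 unfolding L by simp
  finally have "L1 * a = m2 * (a - c)" using ac by simp
  moreover have "L1 * (a - c) < L1 * a" using ac L_pos by simp
  ultimately have "L1 * (a - c) < m2 * (a - c)" by simp
  then have m2L: "L1 < m2" using ac by simp
  have "L1 * bb1 = l2" using L_pos by (simp add: b_L)
  then have "L1 * (m1 - m2 - sqrt (l1 * m1) + bb1 * m2) = 0" using D0 by (simp add: algebra_simps)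
  then have "m2 * bb1 = m2 - m1 + sqrt (l1 * m1)" using L_pos by (simp add: mult.commute)
  moreover have "m2 * (bb1 + bb1) < m2 * (\<eta>1 + \<eta>2)" using e2 eta2_less_eta1 m2 by simp
  ultimately have "2 * m2 + 2 * sqrt (l1 * m1) < 1" unfolding eta_sum by (simp add: ring_distribs)
  then have "m2 < L1" using L_eqs(1) by linarith
  then show False using m2L by simp
qed

text \<open>
  At a zero of \<open>F\<close> the kernel identity equates \<open>(z * S)^2 > 0\<close> with a multiple of
  \<open>(1 - \<eta>1 * z) * (1 - \<eta>2 * z)\<close>, which is not positive between \<open>1 / \<eta>1\<close> and \<open>1 / b1\<close>.
\<close>

lemma F_nonzero:
  assumes D: "D_const l1 l2 m1 m2 \<noteq> 0" and z: "1 / \<eta>1 \<le> z" "z < 1 / bb1"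
  shows "F_fun l2 m1 m2 z \<noteq> 0"
proof
  assume F: "F_fun l2 m1 m2 z = 0"
  have e1: "1 / \<eta>1 > 1" using eta1_pos eta1_less_1 by simp
  have z0: "z > 1" using e1 z by linarith
  then have az: "\<bar>z\<bar> < 1 / bb1" using z by simp
  have "(z * sqrt (disc z)) * (z * sqrt (disc z)) > 0" using disc_pos(2)[OF az] z0 by (intro mult_pos_pos) auto
  then have "4 * (m2 * m2) * (z - 1) * ((1 - \<eta>1 * z) * (1 - \<eta>2 * z)) > 0"
    using kernel_at[of z] F az by simp
  moreover have "1 - \<eta>1 * z \<le> 0" using z(1) eta1_pos by (simp add: divide_le_eq mult.commute)
  moreover have "1 - \<eta>2 * z > 0"
  proof (cases "\<eta>2 > 0")
    case True
    then have "\<eta>2 * z < \<eta>2 * (1 / bb1)" using z by (intro mult_strict_left_mono) auto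
    also have "\<dots> < 1" using eta_order(1)[OF D] b_pos by simp
    finally show ?thesis by simp
  next
    case False
    then have "\<eta>2 * z \<le> 0" using z0 by (simp add: mult_le_0_iff)
    then show ?thesis by simp
  qed
  ultimately show False using z0 m2
    by (smt (verit, best) mult_nonneg_nonneg mult_nonneg_nonpos mult_nonneg_nonpos2)
qed

lemma F_sign_at_pole:
  assumes D: "D_const l1 l2 m1 m2 \<noteq> 0"
  shows "F_fun l2 m1 m2 (1 / \<eta>1) > 0 \<longleftrightarrow> D_const l1 l2 m1 m2 > 0"
proof -
  have lt: "1 / \<eta>1 < 1 / bb1" using eta_order(2)[OF D] b_pos by (simp add: frac_less2)
  have cont: "continuous_on {1 / \<eta>1..1 / bb1} (F_fun l2 m1 m2)"
    unfolding F_fun_def by (intro continuous_intros)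
  have nz: "F_fun l2 m1 m2 (1 / bb1) \<noteq> 0" using D F_z1_sign(3) by simp
  have nz': "F_fun l2 m1 m2 z \<noteq> 0" if "1 / \<eta>1 \<le> z" "z \<le> 1 / bb1" for z
    using F_nonzero[OF D, of z] nz that by (cases "z = 1 / bb1") auto
  have "F_fun l2 m1 m2 (1 / \<eta>1) > 0 \<longleftrightarrow> F_fun l2 m1 m2 (1 / bb1) > 0"
    using IVT'[OF _ _ less_imp_le[OF lt] cont, of 0] IVT2'[OF _ _ less_imp_le[OF lt] cont, of 0] nz' nz lt
    by (smt (verit))
  then show ?thesis using F_z1_sign by simp
qed

text \<open>
  At \<open>1 / \<eta>1\<close> one of \<open>z * S - F\<close> and \<open>z * S + F\<close> vanishes; as \<open>z * S > 0\<close>, the sign of \<open>F\<close> tells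
  which.
\<close>

lemma numerator_at_eta1:
  assumes D: "D_const l1 l2 m1 m2 \<noteq> 0"
  shows "(1 / \<eta>1) * sqrt (disc (1 / \<eta>1)) + F_fun l2 m1 m2 (1 / \<eta>1) =
    (if D_const l1 l2 m1 m2 > 0 then 2 * F_fun l2 m1 m2 (1 / \<eta>1) else 0)"
proof -
  have lt: "1 / \<eta>1 < 1 / bb1" using eta_order(2)[OF D] b_pos by (simp add: frac_less2)
  then have az: "\<bar>1 / \<eta>1\<bar> < 1 / bb1" using eta1_pos by simp
  have pos: "(1 / \<eta>1) * sqrt (disc (1 / \<eta>1)) > 0" using disc_pos(2)[OF az] eta1_pos by simp
  have "((1 / \<eta>1) * sqrt (disc (1 / \<eta>1)) - F_fun l2 m1 m2 (1 / \<eta>1)) *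
      ((1 / \<eta>1) * sqrt (disc (1 / \<eta>1)) + F_fun l2 m1 m2 (1 / \<eta>1)) = 0"
    using kernel_at[of "1 / \<eta>1"] az eta1_pos by simp
  then have "(1 / \<eta>1) * sqrt (disc (1 / \<eta>1)) = F_fun l2 m1 m2 (1 / \<eta>1) \<or>
      (1 / \<eta>1) * sqrt (disc (1 / \<eta>1)) = - F_fun l2 m1 m2 (1 / \<eta>1)"
    unfolding mult_eq_0_iff by linarith
  then show ?thesis using pos F_sign_at_pole[OF D] by (cases "D_const l1 l2 m1 m2 > 0") auto
qed

text \<open>
  Under these assumptions \<open>\<eta>2\<close> is negative, and for negative \<open>z\<close> the factor \<open>z * S - F\<close> is
  strictly negative.
\<close>

lemma numerator_at_eta2:
  assumes "bb1 \<le> \<bar>\<eta>2\<bar>" "\<eta>2 < bb1"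
  shows "(1 / \<eta>2) * sqrt (disc (1 / \<eta>2)) + F_fun l2 m1 m2 (1 / \<eta>2) = 0"
proof -
  define z where "z = 1 / \<eta>2"
  have e: "\<eta>2 < 0" using assms b_pos by linarith
  then have z: "z < 0" by (simp add: z_def)
  have az: "\<bar>z\<bar> \<le> 1 / bb1" using assms(1) b_pos by (simp add: z_def frac_le)
  define w s where "w = 1 - m2 - l2 * z" and "s = sqrt (disc z)"
  have "l2 * z < 0" using l2 z by (simp add: mult_less_0_iff)
  then have w: "w > l1 + m1" unfolding w_def using normalized l2 by linarith
  have "2 * m1 - w < s"
  proof (cases "2 * m1 - w < 0")
    case True
    then show ?thesis using disc_pos(1)[OF az] by (simp add: s_def less_le_trans[of _ 0])
  next
    case False
    have "m1 * (l1 + m1) < m1 * w" using w m1 by simp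
    then have "(2 * m1 - w)\<^sup>2 < disc z"
      unfolding disc_def w_def[symmetric] by (simp add: power2_eq_square algebra_simps)
    then show ?thesis unfolding s_def by (rule real_less_rsqrt)
  qed
  then have "z * (w + s - 2 * m1) < 0" using z by (simp add: mult_less_0_iff)
  moreover have "m2 * (z - 1) < 0" using z m2 by (simp add: mult_less_0_iff)
  moreover have "z * s - F_fun l2 m1 m2 z = z * (w + s - 2 * m1) + 2 * (m2 * (z - 1))"
    unfolding F_fun_def w_def by (simp add: power2_eq_square algebra_simps)
  ultimately have "z * s - F_fun l2 m1 m2 z \<noteq> 0" by linarith
  moreover have "(z * s - F_fun l2 m1 m2 z) * (z * s + F_fun l2 m1 m2 z) = 0"
    using kernel_at[OF az] e unfolding s_def z_def by simp
  ultimately show ?thesis unfolding z_def[symmetric] s_def[symmetric] by simp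
qed

text \<open>
  The product of the two characteristic roots is \<open>l1 / m1\<close>.
\<close>

lemma u_of_nonzero: "\<bar>z\<bar> \<le> 1 / bb1 \<Longrightarrow> u_of z \<noteq> 0"
proof
  assume z: "\<bar>z\<bar> \<le> 1 / bb1" and "u_of z = 0"
  then have "sqrt (disc z) = 1 - m2 - l2 * z" using m1 by (simp add: u_of_def)
  then have "disc z = (1 - m2 - l2 * z)\<^sup>2" using disc_pos(1)[OF z] by (metis real_sqrt_pow2)
  then show False using l1 m1 by (simp add: disc_def)
qed

end

section \<open>The three asymptotic regimes\<close>

lemma ratio_equivI:
  assumes "(\<lambda>n. f n / w n) \<longlonglongrightarrow> C" "C \<noteq> 0"
  shows "ratio_equiv f (\<lambda>n. C * w n)"
proof -
  have "(\<lambda>n. f n / w n / C) \<longlonglongrightarrow> C / C" using assms by (intro tendsto_divide tendsto_const)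
  then show ?thesis using assms(2) by (simp add: ratio_equiv_def mult.commute)
qed

context stationary_priority_queue
begin

lemma Y2_asymptotic:
  assumes "\<eta>2 < bb1" "sqrt_germ bb1 (numerator i) \<alpha> \<beta>"
  shows "(\<lambda>n. real n powr (3/2) * (Y2_fps i $ n / bb1 ^ n)) \<longlonglongrightarrow> - \<beta> / (2 * sqrt pi) / (1 - \<eta>2 / bb1)"
proof (rule quotient_coeff_asymptotic[OF b_pos(1) assms(2) Y_eqs(2)])
  show "\<eta>2 \<noteq> bb1" using assms by simp
  assume le: "bb1 \<le> \<bar>\<eta>2\<bar>"
  then have "\<bar>1 / \<eta>2\<bar> \<le> 1 / bb1" using b_pos by (simp add: frac_le)
  from eval_numerator[OF this, of i] show "eval_fps (numerator i) (1 / \<eta>2) = 0"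
    using numerator_at_eta2[OF le assms(1)] by (simp add: has_eval_def)
qed

text \<open>
  With \<open>N\<close> or more low-priority customers the server is not on vacation.
\<close>

lemma joint_prob_level: "eventually (\<lambda>n. joint_prob \<pi> i n = level i n) sequentially"
  using eventually_ge_at_top[of "max N 1"]
proof eventually_elim
  case (elim n)
  then show ?case
    by (cases i) (auto simp: joint_prob_def level_def prob_def queue_states_def)
qed

lemma level_scaled:
  "level i n / w = (\<eta>1 * (Y1_fps i $ n / w) - \<eta>2 * (Y2_fps i $ n / w)) / (2 * m2 * (\<eta>1 - \<eta>2))"
  unfolding level_partial_fractions by (simp add: diff_divide_distrib mult.commute)

lemma ratio_equiv_level:
  assumes "(\<lambda>n. level i n / w n) \<longlonglongrightarrow> C" "C \<noteq> 0"
  shows "ratio_equiv (joint_prob \<pi> i) (\<lambda>n. C * w n)"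
proof (rule ratio_equivI[OF _ assms(2)])
  have "\<forall>\<^sub>F n in sequentially. level i n / w n = joint_prob \<pi> i n / w n"
    using joint_prob_level[of i] by eventually_elim simp
  with assms(1) show "(\<lambda>n. joint_prob \<pi> i n / w n) \<longlonglongrightarrow> C" by (rule Lim_transform_eventually)
qed

lemma c_pos: "root_const * sqrt (1 - bb2 / bb1) > 0"
proof -
  have "1 - bb2 / bb1 > 0" using b_pos b2_less_b1 by simp
  then show ?thesis using L_pos by (simp add: root_const_def)
qed

lemma root_const_b: "root_const = l2 / sqrt (bb1 * bb2)"
proof -
  have "bb1 * bb2 = l2\<^sup>2 / (L1 * L2)" by (simp add: b_L power2_eq_square)
  then show ?thesis using l2 L_pos by (simp add: root_const_def real_sqrt_divide)
qed

lemma stable': "1 - rho1 l1 m1 - rho2 l2 m2 > 0" using stable by simp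

lemma beta_pos: "z > 0 \<Longrightarrow> beta_fun l1 l2 N z > 0"
  using H_pos[of z] H_pos[of 1] by (simp add: beta_fun_def)

lemma u0_pos: "sqrt (rho1 l1 m1) > 0" using l1 m1 by (simp add: rho1_def)

lemma a_const_eq: "a_const l1 l2 m1 m2 = (1 - rho1 l1 m1 - rho2 l2 m2) / (2 * m2) * (\<eta>1 / (\<eta>1 - \<eta>2))"
  by (simp add: a_const_def)

lemma a_pos: "a_const l1 l2 m1 m2 > 0"
  unfolding a_const_eq using stable' m2 eta1_pos eta2_less_eta1 by simp

text \<open>
  The point \<open>1 / \<eta>1\<close> is a simple pole strictly inside the branch point, and the \<open>\<eta>2\<close> part is of the
  smaller order \<open>n^(-3/2) * b1^n\<close>.
\<close>

lemma exact_geometric_decay: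
  assumes D: "D_const l1 l2 m1 m2 > 0"
  shows "ratio_equiv (joint_prob \<pi> i)
     (\<lambda>n. C_2l1 l1 l2 m1 m2 N * u_fun l1 l2 m1 m2 \<eta>1 ^ i * \<eta>1 ^ n)"
proof (rule ratio_equiv_level)
  have D0: "D_const l1 l2 m1 m2 \<noteq> 0" using D by simp
  note eta = eta_order[OF D0]
  define X where "X = 2 * F_fun l2 m1 m2 (1 / \<eta>1) * V_of (1 / \<eta>1) * u_of (1 / \<eta>1) ^ i"
  have "1 / \<eta>1 < 1 / bb1" using eta b_pos by (simp add: frac_less2)
  then have az: "\<bar>1 / \<eta>1\<bar> \<le> 1 / bb1" using eta1_pos by simp
  have ev: "has_eval (numerator i) (1 / \<eta>1) X"
    using eval_numerator[OF az, of i] numerator_at_eta1[OF D0] D by (simp add: X_def)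
  then have Y1: "(\<lambda>n. Y1_fps i $ n / \<eta>1 ^ n) \<longlonglongrightarrow> X"
    using quotient_simple_pole[OF Y_eqs(1)[of i]] eta1_pos by (simp add: has_eval_def)
  have Y2: "(\<lambda>n. Y2_fps i $ n / \<eta>1 ^ n) \<longlonglongrightarrow> 0"
  proof -
    obtain C where C: "(\<lambda>n. real n powr (3/2) * (Y2_fps i $ n / bb1 ^ n)) \<longlonglongrightarrow> C"
      using Y2_asymptotic[OF eta(1) germ_numerator] by blast
    have "(\<lambda>n. (bb1 / \<eta>1) ^ n) \<longlonglongrightarrow> 0"
      using eta b_pos by (intro LIMSEQ_realpow_zero) auto
    moreover have "(\<lambda>n. real n powr (- (3/2))) \<longlonglongrightarrow> 0"
      by (intro tendsto_neg_powr filterlim_real_sequentially) auto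
    ultimately have "(\<lambda>n. real n powr (3/2) * (Y2_fps i $ n / bb1 ^ n) * ((bb1 / \<eta>1) ^ n * real n powr (- (3/2)))) \<longlonglongrightarrow> C * (0 * 0)"
      by (intro tendsto_mult C)
    then have "(\<lambda>n. real n powr (3/2) * (Y2_fps i $ n / bb1 ^ n) * ((bb1 / \<eta>1) ^ n * real n powr (- (3/2)))) \<longlonglongrightarrow> 0" by simp
    moreover have "\<forall>\<^sub>F n in sequentially. real n powr (3/2) * (Y2_fps i $ n / bb1 ^ n) * ((bb1 / \<eta>1) ^ n * real n powr (- (3/2))) = Y2_fps i $ n / \<eta>1 ^ n"
      using eventually_gt_at_top[of 0]
    proof eventually_elim
      case (elim n)
      have "real n powr (3/2) * real n powr (- (3/2)) = 1"
        using elim by (subst powr_add[symmetric]) simp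
      moreover have "real n powr (3/2) * (Y2_fps i $ n / bb1 ^ n) * ((bb1 / \<eta>1) ^ n * real n powr (- (3/2))) =
         (real n powr (3/2) * real n powr (- (3/2))) * (Y2_fps i $ n / bb1 ^ n * (bb1 / \<eta>1) ^ n)"
        by (simp only: mult_ac)
      ultimately show ?case using b_pos by (simp add: power_divide)
    qed
    ultimately show ?thesis by (rule Lim_transform_eventually)
  qed
  have lim: "(\<lambda>n. (\<eta>1 * (Y1_fps i $ n / \<eta>1 ^ n) - \<eta>2 * (Y2_fps i $ n / \<eta>1 ^ n)) / (2 * m2 * (\<eta>1 - \<eta>2)))
     \<longlonglongrightarrow> (\<eta>1 * X - \<eta>2 * 0) / (2 * m2 * (\<eta>1 - \<eta>2))"
    using m2 eta2_less_eta1 by (intro tendsto_intros Y1 Y2) auto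
  have u: "u_of (1 / \<eta>1) = u_fun l1 l2 m1 m2 \<eta>1"
    by (simp add: u_of_def u_fun_def disc_def)
  have "(\<eta>1 * X - \<eta>2 * 0) / (2 * m2 * (\<eta>1 - \<eta>2)) = C_2l1 l1 l2 m1 m2 N * u_fun l1 l2 m1 m2 \<eta>1 ^ i"
    unfolding X_def V_beta u C_2l1_def a_const_eq by simp
  moreover have "(\<eta>1 * (Y1_fps i $ n / \<eta>1 ^ n) - \<eta>2 * (Y2_fps i $ n / \<eta>1 ^ n)) / (2 * m2 * (\<eta>1 - \<eta>2)) = level i n / \<eta>1 ^ n" for n
    by (rule level_scaled[symmetric])
  ultimately show "(\<lambda>n. level i n / \<eta>1 ^ n) \<longlonglongrightarrow> C_2l1 l1 l2 m1 m2 N * u_fun l1 l2 m1 m2 \<eta>1 ^ i"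
    using lim by simp
  show "C_2l1 l1 l2 m1 m2 N * u_fun l1 l2 m1 m2 \<eta>1 ^ i \<noteq> 0"
    using a_pos F_sign_at_pole[OF D0] D beta_pos[of "1 / \<eta>1"] eta1_pos u_of_nonzero[OF az]
    unfolding C_2l1_def u[symmetric] by simp
qed

text \<open>
  The pole \<open>1 / \<eta>1\<close> is at the branch point, and the numerator vanishes there because
  \<open>F (1 / b1) = 0\<close>.
\<close>

lemma critical_decay:
  assumes D: "D_const l1 l2 m1 m2 = 0"
  shows "ratio_equiv (joint_prob \<pi> i)
     (\<lambda>n. C_2l2 l1 l2 m1 m2 N * sqrt (rho1 l1 m1) ^ i * (real n powr (- 1 / 2) * bb1 ^ n))"
proof (rule ratio_equiv_level)
  have e1: "\<eta>1 = bb1" by (rule eta_critical[OF D])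
  then have e2: "\<eta>2 < bb1" using eta2_less_eta1 by simp
  define c where "c = root_const * sqrt (1 - bb2 / bb1)"
  define \<beta> where "\<beta> = c / bb1 * V_of (1 / bb1) * sqrt (rho1 l1 m1) ^ i"
  have germ: "sqrt_germ bb1 (numerator i) 0 \<beta>"
    using germ_numerator[of i] F_z1_sign(3) D by (simp add: \<beta>_def c_def)
  have Y1: "(\<lambda>n. sqrt (real n) * (Y1_fps i $ n / bb1 ^ n)) \<longlonglongrightarrow> \<beta> / sqrt pi"
    using quotient_critical[OF b_pos(1) germ] Y_eqs(1)[of i] e1 by simp
  have Y2: "(\<lambda>n. sqrt (real n) * (Y2_fps i $ n / bb1 ^ n)) \<longlonglongrightarrow> 0"
  proof -
    obtain C where C: "(\<lambda>n. real n powr (3/2) * (Y2_fps i $ n / bb1 ^ n)) \<longlonglongrightarrow> C"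
      using Y2_asymptotic[OF e2 germ] by blast
    have "(\<lambda>n. real n powr (- 1)) \<longlonglongrightarrow> 0"
      by (intro tendsto_neg_powr filterlim_real_sequentially) auto
    from tendsto_mult[OF this C]
    have "(\<lambda>n. real n powr (- 1) * (real n powr (3/2) * (Y2_fps i $ n / bb1 ^ n))) \<longlonglongrightarrow> 0" by simp
    moreover have "real n powr (- 1) * (real n powr (3/2) * (Y2_fps i $ n / bb1 ^ n)) = sqrt (real n) * (Y2_fps i $ n / bb1 ^ n)" for n
    proof -
      have "real n powr (- 1) * real n powr (3/2) = sqrt (real n)"
        by (subst powr_add[symmetric]) (simp add: powr_half_sqrt)
      then show ?thesis by (simp only: mult.assoc[symmetric])
    qed
    ultimately show ?thesis by simp
  qed
  have lim: "(\<lambda>n. (\<eta>1 * (sqrt (real n) * (Y1_fps i $ n / bb1 ^ n)) - \<eta>2 * (sqrt (real n) * (Y2_fps i $ n / bb1 ^ n))) / (2 * m2 * (\<eta>1 - \<eta>2)))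
     \<longlonglongrightarrow> (\<eta>1 * (\<beta> / sqrt pi) - \<eta>2 * 0) / (2 * m2 * (\<eta>1 - \<eta>2))"
    using m2 eta2_less_eta1 by (intro tendsto_intros Y1 Y2) auto
  have C: "(\<eta>1 * (\<beta> / sqrt pi) - \<eta>2 * 0) / (2 * m2 * (\<eta>1 - \<eta>2)) = C_2l2 l1 l2 m1 m2 N * sqrt (rho1 l1 m1) ^ i"
    unfolding \<beta>_def c_def root_const_b V_beta C_2l2_def a_const_eq by (simp add: mult_ac)
  have "\<forall>\<^sub>F n in sequentially. (\<eta>1 * (sqrt (real n) * (Y1_fps i $ n / bb1 ^ n)) - \<eta>2 * (sqrt (real n) * (Y2_fps i $ n / bb1 ^ n))) / (2 * m2 * (\<eta>1 - \<eta>2))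
     = level i n / (real n powr (- 1 / 2) * bb1 ^ n)"
    using eventually_gt_at_top[of 0]
  proof eventually_elim
    case (elim n)
    have p: "real n powr (- 1 / 2) = 1 / sqrt (real n)"
      using elim by (simp add: powr_minus_divide powr_half_sqrt)
    have "y / (1 / s * bb1 ^ n) = s * (y / bb1 ^ n)" for y s :: real by simp
    then show ?case unfolding level_scaled p by (simp only:)
  qed
  from Lim_transform_eventually[OF lim this]
  show "(\<lambda>n. level i n / (real n powr (- 1 / 2) * bb1 ^ n)) \<longlonglongrightarrow> C_2l2 l1 l2 m1 m2 N * sqrt (rho1 l1 m1) ^ i"
    unfolding C .
  have "\<beta> > 0" unfolding \<beta>_def c_def V_beta using c_pos b_pos stable' beta_pos[of "1 / bb1"] u0_pos by simp
  then show "C_2l2 l1 l2 m1 m2 N * sqrt (rho1 l1 m1) ^ i \<noteq> 0"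
    unfolding C[symmetric] using e1 b_pos m2 eta2_less_eta1 by simp
qed

text \<open>
  This is how \<open>B\<close> arises from the expansion of the numerator.  Since \<open>F (1 / b1)\<close> has the sign
  of \<open>D\<close>, it also gives \<open>B > 0\<close> for \<open>D < 0\<close>.
\<close>

lemma B_tilde_eq_F:
  "B_tilde l1 l2 m1 m2 = - (F_fun l2 m1 m2 (1 / bb1) * bb1 / (2 * sqrt (l1 * m1)))"
proof -
  have L: "L1 = l1 + l2 + m1 - 2 * sqrt (l1 * m1)" using normalized by (simp add: L_eqs)
  have "L1 * (F_fun l2 m1 m2 (1 / bb1) * bb1) = 2 * D_const l1 l2 m1 m2"
    using F_z1 L_pos by (simp add: b_L mult.commute)
  also have "\<dots> = L1 * (2 * (m1 - m2 - sqrt (l1 * m1) + m2 * bb1))"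
    using L_pos unfolding D_const_def L[symmetric] b_L by (simp add: algebra_simps)
  finally have "F_fun l2 m1 m2 (1 / bb1) * bb1 = 2 * (m1 - m2 - sqrt (l1 * m1) + m2 * bb1)" using L_pos by simp
  then have "F_fun l2 m1 m2 (1 / bb1) * bb1 / (2 * sqrt (l1 * m1)) = (m1 - m2 - sqrt (l1 * m1) + m2 * bb1) / sqrt (l1 * m1)"
    by (simp only: mult_divide_mult_cancel_left)
  moreover have "m2 - m1 - m2 * bb1 + sqrt (l1 * m1) = - (m1 - m2 - sqrt (l1 * m1) + m2 * bb1)" by simp
  ultimately show ?thesis unfolding B_tilde_def by (simp only: minus_divide_left)
qed

text \<open>
  Both partial fractions have the order of the branch-point singularity, and their sum does not cancel:
  \<open>\<eta>1 / (\<eta>1 - b1) - \<eta>2 / (\<eta>2 - b1)\<close> is positive since \<open>\<eta>2 < b1 < \<eta>1\<close>.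
\<close>

lemma subcritical_decay:
  assumes D: "D_const l1 l2 m1 m2 < 0"
  shows "ratio_equiv (joint_prob \<pi> i)
     (\<lambda>n. C_2l3 l1 l2 m1 m2 N * (1 + real i * B_tilde l1 l2 m1 m2) * sqrt (rho1 l1 m1) ^ i * (real n powr (- 3 / 2) * bb1 ^ n))"
proof (rule ratio_equiv_level)
  have D0: "D_const l1 l2 m1 m2 \<noteq> 0" using D by simp
  note eta = eta_order[OF D0]
  define u0 where "u0 = sqrt (rho1 l1 m1)"
  define c where "c = root_const * sqrt (1 - bb2 / bb1)"
  define f where "f = F_fun l2 m1 m2 (1 / bb1)"
  define v where "v = V_of (1 / bb1)"
  define B where "B = B_tilde l1 l2 m1 m2"
  define \<beta> where "\<beta> = c / bb1 * v * u0 ^ i * (1 + real i * B)"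
  have u0: "u0 > 0" using u0_pos by (simp add: u0_def)
  have u0m: "u0 * m1 = sqrt (l1 * m1)"
  proof -
    have "u0 * sqrt m1 = sqrt l1" using m1 by (simp add: u0_def rho1_def real_sqrt_divide)
    moreover have "u0 * m1 = u0 * sqrt m1 * sqrt m1" using m1 by simp
    ultimately show ?thesis by (simp only: real_sqrt_mult)
  qed
  have B: "B = - (f * bb1 / (2 * (u0 * m1)))" unfolding B_def B_tilde_eq_F f_def u0m ..
  have germ: "sqrt_germ bb1 (numerator i) (f * v * u0 ^ i) \<beta>"
  proof -
    have "f * v * (real i * u0 ^ (i - 1) * (- c / (2 * m1))) + c / bb1 * v * u0 ^ i = \<beta>"
    proof (cases i)
      case 0
      then show ?thesis by (simp add: \<beta>_def)
    next
      case (Suc k)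
      have "c / bb1 * v * u0 ^ i * (real i * B) = f * v * (real i * u0 ^ (i - 1) * (- c / (2 * m1)))"
        unfolding B Suc using u0 b_pos by simp
      then show ?thesis unfolding \<beta>_def by (simp add: distrib_left)
    qed
    then show ?thesis using germ_numerator[of i] unfolding f_def v_def u0_def c_def by simp
  qed
  have Y1: "(\<lambda>n. real n powr (3/2) * (Y1_fps i $ n / bb1 ^ n)) \<longlonglongrightarrow> - \<beta> / (2 * sqrt pi) / (1 - \<eta>1 / bb1)"
  proof (rule quotient_coeff_asymptotic[OF b_pos(1) germ Y_eqs(1)])
    show "\<eta>1 \<noteq> bb1" using eta by simp
    have "1 / \<eta>1 < 1 / bb1" using eta b_pos by (simp add: frac_less2)
    then have "\<bar>1 / \<eta>1\<bar> \<le> 1 / bb1" using eta1_pos by simp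
    from eval_numerator[OF this, of i] show "eval_fps (numerator i) (1 / \<eta>1) = 0"
      using numerator_at_eta1[OF D0] D by (simp add: has_eval_def)
  qed
  note Y2 = Y2_asymptotic[OF eta(1) germ]
  define y1 where "y1 = - \<beta> / (2 * sqrt pi) / (1 - \<eta>1 / bb1)"
  define y2 where "y2 = - \<beta> / (2 * sqrt pi) / (1 - \<eta>2 / bb1)"
  have lim: "(\<lambda>n. (\<eta>1 * (real n powr (3/2) * (Y1_fps i $ n / bb1 ^ n)) - \<eta>2 * (real n powr (3/2) * (Y2_fps i $ n / bb1 ^ n))) / (2 * m2 * (\<eta>1 - \<eta>2)))
     \<longlonglongrightarrow> (\<eta>1 * y1 - \<eta>2 * y2) / (2 * m2 * (\<eta>1 - \<eta>2))"
    unfolding y1_def y2_def using m2 eta2_less_eta1 by (intro tendsto_divide tendsto_diff tendsto_mult tendsto_const Y1 Y2) auto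
  have sigma: "sigma_fun l1 l2 m1 \<eta> = c / (2 * sqrt pi * (\<eta> - bb1))" for \<eta>
    unfolding sigma_fun_def K_fun_def c_def root_const_b using b_pos by (simp add: mult_ac)
  have y: "- \<beta> / (2 * sqrt pi) / (1 - \<eta> / bb1) = \<beta> * bb1 / (2 * sqrt pi * (\<eta> - bb1))" if "\<eta> \<noteq> bb1" for \<eta>
  proof -
    have "1 - \<eta> / bb1 = - ((\<eta> - bb1) / bb1)" using b_pos by (simp add: diff_divide_distrib)
    then show ?thesis by simp
  qed
  have \<beta>b: "\<beta> * bb1 = c * v * u0 ^ i * (1 + real i * B)" using b_pos by (simp add: \<beta>_def)
  have C: "(\<eta>1 * y1 - \<eta>2 * y2) / (2 * m2 * (\<eta>1 - \<eta>2)) =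
     C_2l3 l1 l2 m1 m2 N * (1 + real i * B_tilde l1 l2 m1 m2) * sqrt (rho1 l1 m1) ^ i"
  proof -
    define k where "k = 1 - rho1 l1 m1 - rho2 l2 m2"
    define h where "h = beta_fun l1 l2 N (1 / bb1)"
    have v: "v = k * h" by (simp add: v_def k_def h_def V_beta)
    have bc: "b_const l1 l2 m1 m2 = - (k / (2 * m2) * (\<eta>2 / (\<eta>1 - \<eta>2)))"
      unfolding b_const_def k_def[symmetric] minus_mult_right minus_divide_right minus_diff_eq ..
    have "C_2l3 l1 l2 m1 m2 N * (1 + real i * B) * u0 ^ i =
       (k / (2 * m2) * (\<eta>1 / (\<eta>1 - \<eta>2)) * (c / (2 * sqrt pi * (\<eta>1 - bb1)))
         - k / (2 * m2) * (\<eta>2 / (\<eta>1 - \<eta>2)) * (c / (2 * sqrt pi * (\<eta>2 - bb1)))) * h * (1 + real i * B) * u0 ^ i"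
      unfolding C_2l3_def sigma a_const_eq bc k_def[symmetric] h_def[symmetric] by simp
    also have "\<dots> = (\<eta>1 * (c * v * u0 ^ i * (1 + real i * B) / (2 * sqrt pi * (\<eta>1 - bb1)))
        - \<eta>2 * (c * v * u0 ^ i * (1 + real i * B) / (2 * sqrt pi * (\<eta>2 - bb1)))) / (2 * m2 * (\<eta>1 - \<eta>2))"
      unfolding v left_diff_distrib diff_divide_distrib times_divide_eq_left times_divide_eq_right divide_divide_eq_left
      by (simp only: mult_ac)
    also have "\<dots> = (\<eta>1 * y1 - \<eta>2 * y2) / (2 * m2 * (\<eta>1 - \<eta>2))"
      unfolding y1_def y2_def using y[of \<eta>1] y[of \<eta>2] eta unfolding \<beta>b by simp
    finally show ?thesis unfolding B_def u0_def ..
  qed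
  have "\<forall>\<^sub>F n in sequentially. (\<eta>1 * (real n powr (3/2) * (Y1_fps i $ n / bb1 ^ n)) - \<eta>2 * (real n powr (3/2) * (Y2_fps i $ n / bb1 ^ n))) / (2 * m2 * (\<eta>1 - \<eta>2))
     = level i n / (real n powr (- 3 / 2) * bb1 ^ n)"
    using eventually_gt_at_top[of 0]
  proof eventually_elim
    case (elim n)
    have p: "real n powr (- 3 / 2) = 1 / real n powr (3/2)"
      using elim by (simp add: powr_minus_divide)
    have "y / (1 / s * bb1 ^ n) = s * (y / bb1 ^ n)" for y s :: real by simp
    then show ?case unfolding level_scaled p by (simp only:)
  qed
  from Lim_transform_eventually[OF lim this]
  show "(\<lambda>n. level i n / (real n powr (- 3 / 2) * bb1 ^ n)) \<longlonglongrightarrow>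
     C_2l3 l1 l2 m1 m2 N * (1 + real i * B_tilde l1 l2 m1 m2) * sqrt (rho1 l1 m1) ^ i"
    unfolding C .
  have "f < 0" using F_z1_sign(2) D by (simp add: f_def)
  then have "B > 0" unfolding B using u0 m1 b_pos by (simp add: mult_neg_pos divide_neg_pos)
  then have "1 + real i * B > 0" by (simp add: add_pos_nonneg)
  then have \<beta>: "\<beta> > 0"
    unfolding \<beta>_def c_def v_def V_beta using c_pos b_pos stable' beta_pos[of "1 / bb1"] u0 by simp
  have "y1 > 0" unfolding y1_def using y[of \<eta>1] eta \<beta> b_pos by simp
  have "\<eta>1 * y1 - \<eta>2 * y2 > 0"
  proof (cases "\<eta>2 \<ge> 0")
    case True
    have "y2 < 0" unfolding y2_def using y[of \<eta>2] eta \<beta> b_pos by (simp add: divide_pos_neg mult_pos_neg)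
    then have "\<eta>2 * y2 \<le> 0" using True by (simp add: mult_le_0_iff)
    then show ?thesis using \<open>y1 > 0\<close> eta1_pos by (smt (verit) mult_pos_pos)
  next
    case False
    have e: "\<eta>1 * y1 - \<eta>2 * y2 = \<beta> * bb1 / (2 * sqrt pi) * (\<eta>1 / (\<eta>1 - bb1) - \<eta>2 / (\<eta>2 - bb1))"
      unfolding y1_def y2_def using y[of \<eta>1] y[of \<eta>2] eta by (simp add: right_diff_distrib mult_ac)
    have "\<eta>1 / (\<eta>1 - bb1) > 1" using eta b_pos by (simp add: less_divide_eq)
    moreover have "\<eta>2 / (\<eta>2 - bb1) < 1" using eta b_pos by (simp add: divide_less_eq)
    ultimately show ?thesis unfolding e using \<beta> b_pos by (intro mult_pos_pos) auto
  qed
  then show "C_2l3 l1 l2 m1 m2 N * (1 + real i * B_tilde l1 l2 m1 m2) * sqrt (rho1 l1 m1) ^ i \<noteq> 0"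
    unfolding C[symmetric] using m2 eta2_less_eta1 by simp
qed

end

theorem theorem4:
  fixes l1 l2 m1 m2 :: real and N :: nat and \<pi> :: "state \<Rightarrow> real" and i :: nat
  assumes "N \<ge> 1"
    and "l1 > 0" and "l2 > 0" and "m1 > 0" and "m2 > 0"
    and "rho1 l1 m1 + rho2 l2 m2 < 1"
    and "l1 + l2 + m1 + m2 = 1"
    and "queue_stationary l1 l2 m1 m2 N \<pi>"
  shows
    "(D_const l1 l2 m1 m2 > 0 \<longrightarrow>
        ratio_equiv (\<lambda>n. joint_prob \<pi> i n)
          (\<lambda>n. C_2l1 l1 l2 m1 m2 N * u_fun l1 l2 m1 m2 (eta1 l2 m1 m2) ^ i * eta1 l2 m1 m2 ^ n)) \<and>
     (D_const l1 l2 m1 m2 = 0 \<longrightarrow>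
        ratio_equiv (\<lambda>n. joint_prob \<pi> i n)
          (\<lambda>n. C_2l2 l1 l2 m1 m2 N * sqrt (rho1 l1 m1) ^ i
                * real n powr (- 1 / 2) * b1 l1 l2 m1 ^ n)) \<and>
     (D_const l1 l2 m1 m2 < 0 \<longrightarrow>
        ratio_equiv (\<lambda>n. joint_prob \<pi> i n)
          (\<lambda>n. C_2l3 l1 l2 m1 m2 N * (1 + real i * B_tilde l1 l2 m1 m2) * sqrt (rho1 l1 m1) ^ i
                * real n powr (- 3 / 2) * b1 l1 l2 m1 ^ n))"
proof -
  interpret stationary_priority_queue l1 l2 m1 m2 N \<pi>
    using assms by unfold_locales
  show ?thesis
    using exact_geometric_decay[of i] critical_decay[of i] subcritical_decay[of i]
    by (simp only: mult.assoc) blast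
qed

end
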